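(* Let $\beta,L>0$. Let $X=\{X(t),t\in\mathbb{R}^d\}$ be a real process in $\mathbb{H}$ which has mean zero and is second-order stationary with stationary covariance operator $C$ and spectral density $f\in\mathcal{P}_C(\beta,L)$, observed on the grid $\mathbb{T}_n=\prod_{\ell=1}^d\{\delta_n,2\delta_n,\dots,n_\ell\delta_n\}$, where $n_\ell\to\infty$ for each $\ell$, and let $\hat f_n(\theta)$ be the estimator in the context. Assume: (Covariance) $\int_{\mathbb{R}^d}\|C(h)\|_{\rm tr}\,dh<\infty$, and there are $\gamma\in(0,1]$ and a finite constant $\kappa$ such that $\int_{\mathbb{R}^d}\sup_{y:\|x-y\|_2\le\delta}\|C(y)-C(x)\|_{\rm tr}\,dx\le\kappa\,\delta^\gamma$ for all $\delta\in(0,1)$. (Kernel) $K:\mathbb{R}^d\to[0,\infty)$ is continuous; $S_K=\{t:K(t)>0\}$ is bounded and contains $0$; $\sup_u K(u)=K(0)=1$; for some $\epsilon>0$, $K$ is differentiable on $\{\|u\|_2<\epsilon\}$ with $\sup_{\|u\|_2<\epsilon}\|\nabla K(u)\|_2<\infty$; and for some integer $\lambda>0\vee(\beta-1)$, $$\partial^{\alpha}K(0)=0\ \text{ for all }\alpha\in\mathbb{Z}_+^d\text{ with }1\le|\alpha|\le\lambda,\qquad \sup_h|\partial^\alpha K(h)|<\infty\ \text{ for all }\alpha\text{ with }|\alpha|=\lambda+1,$$ where $|\alpha|=\sum_i\alpha_i$. (Sampling) $\delta_n\to0$, $|T_n|\to\infty$, and $T_n/|T_n|^{1/d}\to T$ in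 the Hausdorff metric for some fixed bounded convex set $T$ with non-empty interior. (Fourth order) (a) $\mathbb{E}\|X(t)\|^4<\infty$ for all $t$; (b) ${\rm cum}(X(t+\tau),X(s+\tau),X(w+\tau),X(v+\tau))={\rm cum}(X(t),X(s),X(w),X(v))$ for all $t,s,w,v,\tau\in\mathbb{R}^d$; (c) for some small enough $\delta>0$, with $B(0,\delta)$ the ball of radius $\delta$ centered at $0$, $$\sup_{w\in\mathbb{R}^d}\int_{\mathbb{R}^d}\int_{\mathbb{R}^d}\ \sup_{\lambda_1,\lambda_2,\lambda_3\in B(0,\delta)}\big|{\rm cum}(X(\lambda_1+u),X(\lambda_2+v),X(\lambda_3+w),X(0))\big|\,dv\,du<\infty.$$ (Bandwidth) $\Delta_n\to\infty$, $\Delta_n\cdot S_K\subset T_n-T_n$ for all $n$, and $\Delta_n^d/|T_n|\to0$. Then, for every bounded $\Theta\subset\mathbb{R}^d$, $$\sup_{\theta\in\Theta}\|\mathbb{E}\hat f_n(\theta)-f(\theta)\|_{\rm HS}=\mathcal{O}(\delta_n^\gamma+\Delta_n^{-\beta}),\qquad n\to\infty.$$ Moreover, with the choice $\Delta_n=|T_n|^{1/(2\beta+d)}$, $$\sup_{\theta\in\Theta}\Big(\mathbb{E}\|\hat f_n(\theta)-f(\theta)\|_{\rm HS}^2\Big)^{1/2}=\mathcal{O}\Big(\delta_n^\gamma\vee|T_n|^{-\beta/(2\beta+d)}\Big).$$ (The implied constants may depend on the process, i.e. no uniformity over $\mathcal{P}_C(\beta,L)$ is claimed.)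
   Context: $\mathbb{H}$ is a separable complex Hilbert space with inner product $\langle\cdot,\cdot\rangle$ (linear in the first argument) and norm $\|\cdot\|$. Fix a complete orthonormal system $\{e_j\}$ of $\mathbb{H}$ (the "real" CONS); $x\in\mathbb{H}$ is real if all $\langle x,e_j\rangle$ are real, and $\overline{x}=\sum_j\overline{\langle x,e_j\rangle}e_j$. A process is real if all its values are real elements of $\mathbb{H}$. $x\otimes y$ is the operator $z\mapsto x\langle z,y\rangle$. $\|\cdot\|_{\rm tr}$, $\|\cdot\|_{\rm HS}$ are the trace and Hilbert–Schmidt norms and $\langle\cdot,\cdot\rangle_{\rm HS}$ the Hilbert–Schmidt inner product. A real zero-mean process with $\mathbb{E}\|X(t)\|^2<\infty$ is second-order stationary if $C(h):=\mathbb{E}[X(t+h)\otimes X(t)]$ does not depend on $t$; its spectral density is $f(\theta)=(2\pi)^{-d}\int_{\mathbb{R}^d}e^{\mathrm{i}h^\top\theta}C(h)\,dh$. Power-law class: $\mathcal{P}_C(\beta,L)$ is the set of spectral densities $f(\theta)=(2\pi)^{-d}\int_{\mathbb{R}^d}e^{\mathrm{i}x^\top\theta}C(x)\,dx$ with $\int_{\mathbb{R}^d}(1+\|x\|_2^\beta)\|C(x)\|_{\rm tr}\,dx\le L$. Fourth-order cumulant of zero-mean $\mathbb{H}$-valued random elements: $${\rm cum}(Y_1,Y_2,Y_3,Y_4)=\mathbb{E}\langle Y_1\otimes Y_2,Y_3\otimes Y_4\rangle_{\rm HS}-\langle\mathbb{E}(Y_1\otimes Y_2),\mathbb{E}(Y_3\otimes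 Y_4)\rangle_{\rm HS}-\mathbb{E}\langle Y_1,Y_3\rangle\,\mathbb{E}\langle Y_4,Y_2\rangle-\langle\mathbb{E}(Y_1\otimes\overline{Y_4}),\mathbb{E}(Y_3\otimes\overline{Y_2})\rangle_{\rm HS}.$$ Estimator: with $T_n=\prod_{\ell=1}^d[0,n_\ell\delta_n]$ and $|\cdot|$ Lebesgue measure, $$\hat f_n(\theta)=\frac{\delta_n^{2d}}{(2\pi)^d}\sum_{t\in\mathbb{T}_n}\sum_{s\in\mathbb{T}_n}e^{\mathrm{i}(t-s)^\top\theta}\frac{X(t)\otimes X(s)}{|T_n\cap(T_n-(t-s))|}K\Big(\frac{t-s}{\Delta_n}\Big),$$ where terms with $K((t-s)/\Delta_n)=0$ are read as $0$. $A-B=\{a-b:a\in A,b\in B\}$. *)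

theory Defs
  imports "HOL-Probability.Probability"
begin

section \<open>Separable complex Hilbert spaces\<close>

text \<open>Separability is second countability; completeness comes from \<^class>\<open>banach\<close>. The inner
  product is linear in its first argument.\<close>

class separable_chilbert = banach + second_countable_topology +
  fixes scaleC :: "complex \<Rightarrow> 'a \<Rightarrow> 'a"  (infixr \<open>*\<^sub>C\<close> 75)
    and cinner :: "'a \<Rightarrow> 'a \<Rightarrow> complex"
  assumes scaleC_add_right: "a *\<^sub>C (x + y) = a *\<^sub>C x + a *\<^sub>C y"
    and scaleC_add_left: "(a + b) *\<^sub>C x = a *\<^sub>C x + b *\<^sub>C x"
    and scaleC_scaleC: "a *\<^sub>C b *\<^sub>C x = (a * b) *\<^sub>C x"
    and scaleR_scaleC: "r *\<^sub>R x = complex_of_real r *\<^sub>C x"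
    and cinner_commute: "cinner x y = cnj (cinner y x)"
    and cinner_add_left: "cinner (x + y) z = cinner x z + cinner y z"
    and cinner_scaleC_left: "cinner (a *\<^sub>C x) y = a * cinner x y"
    and cinner_self: "cinner x x = complex_of_real ((norm x)\<^sup>2)"

definition is_cons :: "'h::separable_chilbert set \<Rightarrow> bool" where
  "is_cons E \<longleftrightarrow>
     (\<forall>e\<in>E. \<forall>e'\<in>E. cinner e e' = (if e = e' then 1 else 0)) \<and>
     (\<forall>x. (\<forall>e\<in>E. cinner x e = 0) \<longrightarrow> x = 0)"

definition is_real :: "'h::separable_chilbert set \<Rightarrow> 'h \<Rightarrow> bool" where
  "is_real E x \<longleftrightarrow> (\<forall>e\<in>E. cinner x e \<in> \<real>)"

definition conj_wrt :: "'h::separable_chilbert set \<Rightarrow> 'h \<Rightarrow> 'h" where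
  "conj_wrt E x = (\<Sum>\<^sub>\<infinity>e\<in>E. cnj (cinner x e) *\<^sub>C e)"


section \<open>Operators, trace norm and Hilbert--Schmidt norm\<close>

definition tensor :: "'h::separable_chilbert \<Rightarrow> 'h \<Rightarrow> 'h \<Rightarrow> 'h" where
  "tensor x y = (\<lambda>z. cinner z y *\<^sub>C x)"

definition bounded_clinear :: "('h::separable_chilbert \<Rightarrow> 'h) \<Rightarrow> bool" where
  "bounded_clinear A \<longleftrightarrow> bounded_linear A \<and> (\<forall>c x. A (c *\<^sub>C x) = c *\<^sub>C A x)"

definition positive_op :: "('h::separable_chilbert \<Rightarrow> 'h) \<Rightarrow> bool" where
  "positive_op A \<longleftrightarrow> (\<forall>x. cinner (A x) x \<in> \<real> \<and> 0 \<le> Re (cinner (A x) x))"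

definition cadjoint :: "('h::separable_chilbert \<Rightarrow> 'h) \<Rightarrow> 'h \<Rightarrow> 'h" where
  "cadjoint A = (THE A'. \<forall>x y. cinner (A x) y = cinner x (A' y))"

text \<open>The absolute value \<open>|A| = (A\<^sup>* A)\<^sup>1\<^sup>/\<^sup>2\<close>, i.e. the unique positive square root of \<open>A\<^sup>* A\<close>.\<close>

definition op_abs :: "('h::separable_chilbert \<Rightarrow> 'h) \<Rightarrow> 'h \<Rightarrow> 'h" where
  "op_abs A = (THE B. bounded_clinear B \<and> positive_op B \<and> B \<circ> B = cadjoint A \<circ> A)"

definition esqrt :: "ennreal \<Rightarrow> ennreal" where
  "esqrt x = (if x = \<infinity> then \<infinity> else ennreal (sqrt (enn2real x)))"

text \<open>Both norms are extended-real valued, and infinite for operators outside the class.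
  They are evaluated in the complete orthonormal system \<open>E\<close>, on which they do not depend.\<close>

definition trace_norm :: "'h::separable_chilbert set \<Rightarrow> ('h \<Rightarrow> 'h) \<Rightarrow> ennreal" where
  "trace_norm E A =
     (if bounded_clinear A then (\<Sum>\<^sub>\<infinity>e\<in>E. ennreal (Re (cinner (op_abs A e) e))) else \<infinity>)"

definition hs_norm :: "'h::separable_chilbert set \<Rightarrow> ('h \<Rightarrow> 'h) \<Rightarrow> ennreal" where
  "hs_norm E A =
     (if bounded_clinear A then esqrt (\<Sum>\<^sub>\<infinity>e\<in>E. ennreal ((norm (A e))\<^sup>2)) else \<infinity>)"

definition hs_inner :: "'h::separable_chilbert set \<Rightarrow> ('h \<Rightarrow> 'h) \<Rightarrow> ('h \<Rightarrow> 'h) \<Rightarrow> complex" where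
  "hs_inner E A B = (\<Sum>\<^sub>\<infinity>e\<in>E. cinner (A e) (B e))"

text \<open>Integrals of operator-valued functions are taken in the strong sense. For
  Bochner-integrable functions with values in the trace class or in the Hilbert--Schmidt class
  this is the Bochner integral.\<close>

definition op_integral :: "'a measure \<Rightarrow> ('a \<Rightarrow> 'h \<Rightarrow> 'h) \<Rightarrow> 'h \<Rightarrow> 'h::separable_chilbert" where
  "op_integral M A = (\<lambda>z. \<integral>\<omega>. A \<omega> z \<partial>M)"

text \<open>Bochner integrability in the trace class: since that space is separable, measurability
  may be tested pointwise.\<close>

definition trace_integrable ::
  "'h::separable_chilbert set \<Rightarrow> 'a measure \<Rightarrow> ('a \<Rightarrow> 'h \<Rightarrow> 'h) \<Rightarrow> bool" where
  "trace_integrable E M A \<longleftrightarrow>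
     (\<forall>z. (\<lambda>x. A x z) \<in> borel_measurable M) \<and> (\<integral>\<^sup>+x. trace_norm E (A x) \<partial>M) < \<infinity>"


section \<open>Processes, spectral densities, cumulants\<close>

definition so_stationary ::
  "'w measure \<Rightarrow> (real^'d \<Rightarrow> 'w \<Rightarrow> 'h::separable_chilbert) \<Rightarrow> (real^'d \<Rightarrow> 'h \<Rightarrow> 'h) \<Rightarrow> bool" where
  "so_stationary M X C \<longleftrightarrow>
     (\<forall>t h. op_integral M (\<lambda>\<omega>. tensor (X (t + h) \<omega>) (X t \<omega>)) = C h)"

definition spectral_density ::
  "(real^'d \<Rightarrow> 'h \<Rightarrow> 'h::separable_chilbert) \<Rightarrow> real^'d \<Rightarrow> 'h \<Rightarrow> 'h" where
  "spectral_density C \<theta> =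
     op_integral lebesgue
       (\<lambda>h z. (cis (h \<bullet> \<theta>) / complex_of_real ((2 * pi) ^ CARD('d))) *\<^sub>C C h z)"

text \<open>Membership of \<open>f\<close> in the power-law class, where \<open>C\<close> is the covariance whose spectral density
  \<open>f\<close> is; the defining bound is a condition on that covariance.\<close>

definition in_power_law_class ::
  "'h::separable_chilbert set \<Rightarrow> real \<Rightarrow> real \<Rightarrow> (real^'d \<Rightarrow> 'h \<Rightarrow> 'h) \<Rightarrow> (real^'d \<Rightarrow> 'h \<Rightarrow> 'h) \<Rightarrow> bool"
where
  "in_power_law_class E \<beta> L C f \<longleftrightarrow>
     f = spectral_density C \<and>
     (\<integral>\<^sup>+x. ennreal (1 + norm x powr \<beta>) * trace_norm E (C x) \<partial>lebesgue) \<le> ennreal L"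

definition cum4 ::
  "'h::separable_chilbert set \<Rightarrow> 'w measure \<Rightarrow>
    ('w \<Rightarrow> 'h) \<Rightarrow> ('w \<Rightarrow> 'h) \<Rightarrow> ('w \<Rightarrow> 'h) \<Rightarrow> ('w \<Rightarrow> 'h) \<Rightarrow> complex" where
  "cum4 E M Y1 Y2 Y3 Y4 =
     (\<integral>\<omega>. hs_inner E (tensor (Y1 \<omega>) (Y2 \<omega>)) (tensor (Y3 \<omega>) (Y4 \<omega>)) \<partial>M)
     - hs_inner E (op_integral M (\<lambda>\<omega>. tensor (Y1 \<omega>) (Y2 \<omega>)))
                  (op_integral M (\<lambda>\<omega>. tensor (Y3 \<omega>) (Y4 \<omega>)))
     - (\<integral>\<omega>. cinner (Y1 \<omega>) (Y3 \<omega>) \<partial>M) * (\<integral>\<omega>. cinner (Y4 \<omega>) (Y2 \<omega>) \<partial>M)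
     - hs_inner E (op_integral M (\<lambda>\<omega>. tensor (Y1 \<omega>) (conj_wrt E (Y4 \<omega>))))
                  (op_integral M (\<lambda>\<omega>. tensor (Y3 \<omega>) (conj_wrt E (Y2 \<omega>))))"


section \<open>Sampling region and estimator\<close>

definition grid :: "('d::finite \<Rightarrow> nat) \<Rightarrow> real \<Rightarrow> (real^'d) set" where
  "grid N \<delta> = {t. \<forall>l. \<exists>k\<in>{1..N l}. t $ l = real k * \<delta>}"

definition region :: "('d::finite \<Rightarrow> nat) \<Rightarrow> real \<Rightarrow> (real^'d) set" where
  "region N \<delta> = {t. \<forall>l. t $ l \<in> {0..real (N l) * \<delta>}}"

definition set_diff :: "'a::minus set \<Rightarrow> 'a set \<Rightarrow> 'a set" where
  "set_diff A B = {a - b | a b. a \<in> A \<and> b \<in> B}"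

text \<open>A summand whose kernel factor vanishes is \<open>0\<close>, whatever the value of the quotient.\<close>

definition spec_estimator ::
  "(real^'d \<Rightarrow> 'w \<Rightarrow> 'h::separable_chilbert) \<Rightarrow> (real^'d \<Rightarrow> real) \<Rightarrow> ('d \<Rightarrow> nat) \<Rightarrow> real \<Rightarrow> real \<Rightarrow>
    real^'d \<Rightarrow> 'w \<Rightarrow> 'h \<Rightarrow> 'h" where
  "spec_estimator X K N \<delta> \<Delta> \<theta> \<omega> = (\<lambda>z.
     complex_of_real (\<delta> ^ (2 * CARD('d)) / (2 * pi) ^ CARD('d)) *\<^sub>C
     (\<Sum>t\<in>grid N \<delta>. \<Sum>s\<in>grid N \<delta>.
        (cis ((t - s) \<bullet> \<theta>) *
         complex_of_real (K ((t - s) /\<^sub>R \<Delta>) /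
           measure lebesgue (region N \<delta> \<inter> (\<lambda>x. x - (t - s)) ` region N \<delta>))) *\<^sub>C
        tensor (X t \<omega>) (X s \<omega>) z))"


section \<open>Assumptions\<close>

definition covariance_cond ::
  "'h::separable_chilbert set \<Rightarrow> (real^'d \<Rightarrow> 'h \<Rightarrow> 'h) \<Rightarrow> real \<Rightarrow> bool" where
  "covariance_cond E C \<gamma> \<longleftrightarrow>
     trace_integrable E lebesgue C \<and> 0 < \<gamma> \<and> \<gamma> \<le> 1 \<and>
     (\<exists>\<kappa>::real. \<forall>\<delta>. 0 < \<delta> \<and> \<delta> < 1 \<longrightarrow>
        (\<integral>\<^sup>+x. (SUP y\<in>cball x \<delta>. trace_norm E (C y - C x)) \<partial>lebesgue) \<le> ennreal (\<kappa> * \<delta> powr \<gamma>))"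

definition pderiv_dir :: "'d::finite \<Rightarrow> (real^'d \<Rightarrow> real) \<Rightarrow> real^'d \<Rightarrow> real" where
  "pderiv_dir i g x = deriv (\<lambda>r. g (x + r *\<^sub>R axis i 1)) 0"

text \<open>A multi-index \<open>\<alpha>\<close> is represented by the lists of directions in which direction \<open>i\<close> occurs
  \<open>\<alpha> i\<close> times, so that \<open>|\<alpha>|\<close> is the length; quantifying over lists covers every order
  of differentiation.\<close>

definition iter_pderiv :: "'d::finite list \<Rightarrow> (real^'d \<Rightarrow> real) \<Rightarrow> real^'d \<Rightarrow> real" where
  "iter_pderiv js g = foldr pderiv_dir js g"

definition has_pderivs_upto :: "nat \<Rightarrow> (real^'d \<Rightarrow> real) \<Rightarrow> bool" where
  "has_pderivs_upto m g \<longleftrightarrow>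
     (\<forall>js i x. length js < m \<longrightarrow>
        (\<lambda>r. iter_pderiv js g (x + r *\<^sub>R axis i 1)) field_differentiable at 0)"

definition kernel_cond :: "real \<Rightarrow> (real^'d \<Rightarrow> real) \<Rightarrow> bool" where
  "kernel_cond \<beta> K \<longleftrightarrow>
     continuous_on UNIV K \<and> (\<forall>u. 0 \<le> K u) \<and>
     bounded {t. K t > 0} \<and> 0 \<in> {t. K t > 0} \<and>
     (\<forall>u. K u \<le> K 0) \<and> K 0 = 1 \<and>
     (\<exists>\<epsilon>>0. \<exists>G. (\<forall>u. norm u < \<epsilon> \<longrightarrow> (GDERIV K u :> G u)) \<and> bounded (G ` {u. norm u < \<epsilon>})) \<and>
     (\<exists>lam::nat. real lam > max 0 (\<beta> - 1) \<and> has_pderivs_upto (lam + 1) K \<and>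
        (\<forall>js. 1 \<le> length js \<and> length js \<le> lam \<longrightarrow> iter_pderiv js K 0 = 0) \<and>
        (\<forall>js. length js = lam + 1 \<longrightarrow> bounded (range (iter_pderiv js K))))"

text \<open>The Hausdorff distance, for non-empty bounded sets.\<close>

definition hausdorff_dist :: "'a::metric_space set \<Rightarrow> 'a set \<Rightarrow> real" where
  "hausdorff_dist S T = max (SUP x\<in>S. infdist x T) (SUP y\<in>T. infdist y S)"

definition sampling_cond :: "(nat \<Rightarrow> 'd::finite \<Rightarrow> nat) \<Rightarrow> (nat \<Rightarrow> real) \<Rightarrow> bool" where
  "sampling_cond N \<delta> \<longleftrightarrow>
     (\<forall>l. filterlim (\<lambda>n. N n l) at_top sequentially) \<and>
     (\<forall>n. 0 < \<delta> n) \<and> \<delta> \<longlonglongrightarrow> 0 \<and>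
     filterlim (\<lambda>n. measure lebesgue (region (N n) (\<delta> n))) at_top sequentially \<and>
     (\<exists>T :: (real^'d) set. bounded T \<and> convex T \<and> interior T \<noteq> {} \<and>
        (\<lambda>n. hausdorff_dist
           ((\<lambda>x. x /\<^sub>R (measure lebesgue (region (N n) (\<delta> n)) powr (1 / CARD('d)))) ` region (N n) (\<delta> n))
           T) \<longlonglongrightarrow> 0)"

definition fourth_order_cond ::
  "'h::separable_chilbert set \<Rightarrow> 'w measure \<Rightarrow> (real^'d \<Rightarrow> 'w \<Rightarrow> 'h) \<Rightarrow> bool" where
  "fourth_order_cond E M X \<longleftrightarrow>
     (\<forall>t. integrable M (\<lambda>\<omega>. (norm (X t \<omega>)) ^ 4)) \<and>
     (\<forall>t s w v \<tau>. cum4 E M (X (t + \<tau>)) (X (s + \<tau>)) (X (w + \<tau>)) (X (v + \<tau>)) =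
                   cum4 E M (X t) (X s) (X w) (X v)) \<and>
     (\<exists>\<delta>>0.
        (SUP w. \<integral>\<^sup>+u. \<integral>\<^sup>+v.
           (SUP (l1, l2, l3) \<in> ball 0 \<delta> \<times> ball 0 \<delta> \<times> ball 0 \<delta>.
              ennreal (cmod (cum4 E M (X (l1 + u)) (X (l2 + v)) (X (l3 + w)) (X 0))))
           \<partial>lebesgue \<partial>lebesgue) < \<infinity>)"

definition bandwidth_cond ::
  "(real^'d \<Rightarrow> real) \<Rightarrow> (nat \<Rightarrow> 'd \<Rightarrow> nat) \<Rightarrow> (nat \<Rightarrow> real) \<Rightarrow> (nat \<Rightarrow> real) \<Rightarrow> bool" where
  "bandwidth_cond K N \<delta> \<Delta> \<longleftrightarrow>
     (\<forall>n. 0 < \<Delta> n) \<and> filterlim \<Delta> at_top sequentially \<and>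
     (\<forall>n. (\<lambda>t. \<Delta> n *\<^sub>R t) ` {t. K t > 0} \<subseteq> set_diff (region (N n) (\<delta> n)) (region (N n) (\<delta> n))) \<and>
     (\<lambda>n. \<Delta> n ^ CARD('d) / measure lebesgue (region (N n) (\<delta> n))) \<longlonglongrightarrow> 0"

end

(*
  Every grid pair with lag h is weighted by 1 / |T \<inter> (T - h)|, and the number of such pairs is
  exactly delta^(-d) |T \<inter> (T - h)|. Hence the mean of the estimator is the Riemann sum of
  e^(i h theta) C(h) K(h / Delta), and the bias splits into the L1 modulus of C (order delta^gamma),
  Lipschitz errors of order delta, and the effect of K. Since K is flat to order lambda + 1 > beta
  at 0 and bounded, |K(u) - 1| <= c |u|^beta, which the moment of C of order beta turns
  into Delta^(-beta).

  The variance is a quadruple sum over the grid of cum + tr C tr C + <C, C>_HS, because the process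
  is real. In each of the three terms two of the four summation variables are absorbed by summability
  (of the cumulants, of tr C, of the Hilbert-Schmidt norm of C), while the kernel restricts one of
  the remaining two to a ball of radius of order Delta around the other. This gives Delta^d / |T|.
*)
theory Submission
  imports Defs
begin

section \<open>Complex inner products\<close>

text \<open>The norms rest on definite descriptions, so adjoint, positive square root and
  \<open>op_abs\<close> first have to be shown to exist and to be unique. After that the trace norm
  is used only through two inequalities: it dominates the Hilbert-Schmidt norm and the modulus of
  the trace.

  No operator-valued integral is handled. Every bound is proved for a finite set \<open>F\<close> of
  basis vectors, uniformly in \<open>F\<close>, so that integrals and measurability concern vectors;
  a supremum over \<open>F\<close> then reaches \<open>E\<close>.

  Grid sums are read as integrals of functions constant on cells of side \<delta>. The modulus
  condition on C then controls values at lattice points, a null set about which integrability alone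
  says nothing.

  The weights are comparable to 1/|T| only while lags of order \<Delta> stay below half of every
  side of the box. Convergence of the rescaled boxes to a bounded set excludes thin boxes, and
  \<Delta>^d / |T| -> 0 does the rest. For the prescribed bandwidth \<Delta>^d / |T| equals
  \<Delta>^(-2 \<beta>), which balances variance and squared bias.\<close>

lemma cinner_scaleC_right: "cinner x (a *\<^sub>C y) = cnj a * cinner x y"
  by (metis cinner_commute cinner_scaleC_left complex_cnj_cnj complex_cnj_mult)

lemma cinner_add_right: "cinner x (y + z) = cinner x y + cinner x z"
  by (metis cinner_add_left cinner_commute complex_cnj_add)

lemma scaleC_one [simp]: "1 *\<^sub>C x = (x :: 'h::separable_chilbert)"
  using scaleR_scaleC[of "1" x] by simp

lemma scaleC_zero_left [simp]: "0 *\<^sub>C x = (0 :: 'h::separable_chilbert)"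
  using scaleR_scaleC[of "0" x] by simp

lemma scaleC_zero_right [simp]: "a *\<^sub>C 0 = (0 :: 'h::separable_chilbert)"
  using scaleC_add_right[of a "0::'h" 0] by simp

lemma scaleC_minus_right: "a *\<^sub>C (- x) = - (a *\<^sub>C x :: 'h::separable_chilbert)"
  using scaleC_add_right[of a "-x" x] by (simp add: eq_neg_iff_add_eq_0)

lemma scaleC_diff_right: "a *\<^sub>C (x - y) = a *\<^sub>C x - (a *\<^sub>C y :: 'h::separable_chilbert)"
  using scaleC_add_right[of a x "-y"] by (simp add: scaleC_minus_right)

lemma scaleC_minus_left: "(- a) *\<^sub>C x = - (a *\<^sub>C x :: 'h::separable_chilbert)"
  using scaleC_add_left[of "-a" a x] by (simp add: eq_neg_iff_add_eq_0)

lemma scaleC_diff_left: "(a - b) *\<^sub>C x = a *\<^sub>C x - (b *\<^sub>C x :: 'h::separable_chilbert)"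
  using scaleC_add_left[of a "-b" x] by (simp add: scaleC_minus_left)

lemma cinner_zero_left [simp]: "cinner 0 (x :: 'h::separable_chilbert) = 0"
  using cinner_add_left[of 0 0 x] by simp

lemma cinner_zero_right [simp]: "cinner (x :: 'h::separable_chilbert) 0 = 0"
  using cinner_add_right[of x 0 0] by simp

lemma cinner_minus_left: "cinner (- x) y = - cinner x (y :: 'h::separable_chilbert)"
  using cinner_add_left[of "-x" x y] by (simp add: eq_neg_iff_add_eq_0)

lemma cinner_minus_right: "cinner x (- y) = - cinner x (y :: 'h::separable_chilbert)"
  using cinner_add_right[of x "-y" y] by (simp add: eq_neg_iff_add_eq_0)

lemma cinner_diff_left: "cinner (x - y) z = cinner x z - cinner y (z :: 'h::separable_chilbert)"
  using cinner_add_left[of x "-y" z] by (simp add: cinner_minus_left)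

lemma cinner_diff_right: "cinner x (y - z) = cinner x y - cinner x (z :: 'h::separable_chilbert)"
  using cinner_add_right[of x y "-z"] by (simp add: cinner_minus_right)

lemma cinner_sum_left:
  "cinner (\<Sum>i\<in>I. f i) (y :: 'h::separable_chilbert) = (\<Sum>i\<in>I. cinner (f i) y)"
  by (induction I rule: infinite_finite_induct) (auto simp: cinner_add_left)

lemma cinner_sum_right:
  "cinner (y :: 'h::separable_chilbert) (\<Sum>i\<in>I. f i) = (\<Sum>i\<in>I. cinner y (f i))"
  by (induction I rule: infinite_finite_induct) (auto simp: cinner_add_right)

lemmas cinner_algebra = cinner_add_left cinner_add_right cinner_diff_left cinner_diff_right
  cinner_minus_left cinner_minus_right cinner_scaleC_left cinner_scaleC_right

lemma scaleC_sum_right: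
  "a *\<^sub>C (\<Sum>i\<in>I. f i) = (\<Sum>i\<in>I. a *\<^sub>C f i :: 'h::separable_chilbert)"
  by (induction I rule: infinite_finite_induct) (auto simp: scaleC_add_right)

lemma power2_norm_eq_cinner: "(norm x)\<^sup>2 = Re (cinner x (x :: 'h::separable_chilbert))"
  by (simp add: cinner_self)

lemma norm_scaleC: "norm (a *\<^sub>C x) = cmod a * norm (x :: 'h::separable_chilbert)"
proof -
  have "cinner (a *\<^sub>C x) (a *\<^sub>C x) = (a * cnj a) * complex_of_real ((norm x)\<^sup>2)"
    unfolding cinner_scaleC_left cinner_scaleC_right cinner_self[of x] by simp
  also have "\<dots> = complex_of_real ((cmod a * norm x)\<^sup>2)"
    unfolding complex_norm_square[symmetric] by (simp add: power_mult_distrib)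
  finally have "cinner (a *\<^sub>C x) (a *\<^sub>C x) = complex_of_real ((cmod a * norm x)\<^sup>2)" .
  then have "(norm (a *\<^sub>C x))\<^sup>2 = (cmod a * norm x)\<^sup>2"
    by (simp add: power2_norm_eq_cinner)
  then show ?thesis by (simp add: power2_eq_iff_nonneg)
qed

lemma bounded_clinearD:
  assumes "bounded_clinear A"
  shows "bounded_linear A" "A (x + y) = A x + A y" "A (x - y) = A x - A y" "A (c *\<^sub>C x) = c *\<^sub>C A x"
    "A 0 = 0" "A (- x) = - A x"
proof -
  show 1: "bounded_linear A" using assms by (simp add: bounded_clinear_def)
  interpret bounded_linear A by fact
  show "A (x + y) = A x + A y" "A (x - y) = A x - A y" "A 0 = 0" "A (- x) = - A x"
    by (simp_all add: add diff bounded_linear.linear[OF 1] linear_neg)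
  show "A (c *\<^sub>C x) = c *\<^sub>C A x" using assms by (simp add: bounded_clinear_def)
qed

lemma bounded_clinear_id: "bounded_clinear (\<lambda>x. x)"
  by (simp add: bounded_clinear_def)

lemma positive_op_id: "positive_op (\<lambda>x. x)"
  by (simp add: positive_op_def cinner_self)

lemma bounded_clinear_scaleC: "bounded_clinear ((*\<^sub>C) c :: 'h \<Rightarrow> 'h::separable_chilbert)"
  unfolding bounded_clinear_def
proof
  show "bounded_linear ((*\<^sub>C) c :: 'h \<Rightarrow> 'h)"
    by (rule bounded_linear_intro[where K = "cmod c"])
      (simp_all add: scaleC_add_right norm_scaleC scaleR_scaleC scaleC_scaleC mult.commute)
qed (simp add: scaleC_scaleC mult.commute)

lemma bounded_clinear_compose:
  assumes "bounded_clinear A" "bounded_clinear B"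
  shows "bounded_clinear (\<lambda>x. A (B x))"
  using assms bounded_linear_compose by (auto simp: bounded_clinear_def)

lemma bounded_clinear_add:
  assumes "bounded_clinear A" "bounded_clinear B"
  shows "bounded_clinear (\<lambda>x. A x + B x)"
  using assms bounded_linear_add by (auto simp: bounded_clinear_def scaleC_add_right)

lemma bounded_clinear_diff:
  assumes "bounded_clinear A" "bounded_clinear B"
  shows "bounded_clinear (\<lambda>x. A x - B x)"
  using assms bounded_linear_sub by (auto simp: bounded_clinear_def scaleC_diff_right)

lemma bounded_clinear_sum:
  assumes "\<And>i. i \<in> I \<Longrightarrow> bounded_clinear (A i)"
  shows "bounded_clinear (\<lambda>x. \<Sum>i\<in>I. A i x)"
  unfolding bounded_clinear_def
proof (intro conjI allI)
  show "bounded_linear (\<lambda>x. \<Sum>i\<in>I. A i x)"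
    by (rule bounded_linear_sum) (use assms in \<open>simp add: bounded_clinear_def\<close>)
  show "(\<Sum>i\<in>I. A i (c *\<^sub>C x)) = c *\<^sub>C (\<Sum>i\<in>I. A i x)" for c x
    using assms by (simp add: bounded_clinear_def scaleC_sum_right)
qed

text \<open>Polarization: the quadratic form is real at x + y, which fixes the imaginary parts, and
  at x + i y, which fixes the real parts.\<close>

lemma positive_op_symmetric:
  assumes A: "bounded_clinear A" "positive_op A"
  shows "cinner (A x) y = cinner x (A y)"
proof -
  note l = bounded_clinearD[OF A(1)]
  have re: "Im (cinner (A z) z) = 0" for z
    using A(2) by (auto simp: positive_op_def complex_is_Real_iff)
  have 1: "Im (cinner (A x) y) + Im (cinner (A y) x) = 0"
    using re[of "x + y"] re[of x] re[of y] by (simp add: l cinner_algebra)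
  have 2: "Re (cinner (A y) x) = Re (cinner (A x) y)"
    using re[of "x + \<i> *\<^sub>C y"] re[of x] re[of y] by (simp add: l cinner_algebra)
  have "cinner (A y) x = cnj (cinner (A x) y)"
    using 1 2 by (simp add: complex_eq_iff)
  then show ?thesis
    by (metis cinner_commute complex_cnj_cnj)
qed

text \<open>Discriminant argument for a form that may be degenerate, hence the separate case b = 0.
  With A the identity it is the usual inequality; with y = A x it turns information on the form into
  information on A.\<close>

lemma positive_op_Cauchy_Schwarz:
  assumes A: "bounded_clinear A" "positive_op A"
  shows "(cmod (cinner (A x) y))\<^sup>2 \<le> Re (cinner (A x) x) * Re (cinner (A y) y)"
proof -
  note l = bounded_clinearD[OF A(1)]
  define p a b where "p = cinner (A x) y" and "a = Re (cinner (A x) x)" and "b = Re (cinner (A y) y)"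
  have yx: "cinner (A y) x = cnj p"
    unfolding p_def by (metis A positive_op_symmetric cinner_commute)
  have q: "0 \<le> a - 2 * r * (cmod p)\<^sup>2 + r\<^sup>2 * (cmod p)\<^sup>2 * b" for r :: real
  proof -
    \<comment> \<open>The factor p aligns the phases, so that both cross terms equal r
      |p|^2.\<close>
    define t where "t = complex_of_real r * p"
    have "0 \<le> Re (cinner (A (x - t *\<^sub>C y)) (x - t *\<^sub>C y))"
      using A(2) by (auto simp: positive_op_def)
    also have "\<dots> = a - Re (cnj t * p) - Re (t * cnj p) + Re (t * cnj t * cinner (A y) y)"
      by (simp add: l cinner_algebra p_def[symmetric] yx a_def b_def algebra_simps)
    also have "t * cnj t = (complex_of_real r)\<^sup>2 * (p * cnj p)"
      by (simp add: t_def power2_eq_square)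
    also have "\<dots> = complex_of_real (r\<^sup>2 * (cmod p)\<^sup>2)"
      unfolding complex_norm_square[symmetric] by simp
    also have "Re (cnj t * p) = r * (cmod p)\<^sup>2"
      unfolding cmod_power2 by (simp add: t_def power2_eq_square algebra_simps)
    also have "Re (t * cnj p) = r * (cmod p)\<^sup>2"
      unfolding cmod_power2 by (simp add: t_def power2_eq_square algebra_simps)
    finally show ?thesis by (simp add: b_def algebra_simps)
  qed
  have b0: "b \<ge> 0" using A(2) by (auto simp: positive_op_def b_def)
  show ?thesis
  proof (cases "b = 0")
    case True
    have "p = 0"
    proof (rule ccontr)
      assume "p \<noteq> 0"
      \<comment> \<open>For b = 0 the bound is affine in r, and this r makes it equal to -1.\<close>
      then show False using q[of "(a + 1) / (2 * (cmod p)\<^sup>2)"] True by simp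
    qed
    then show ?thesis using True by (simp add: p_def b_def)
  next
    case False
    then have "b > 0" using b0 by simp
    have "0 \<le> a - (cmod p)\<^sup>2 / b"
      using q[of "1 / b"] \<open>b > 0\<close> by (simp add: power2_eq_square field_simps)
    then show ?thesis using \<open>b > 0\<close> by (simp add: p_def a_def b_def field_simps)
  qed
qed

lemma cinner_Cauchy_Schwarz: "cmod (cinner x y) \<le> norm x * norm (y :: 'h::separable_chilbert)"
proof -
  have "(cmod (cinner x y))\<^sup>2 \<le> (norm x * norm y)\<^sup>2"
    using positive_op_Cauchy_Schwarz[OF bounded_clinear_id positive_op_id, of x y]
    by (simp add: power2_norm_eq_cinner power_mult_distrib)
  then show ?thesis by (simp add: power2_le_iff_abs_le)
qed

lemma bounded_bilinear_cinner:
  "bounded_bilinear (cinner :: 'h::separable_chilbert \<Rightarrow> 'h \<Rightarrow> complex)"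
  by (rule bounded_bilinear.intro)
    (auto simp: cinner_algebra scaleR_scaleC scaleR_conv_of_real
      intro!: exI[of _ 1] cinner_Cauchy_Schwarz)

lemma bounded_bilinear_scaleC:
  "bounded_bilinear (scaleC :: complex \<Rightarrow> 'h \<Rightarrow> 'h::separable_chilbert)"
  by (rule bounded_bilinear.intro)
    (auto simp: scaleC_add_left scaleC_add_right scaleR_scaleC scaleC_scaleC norm_scaleC
      scaleR_conv_of_real mult.commute intro!: exI[of _ 1])

lemma cinner_measurable [measurable (raw)]:
  fixes f g :: "'a \<Rightarrow> 'h::separable_chilbert"
  assumes "f \<in> borel_measurable M" "g \<in> borel_measurable M"
  shows "(\<lambda>x. cinner (f x) (g x)) \<in> borel_measurable M"
proof -
  interpret bounded_bilinear "cinner :: 'h \<Rightarrow> 'h \<Rightarrow> complex" by (rule bounded_bilinear_cinner)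
  show ?thesis
    using assms
    by (rule borel_measurable_continuous_Pair) (intro continuous_on continuous_intros)
qed

lemma scaleC_measurable [measurable (raw)]:
  fixes g :: "'a \<Rightarrow> 'h::separable_chilbert"
  assumes "f \<in> borel_measurable M" "g \<in> borel_measurable M"
  shows "(\<lambda>x. f x *\<^sub>C g x) \<in> borel_measurable M"
proof -
  interpret bounded_bilinear "scaleC :: complex \<Rightarrow> 'h \<Rightarrow> 'h" by (rule bounded_bilinear_scaleC)
  show ?thesis
    using assms
    by (rule borel_measurable_continuous_Pair) (intro continuous_on continuous_intros)
qed

lemma integral_scaleC_right:
  fixes f :: "'a \<Rightarrow> 'h::separable_chilbert"
  assumes "integrable M f"
  shows "integrable M (\<lambda>x. c *\<^sub>C f x)" "(\<integral>x. c *\<^sub>C f x \<partial>M) = c *\<^sub>C (\<integral>x. f x \<partial>M)"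
proof -
  have "bounded_linear (\<lambda>x::'h. c *\<^sub>C x)"
    using bounded_clinear_scaleC bounded_clinear_def by blast
  then show "integrable M (\<lambda>x. c *\<^sub>C f x)" "(\<integral>x. c *\<^sub>C f x \<partial>M) = c *\<^sub>C (\<integral>x. f x \<partial>M)"
    using assms by (auto intro: integrable_bounded_linear integral_bounded_linear)
qed

lemma integral_cinner_left:
  fixes f :: "'a \<Rightarrow> 'h::separable_chilbert"
  assumes "integrable M f"
  shows "integrable M (\<lambda>x. cinner (f x) y)" "(\<integral>x. cinner (f x) y \<partial>M) = cinner (\<integral>x. f x \<partial>M) y"
proof -
  have "bounded_linear (\<lambda>x::'h. cinner x y)"
    using bounded_bilinear_cinner by (rule bounded_bilinear.bounded_linear_left)
  then show "integrable M (\<lambda>x. cinner (f x) y)" "(\<integral>x. cinner (f x) y \<partial>M) = cinner (\<integral>x. f x \<partial>M) y"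
    using assms by (auto intro: integrable_bounded_linear integral_bounded_linear)
qed

lemma integral_cinner_right:
  fixes f :: "'a \<Rightarrow> 'h::separable_chilbert"
  assumes "integrable M f"
  shows "integrable M (\<lambda>x. cinner y (f x))" "(\<integral>x. cinner y (f x) \<partial>M) = cinner y (\<integral>x. f x \<partial>M)"
proof -
  have "bounded_linear (\<lambda>x::'h. cinner y x)"
    using bounded_bilinear_cinner by (rule bounded_bilinear.bounded_linear_right)
  then show "integrable M (\<lambda>x. cinner y (f x))" "(\<integral>x. cinner y (f x) \<partial>M) = cinner y (\<integral>x. f x \<partial>M)"
    using assms by (auto intro: integrable_bounded_linear integral_bounded_linear)
qed

section \<open>Orthonormal expansions\<close>

lemma norm_sum_orthonormal:
  assumes E: "\<And>e e'. e \<in> F \<Longrightarrow> e' \<in> F \<Longrightarrow> cinner e e' = (if e = e' then 1 else 0)"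
  shows "(norm (\<Sum>e\<in>F. a e *\<^sub>C (e :: 'h::separable_chilbert)))\<^sup>2 = (\<Sum>e\<in>F. (cmod (a e))\<^sup>2)"
proof (cases "finite F")
  case True
  have "cinner (\<Sum>e\<in>F. a e *\<^sub>C e) (\<Sum>e\<in>F. a e *\<^sub>C e)
      = (\<Sum>e\<in>F. \<Sum>e'\<in>F. if e = e' then a e * cnj (a e) else 0)"
    unfolding cinner_sum_left cinner_sum_right
    by (intro sum.cong) (auto simp: cinner_algebra E)
  also have "\<dots> = complex_of_real (\<Sum>e\<in>F. (cmod (a e))\<^sup>2)"
    unfolding of_real_sum complex_norm_square using True by (simp add: sum.delta)
  finally show ?thesis by (simp add: power2_norm_eq_cinner)
qed auto

context
  fixes E :: "'h::separable_chilbert set"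
  assumes E: "is_cons E"
begin

lemma cons_orthonormal: "e \<in> E \<Longrightarrow> e' \<in> E \<Longrightarrow> cinner e e' = (if e = e' then 1 else 0)"
  using E by (auto simp: is_cons_def)

lemma cons_norm: "e \<in> E \<Longrightarrow> norm e = 1"
  using cons_orthonormal[of e e] power2_norm_eq_cinner[of e] norm_ge_zero[of e]
  by (simp add: power2_eq_1_iff)

lemma cons_complete:
  assumes "\<And>e. e \<in> E \<Longrightarrow> cinner x e = cinner y e"
  shows "x = y"
proof -
  have "\<forall>e\<in>E. cinner (x - y) e = 0"
    using assms by (simp add: cinner_diff_left)
  then have "x - y = 0"
    using E is_cons_def by blast
  then show ?thesis by simp
qed

text \<open>Distinct elements of \<open>E\<close> are at distance sqrt 2, so points of a countable
  dense set chosen within 1/2 of them are distinct. Countability is what permits exchanging sums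
  over \<open>E\<close> with integrals later.\<close>

lemma countable_cons: "countable E"
proof -
  obtain D :: "'h set" where D: "countable D" "\<And>X. open X \<Longrightarrow> X \<noteq> {} \<Longrightarrow> \<exists>d\<in>D. d \<in> X"
    using countable_dense_setE by blast
  have "\<exists>d\<in>D. dist e d < 1 / 2" for e
    using D(2)[of "ball e (1 / 2)"] by auto
  then obtain g where g: "\<And>e. g e \<in> D" "\<And>e. dist e (g e) < 1 / 2" by metis
  have "inj_on g E"
  proof
    fix e e' assume e: "e \<in> E" "e' \<in> E" "g e = g e'"
    show "e = e'"
    proof (rule ccontr)
      assume "e \<noteq> e'"
      then have "(norm (e - e'))\<^sup>2 = 2"
        by (simp add: power2_norm_eq_cinner cinner_algebra cons_orthonormal e)
      moreover have "norm (e - e') < 1"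
        using g(2)[of e] g(2)[of e'] e(3) dist_triangle_less_add[of e "g e" "1/2" e' "1/2"]
        by (simp add: dist_norm dist_commute norm_minus_commute)
      then have "(norm (e - e'))\<^sup>2 < 1"
        by (simp add: abs_square_less_1)
      ultimately show False by simp
    qed
  qed
  then show ?thesis
    using D(1) g(1) by (meson countable_subset image_subsetI countable_image_inj_on)
qed

text \<open>The projection p satisfies <x, p> = |p|^2, so Cauchy-Schwarz gives |p| <= |x|.\<close>

lemma Bessel:
  assumes "finite F" "F \<subseteq> E"
  shows "(\<Sum>e\<in>F. (cmod (cinner x e))\<^sup>2) \<le> (norm x)\<^sup>2"
proof -
  define p where "p = (\<Sum>e\<in>F. cinner x e *\<^sub>C e)"
  have p2: "(norm p)\<^sup>2 = (\<Sum>e\<in>F. (cmod (cinner x e))\<^sup>2)"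
    unfolding p_def by (rule norm_sum_orthonormal) (use assms cons_orthonormal in blast)
  have "cinner x p = complex_of_real (\<Sum>e\<in>F. (cmod (cinner x e))\<^sup>2)"
    unfolding p_def cinner_sum_right of_real_sum complex_norm_square
    by (simp add: cinner_algebra mult.commute)
  then have "(norm p)\<^sup>2 \<le> norm x * norm p"
    using complex_Re_le_cmod[of "cinner x p"] cinner_Cauchy_Schwarz[of x p] p2 by simp
  then have "norm p \<le> norm x"
    by (cases "norm p = 0") (auto simp: power2_eq_square)
  then show ?thesis
    using p2 by (metis norm_ge_zero power_mono)
qed

text \<open>Cauchy criterion along finite subsets. By orthonormality the squared distance of two
  nested partial sums is a sum of squared coefficients, so a set \<open>F0\<close> with squared tail
  below (r/2)^2 keeps all larger partial sums within r/2 of its own.\<close>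

lemma orthogonal_series_summable:
  assumes a: "\<And>F. finite F \<Longrightarrow> F \<subseteq> E \<Longrightarrow> (\<Sum>e\<in>F. (cmod (a e))\<^sup>2) \<le> B"
  shows "(\<lambda>e. a e *\<^sub>C e) summable_on E"
proof -
  have "(\<lambda>e. (cmod (a e))\<^sup>2) summable_on E"
    by (rule nonneg_bdd_above_summable_on) (use a in \<open>auto intro!: bdd_aboveI[of _ B]\<close>)
  then obtain S where S: "((\<lambda>e. (cmod (a e))\<^sup>2) has_sum S) E"
    by (auto simp: summable_on_def)
  define f where "f = (\<lambda>e. a e *\<^sub>C e)"
  have "\<exists>P. eventually P (finite_subsets_at_top E) \<and>
              (\<forall>F F'. P F \<and> P F' \<longrightarrow> dist (sum f F) (sum f F') < r)" if "r > 0" for r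
  proof -
    have "\<forall>\<^sub>F F in finite_subsets_at_top E. dist (\<Sum>e\<in>F. (cmod (a e))\<^sup>2) S < (r / 2)\<^sup>2"
      using S that by (auto simp: has_sum_def tendsto_iff)
    then obtain F0 where F0: "finite F0" "F0 \<subseteq> E" "dist (\<Sum>e\<in>F0. (cmod (a e))\<^sup>2) S < (r / 2)\<^sup>2"
      by (auto simp: eventually_finite_subsets_at_top)
    define P where "P F \<longleftrightarrow> finite F \<and> F0 \<subseteq> F \<and> F \<subseteq> E" for F
    have "eventually P (finite_subsets_at_top E)"
      unfolding eventually_finite_subsets_at_top using F0 by (auto simp: P_def)
    moreover have close: "dist (sum f F) (sum f F0) < r / 2" if F: "P F" for F
    proof -
      have "sum f F - sum f F0 = sum f (F - F0)"
        using F F0 by (subst sum_diff) (auto simp: P_def)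
      then have "(dist (sum f F) (sum f F0))\<^sup>2 = (\<Sum>e\<in>F - F0. (cmod (a e))\<^sup>2)"
        using F norm_sum_orthonormal[of "F - F0" a] cons_orthonormal
        by (auto simp: dist_norm f_def P_def subset_iff)
      also have "\<dots> = (\<Sum>e\<in>F. (cmod (a e))\<^sup>2) - (\<Sum>e\<in>F0. (cmod (a e))\<^sup>2)"
        using F F0 by (subst sum_diff) (auto simp: P_def)
      also have "\<dots> \<le> S - (\<Sum>e\<in>F0. (cmod (a e))\<^sup>2)"
        using finite_sum_le_has_sum[OF S, of F] F by (auto simp: P_def)
      also have "\<dots> < (r / 2)\<^sup>2"
        using F0(3) by (simp add: dist_real_def)
      finally show ?thesis
        by (rule power2_less_imp_less) (use \<open>r > 0\<close> in simp)
    qed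
    have "dist (sum f F) (sum f F') < r" if "P F" "P F'" for F F'
      using dist_triangle_half_l[OF close[OF that(1)] close[OF that(2)]] by simp
    ultimately show ?thesis by blast
  qed
  then have "cauchy_filter (filtermap (sum f) (finite_subsets_at_top E))"
    by (simp add: cauchy_filter_metric_filtermap)
  then obtain x where "(sum f \<longlongrightarrow> x) (finite_subsets_at_top E)"
    using cauchy_filter_convergent by (auto simp: filterlim_def convergent_filter_iff)
  then show ?thesis
    unfolding f_def using summable_on_def has_sum_def by blast
qed

lemma has_sum_cinner_left:
  assumes "(f has_sum x) A"
  shows "((\<lambda>i. cinner (f i) y) has_sum cinner x y) A"
  using has_sum_bounded_linear[OF bounded_bilinear.bounded_linear_left[OF bounded_bilinear_cinner] assms]
  by simp

lemma cinner_orthogonal_series: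
  assumes "((\<lambda>e. a e *\<^sub>C e) has_sum x) E" "e \<in> E"
  shows "cinner x e = a e"
proof -
  have "((\<lambda>e'. if e' = e then a e else 0) has_sum cinner x e) E"
    using has_sum_cinner_left[OF assms(1), of e] assms(2)
    by (subst has_sum_cong[where g = "\<lambda>e'. cinner (a e' *\<^sub>C e') e"])
      (auto simp: cinner_algebra cons_orthonormal)
  moreover have "((\<lambda>e'. if e' = e then a e else 0) has_sum a e) E"
    by (rule has_sum_finite_neutralI[of "{e}"]) (use assms(2) in auto)
  ultimately show ?thesis by (rule has_sum_unique)
qed

text \<open>Bessel makes the series converge to some y; y has the same coefficients as x, and
  completeness of the system identifies the two.\<close>

lemma cons_expansion: "((\<lambda>e. cinner x e *\<^sub>C e) has_sum x) E"
proof -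
  obtain y where y: "((\<lambda>e. cinner x e *\<^sub>C e) has_sum y) E"
    using orthogonal_series_summable[of "cinner x"] Bessel summable_on_def by blast
  have "y = x"
    by (rule cons_complete) (use cinner_orthogonal_series[OF y] in auto)
  with y show ?thesis by simp
qed

lemma Parseval: "((\<lambda>e. cinner x e * cinner e y) has_sum cinner x y) E"
  using has_sum_cinner_left[OF cons_expansion[of x], of y] by (simp add: cinner_algebra)

lemma Parseval_norm: "((\<lambda>e. (cmod (cinner x e))\<^sup>2) has_sum (norm x)\<^sup>2) E"
proof -
  have *: "cinner x e * cinner e x = complex_of_real ((cmod (cinner x e))\<^sup>2)" for e
    unfolding complex_norm_square using cinner_commute[of e x] by simp
  have "((\<lambda>e. complex_of_real ((cmod (cinner x e))\<^sup>2)) has_sum complex_of_real ((norm x)\<^sup>2)) E"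
    using Parseval[of x x] unfolding * cinner_self .
  then show ?thesis unfolding has_sum_of_real_iff .
qed

lemma conj_wrt_real: "is_real E x \<Longrightarrow> conj_wrt E x = x"
proof -
  assume "is_real E x"
  then have "conj_wrt E x = (\<Sum>\<^sub>\<infinity>e\<in>E. cinner x e *\<^sub>C e)"
    unfolding conj_wrt_def is_real_def by (intro infsum_cong) (auto simp: Reals_cnj_iff)
  then show ?thesis using cons_expansion infsumI by metis
qed

section \<open>Adjoints, square roots and absolute values\<close>

text \<open>Riesz representation: the coefficients of the representing vector are read off on \<open>E\<close>.\<close>

lemma adjoint_exists:
  assumes A: "bounded_clinear (A :: 'h \<Rightarrow> 'h)"
  obtains A' where "\<And>x y. cinner (A x) y = cinner x (A' y)"
proof -
  note l = bounded_clinearD[OF A]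
  obtain k where k: "k > 0" "\<And>x. norm (A x) \<le> norm x * k"
    using bounded_linear.pos_bounded[OF l(1)] by blast
  have "\<exists>w. \<forall>x. cinner (A x) y = cinner x w" for y
  proof -
    \<comment> \<open>If the representing vector w exists, its coefficient <w, e> must be <y, A
      e>.\<close>
    define a where "a e = cinner y (A e)" for e
    have "(\<Sum>e\<in>F. (cmod (a e))\<^sup>2) \<le> (k * norm y)\<^sup>2" if F: "finite F" "F \<subseteq> E" for F
    proof -
      define s where "s = sqrt (\<Sum>e\<in>F. (cmod (a e))\<^sup>2)"
      \<comment> \<open>Testing A on the partial sum itself gives s^2 = <A x, y> <= s k |y|, hence a
        bound on s that does not depend on \<open>F\<close>.\<close>
      define x where "x = (\<Sum>e\<in>F. a e *\<^sub>C e)"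
      have s: "s \<ge> 0" "s\<^sup>2 = (\<Sum>e\<in>F. (cmod (a e))\<^sup>2)"
        by (auto simp: s_def sum_nonneg)
      have "(norm x)\<^sup>2 = s\<^sup>2"
        unfolding x_def s by (rule norm_sum_orthonormal) (use F cons_orthonormal in blast)
      then have x: "norm x = s" using s(1) by simp
      have "cinner (A x) y = (\<Sum>e\<in>F. a e * cinner (A e) y)"
        using linear_sum[OF bounded_linear.linear[OF l(1)], of "\<lambda>e. a e *\<^sub>C e" F]
        by (simp add: x_def cinner_sum_left l cinner_algebra)
      also have "\<dots> = complex_of_real (s\<^sup>2)"
        unfolding s(2) of_real_sum complex_norm_square a_def
        by (intro sum.cong) (auto simp: cinner_commute[of "A _" y])
      finally have "s\<^sup>2 \<le> norm (A x) * norm y"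
        using complex_Re_le_cmod[of "cinner (A x) y"] cinner_Cauchy_Schwarz[of "A x" y] by simp
      also have "\<dots> \<le> (s * k) * norm y"
        using k(2)[of x] x by (intro mult_right_mono) auto
      finally have "s \<le> k * norm y"
        using s(1) by (cases "s = 0") (auto simp: power2_eq_square mult.assoc k(1) less_imp_le)
      then show ?thesis
        using s by (metis power_mono)
    qed
    then have "(\<lambda>e. a e *\<^sub>C e) summable_on E"
      by (rule orthogonal_series_summable)
    then obtain w where w: "((\<lambda>e. a e *\<^sub>C e) has_sum w) E"
      by (auto simp: summable_on_def)
    have "cinner (A x) y = cinner x w" for x
    proof -
      have "((\<lambda>e. A (cinner x e *\<^sub>C e)) has_sum A x) E"
        using has_sum_bounded_linear[OF l(1) cons_expansion[of x]] .
      from has_sum_cinner_left[OF this, of y]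
      have "((\<lambda>e. cinner x e * cinner (A e) y) has_sum cinner (A x) y) E"
        by (simp add: l cinner_algebra)
      moreover have "cinner x e * cinner (A e) y = cinner x e * cinner e w" if "e \<in> E" for e
        using cinner_orthogonal_series[OF w that] by (metis a_def cinner_commute)
      ultimately have "((\<lambda>e. cinner x e * cinner e w) has_sum cinner (A x) y) E"
        by (metis (no_types, lifting) has_sum_cong)
      then show ?thesis using Parseval[of x w] has_sum_unique by blast
    qed
    then show ?thesis by blast
  qed
  then show ?thesis using that by metis
qed

lemma cadjoint:
  assumes A: "bounded_clinear (A :: 'h \<Rightarrow> 'h)"
  shows "cinner (A x) y = cinner x (cadjoint A y)"
proof -
  obtain A' where A': "\<And>x y. cinner (A x) y = cinner x (A' y)"
    using adjoint_exists[OF A] by blast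
  have "cadjoint A = A'"
    unfolding cadjoint_def
  proof (rule the_equality)
    fix A'' assume "\<forall>x y. cinner (A x) y = cinner x (A'' y)"
    then have "cinner x (A'' y - A' y) = 0" for x y
      using A' by (simp add: cinner_diff_right)
    then have "A'' y - A' y = 0" for y
      using power2_norm_eq_cinner[of "A'' y - A' y"] by (metis power_eq_0_iff norm_eq_zero zero_complex.sel(1))
    then show "A'' = A'" by auto
  qed (use A' in auto)
  then show ?thesis using A' by simp
qed

end

text \<open>Cauchy-Schwarz for the form of W at x and W x gives |W x|^4 <= <W x, x> <W W x, W x>. It
  turns bounds on quadratic forms into the operator norm bounds needed for the square root iteration
  and for the contraction behind the resolvent.\<close>

lemma positive_op_norm_le:
  assumes W: "bounded_clinear W" "positive_op W"
    and k: "\<And>x. Re (cinner (W x) x) \<le> k * (norm x)\<^sup>2" "k \<ge> 0"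
  shows "norm (W x) \<le> k * norm x"
proof (cases "W x = 0")
  case False
  have "((norm (W x))\<^sup>2)\<^sup>2 = (cmod (cinner (W x) (W x)))\<^sup>2"
    by (simp add: cinner_self norm_power)
  also have "\<dots> \<le> Re (cinner (W x) x) * Re (cinner (W (W x)) (W x))"
    by (rule positive_op_Cauchy_Schwarz[OF W])
  also have "\<dots> \<le> (k * (norm x)\<^sup>2) * (k * (norm (W x))\<^sup>2)"
    using k W(2) by (intro mult_mono) (auto simp: positive_op_def)
  finally have "(norm (W x))\<^sup>2 \<le> (k * norm x)\<^sup>2"
    using False by (simp add: power2_eq_square mult_ac)
  then show ?thesis
    using k(2) by (simp add: power2_le_iff_abs_le)
qed (use k in simp)

section \<open>Square roots of positive operators by a norm-convergent iteration\<close>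

lemma bounded_clinear_limit:
  fixes Y :: "nat \<Rightarrow> 'h::separable_chilbert \<Rightarrow>\<^sub>L 'h"
  assumes "Y \<longlonglongrightarrow> Z" and Y: "\<And>n. bounded_clinear (blinfun_apply (Y n))"
  shows "bounded_clinear (blinfun_apply Z)"
  unfolding bounded_clinear_def
proof (intro conjI allI)
  fix c x
  have lim: "(\<lambda>n. Y n x) \<longlonglongrightarrow> Z x" for x
    using assms(1) by (intro tendsto_intros)
  have "(\<lambda>n. c *\<^sub>C Y n x) \<longlonglongrightarrow> c *\<^sub>C Z x"
    using bounded_linear.tendsto[OF bounded_clinearD(1)[OF bounded_clinear_scaleC] lim] .
  then show "Z (c *\<^sub>C x) = c *\<^sub>C Z x"
    using lim[of "c *\<^sub>C x"] bounded_clinearD(4)[OF Y] LIMSEQ_unique by simp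
qed (rule blinfun.bounded_linear_right)

text \<open>The limit is 1 - (1 - W)^(1/2). The iterates are polynomials in W, so they inherit
  symmetry from W and commute with whatever commutes with W.\<close>

fun sqrt_approx :: "('h::separable_chilbert \<Rightarrow>\<^sub>L 'h) \<Rightarrow> nat \<Rightarrow> 'h \<Rightarrow>\<^sub>L 'h" where
  "sqrt_approx W 0 = 0"
| "sqrt_approx W (Suc n) = (1 / 2) *\<^sub>R (W + (sqrt_approx W n o\<^sub>L sqrt_approx W n))"

text \<open>The scalar case \<open>W = 1\<close>, which majorizes the increments of the operator iteration and makes
  them summable.\<close>

fun sqrt_bound :: "nat \<Rightarrow> real" where
  "sqrt_bound 0 = 0"
| "sqrt_bound (Suc n) = (1 + (sqrt_bound n)\<^sup>2) / 2"

lemma sqrt_bound: "0 \<le> sqrt_bound n" "sqrt_bound n \<le> 1" "sqrt_bound n \<le> sqrt_bound (Suc n)"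
proof -
  show 1: "0 \<le> sqrt_bound n" for n by (cases n) auto
  show "sqrt_bound n \<le> 1"
    by (induction n) (auto simp: power_le_one 1)
  have "0 \<le> (sqrt_bound n - 1)\<^sup>2" by simp
  then show "sqrt_bound n \<le> sqrt_bound (Suc n)"
    by (simp add: power2_diff)
qed

lemma norm_sqrt_approx:
  assumes W: "norm W \<le> 1"
  shows "norm (sqrt_approx W n) \<le> sqrt_bound n"
proof (induction n)
  case (Suc n)
  have "norm (W + (sqrt_approx W n o\<^sub>L sqrt_approx W n))
      \<le> norm W + norm (sqrt_approx W n) * norm (sqrt_approx W n)"
    by (rule order_trans[OF norm_triangle_ineq add_left_mono[OF norm_blinfun_compose]])
  also have "\<dots> \<le> 1 + sqrt_bound n * sqrt_bound n"
    using W Suc by (intro add_mono mult_mono) (auto simp: sqrt_bound)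
  finally show ?case by (simp add: power2_eq_square)
qed simp

text \<open>The difference of squares is split as Y' D + D Y with D = Y' - Y, which needs no
  commutativity. The scalar sequence satisfies the same recursion with equality, so its increments
  dominate.\<close>

lemma norm_sqrt_approx_diff:
  assumes W: "norm W \<le> 1"
  shows "norm (sqrt_approx W (Suc n) - sqrt_approx W n) \<le> sqrt_bound (Suc n) - sqrt_bound n"
proof (induction n)
  case 0
  then show ?case using W by simp
next
  case (Suc n)
  let ?Y = "sqrt_approx W" and ?y = sqrt_bound
  let ?d = "?Y (Suc n) - ?Y n"
  have "?Y (Suc (Suc n)) - ?Y (Suc n) = (1 / 2) *\<^sub>R ((?Y (Suc n) o\<^sub>L ?Y (Suc n)) - (?Y n o\<^sub>L ?Y n))"
    by (subst (1 2) sqrt_approx.simps(2)) (simp add: scaleR_diff_right[symmetric] del: sqrt_approx.simps)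
  also have "(?Y (Suc n) o\<^sub>L ?Y (Suc n)) - (?Y n o\<^sub>L ?Y n) = (?Y (Suc n) o\<^sub>L ?d) + (?d o\<^sub>L ?Y n)"
    by (simp add: bounded_bilinear.diff_left[OF bounded_bilinear_blinfun_compose]
        bounded_bilinear.diff_right[OF bounded_bilinear_blinfun_compose] del: sqrt_approx.simps)
  finally have "norm (?Y (Suc (Suc n)) - ?Y (Suc n)) = norm ((?Y (Suc n) o\<^sub>L ?d) + (?d o\<^sub>L ?Y n)) / 2"
    by (simp del: sqrt_approx.simps)
  also have "\<dots> \<le> (norm (?Y (Suc n)) * norm ?d + norm ?d * norm (?Y n)) / 2"
    by (intro divide_right_mono order_trans[OF norm_triangle_ineq] add_mono norm_blinfun_compose) simp
  also have "\<dots> \<le> (?y (Suc n) * (?y (Suc n) - ?y n) + (?y (Suc n) - ?y n) * ?y n) / 2"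
    by (intro divide_right_mono add_mono mult_mono norm_sqrt_approx[OF W] Suc)
      (use sqrt_bound norm_ge_zero in \<open>auto simp del: sqrt_bound.simps\<close>)
  also have "\<dots> = ?y (Suc (Suc n)) - ?y (Suc n)"
    unfolding sqrt_bound.simps(2)[of "Suc n"] using sqrt_bound.simps(2)[of n]
    by (simp add: field_simps power2_eq_square del: sqrt_bound.simps)
  finally show ?case .
qed

text \<open>The scalar sequence increases and is bounded by 1, so its increments are summable; the
  operator increments are then absolutely summable, and they telescope.\<close>

lemma convergent_sqrt_approx:
  assumes W: "norm W \<le> 1"
  shows "convergent (sqrt_approx W)"
proof -
  obtain l where "sqrt_bound \<longlonglongrightarrow> l"
    by (rule incseq_convergent[of sqrt_bound 1])
      (use sqrt_bound in \<open>auto intro!: incseq_SucI simp del: sqrt_bound.simps\<close>)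
  then have "summable (\<lambda>n. sqrt_bound (Suc n) - sqrt_bound n)"
    by (rule telescope_summable)
  then have "summable (\<lambda>n. sqrt_approx W (Suc n) - sqrt_approx W n)"
    by (rule summable_comparison_test'[where N = 0]) (rule norm_sqrt_approx_diff[OF W])
  then have "convergent (\<lambda>n. \<Sum>i<n. sqrt_approx W (Suc i) - sqrt_approx W i)"
    by (simp add: summable_iff_convergent del: sqrt_approx.simps)
  moreover have "(\<Sum>i<n. sqrt_approx W (Suc i) - sqrt_approx W i) = sqrt_approx W n" for n
    by (subst sum_lessThan_telescope) simp
  ultimately show ?thesis by simp
qed

text \<open>If \<open>Y = (W + Y\<^sup>2) / 2\<close>, then \<open>(1 - Y)\<^sup>2 = 1 - W\<close>.\<close>

lemma positive_op_sqrt: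
  assumes A: "bounded_clinear (A :: 'h::separable_chilbert \<Rightarrow> 'h)" "positive_op A"
  obtains B where "bounded_clinear B" "positive_op B" "\<And>x. B (B x) = A x"
    "\<And>D x. bounded_linear D \<Longrightarrow> (\<And>x. D (A x) = A (D x)) \<Longrightarrow> D (B x) = B (D x)"
proof -
  note l = bounded_clinearD[OF A(1)]
  obtain c where c: "c > 0" "\<And>x. norm (A x) \<le> norm x * c"
    using bounded_linear.pos_bounded[OF l(1)] by blast
  \<comment> \<open>Dividing by a norm bound c of A places the form of w between 0 and |x|^2. If Y
    solves the fixed point equation for w, then sqrt c times 1 - Y squares to c (1 - w) = A.\<close>
  define w where "w x = x - (1 / c) *\<^sub>R A x" for x
  have w: "bounded_clinear w"
    unfolding w_def[abs_def] scaleR_scaleC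
    by (intro bounded_clinear_diff bounded_clinear_id
        bounded_clinear_compose[OF bounded_clinear_scaleC A(1)])
  have wq: "cinner (w x) x = complex_of_real ((norm x)\<^sup>2) - (1 / c) * cinner (A x) x" for x
    by (simp add: w_def scaleR_scaleC cinner_algebra cinner_self)
  have Ac: "Re (cinner (A x) x) \<le> c * (norm x)\<^sup>2" for x
  proof -
    have "Re (cinner (A x) x) \<le> norm (A x) * norm x"
      by (meson cinner_Cauchy_Schwarz complex_Re_le_cmod order_trans)
    also have "\<dots> \<le> (norm x * c) * norm x"
      by (intro mult_right_mono c) simp
    finally show ?thesis by (simp add: power2_eq_square mult_ac)
  qed
  have Apos: "0 \<le> Re (cinner (A x) x)" "cinner (A x) x \<in> \<real>" for x
    using A(2) by (auto simp: positive_op_def)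
  have wpos: "positive_op w"
    unfolding positive_op_def wq
  proof (intro allI conjI)
    fix x
    show "complex_of_real ((norm x)\<^sup>2) - (1 / c) * cinner (A x) x \<in> \<real>"
      using Apos(2)[of x] by (intro Reals_diff Reals_mult) (auto simp del: of_real_power)
    have "Re (cinner (A x) x) / c \<le> (norm x)\<^sup>2"
      using Ac[of x] c(1) by (simp add: divide_le_eq mult.commute)
    then show "0 \<le> Re (complex_of_real ((norm x)\<^sup>2) - (1 / c) * cinner (A x) x)"
      by (simp del: of_real_power)
  qed
  have "norm (w x) \<le> 1 * norm x" for x
    by (rule positive_op_norm_le[OF w wpos])
      (use Apos(1) c(1) in \<open>auto simp: wq simp del: of_real_power\<close>)
  define W where "W = Blinfun w"
  have W_apply: "blinfun_apply W = w"
    unfolding W_def using w by (intro bounded_linear_Blinfun_apply) (auto simp: bounded_clinear_def)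
  have nW: "norm W \<le> 1"
    by (rule norm_blinfun_bound) (use \<open>\<And>x. norm (w x) \<le> 1 * norm x\<close> in \<open>auto simp: W_apply\<close>)
  obtain Y where Y: "sqrt_approx W \<longlonglongrightarrow> Y"
    using convergent_sqrt_approx[OF nW] by (auto simp: convergent_def)
  have "(\<lambda>n. (1 / 2) *\<^sub>R (W + (sqrt_approx W n o\<^sub>L sqrt_approx W n))) \<longlonglongrightarrow> (1 / 2) *\<^sub>R (W + (Y o\<^sub>L Y))"
    by (intro tendsto_intros bounded_bilinear.tendsto[OF bounded_bilinear_blinfun_compose] Y)
  moreover have "(\<lambda>n. sqrt_approx W (Suc n)) \<longlonglongrightarrow> Y"
    using Y by (rule LIMSEQ_Suc)
  ultimately have fixp: "Y = (1 / 2) *\<^sub>R (W + (Y o\<^sub>L Y))"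
    using LIMSEQ_unique by simp
  have Yx: "Y (Y x) = 2 *\<^sub>R Y x - w x" for x
  proof -
    have "Y x = ((1 / 2) *\<^sub>R (W + (Y o\<^sub>L Y))) x"
      using fixp by simp
    also have "\<dots> = (1 / 2) *\<^sub>R (w x + Y (Y x))"
      by (simp add: blinfun.scaleR_left blinfun.add_left W_apply)
    finally have "2 *\<^sub>R Y x = 2 *\<^sub>R (1 / 2) *\<^sub>R (w x + Y (Y x))"
      by (rule arg_cong)
    then have "2 *\<^sub>R Y x = w x + Y (Y x)"
      by simp
    then show ?thesis by simp
  qed
  have lim: "(\<lambda>n. sqrt_approx W n x) \<longlonglongrightarrow> Y x" for x
    using Y by (intro tendsto_intros)
  have cl: "bounded_clinear (blinfun_apply (sqrt_approx W n))" for n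
  proof (induction n)
    case (Suc n)
    show ?case
      unfolding sqrt_approx.simps blinfun.scaleR_left blinfun.add_left W_apply blinfun_apply_blinfun_compose scaleR_scaleC
      by (intro bounded_clinear_compose[OF bounded_clinear_scaleC] bounded_clinear_add w
          bounded_clinear_compose[OF Suc Suc])
  qed (simp add: bounded_clinear_def)
  have Ycl: "bounded_clinear (blinfun_apply Y)"
    by (rule bounded_clinear_limit[OF Y cl])
  have sym: "cinner (sqrt_approx W n x) y = cinner x (sqrt_approx W n y)" for n x y
    by (induction n arbitrary: x y)
      (simp_all add: blinfun.scaleR_left blinfun.add_left W_apply scaleR_scaleC cinner_algebra
        positive_op_symmetric[OF w wpos])
  have Ysym: "cinner (Y x) y = cinner x (Y y)" for x y
  proof (rule LIMSEQ_unique)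
    show "(\<lambda>n. cinner (sqrt_approx W n x) y) \<longlonglongrightarrow> cinner (Y x) y"
      using bounded_linear.tendsto[OF bounded_bilinear.bounded_linear_left[OF bounded_bilinear_cinner] lim] .
    show "(\<lambda>n. cinner (sqrt_approx W n x) y) \<longlonglongrightarrow> cinner x (Y y)"
      unfolding sym
      using bounded_linear.tendsto[OF bounded_bilinear.bounded_linear_right[OF bounded_bilinear_cinner] lim] .
  qed
  have nY: "norm Y \<le> 1"
    by (rule LIMSEQ_le_const2[OF tendsto_norm[OF Y]])
      (use norm_sqrt_approx[OF nW] sqrt_bound(2) order_trans in blast)
  \<comment> \<open>Commutation passes through the polynomial iterates to the limit. Uniqueness of
    the square root depends on this property.\<close>
  have com: "D (Y x) = Y (D x)" if D: "bounded_linear D" "\<And>x. D (A x) = A (D x)" for D x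
  proof -
    interpret D: bounded_linear D by fact
    have Dw: "D (w x) = w (D x)" for x
      by (simp add: w_def D.diff D.scaleR D(2))
    have "D (sqrt_approx W n x) = sqrt_approx W n (D x)" for n x
      by (induction n arbitrary: x)
        (simp_all add: blinfun.scaleR_left blinfun.add_left W_apply Dw D.scaleR D.add D.zero)
    then show ?thesis
      using D.tendsto[OF lim[of x]] lim[of "D x"] LIMSEQ_unique by simp
  qed
  define B where "B x = sqrt c *\<^sub>R (x - Y x)" for x
  have B: "bounded_clinear B"
    unfolding B_def[abs_def] scaleR_scaleC
    by (intro bounded_clinear_diff bounded_clinear_id Ycl
        bounded_clinear_compose[OF bounded_clinear_scaleC])
  have Bpos: "positive_op B"
    unfolding positive_op_def
  proof (intro allI conjI)
    fix x
    have "cinner (Y x) x = cnj (cinner (Y x) x)"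
      by (metis Ysym cinner_commute)
    then have real: "cinner (Y x) x \<in> \<real>" by (simp add: Reals_cnj_iff)
    have eq: "cinner (B x) x = complex_of_real (sqrt c) * (complex_of_real ((norm x)\<^sup>2) - cinner (Y x) x)"
      by (simp add: B_def scaleR_scaleC cinner_algebra cinner_self)
    show "cinner (B x) x \<in> \<real>"
      unfolding eq by (intro Reals_mult Reals_diff real Reals_of_real)
    have "Re (cinner (Y x) x) \<le> norm (Y x) * norm x"
      by (meson cinner_Cauchy_Schwarz complex_Re_le_cmod order_trans)
    also have "\<dots> \<le> (1 * norm x) * norm x"
      using nY by (intro mult_right_mono order_trans[OF norm_blinfun]) (auto intro: mult_right_mono)
    finally show "0 \<le> Re (cinner (B x) x)"
      unfolding eq using c(1) by (simp add: power2_eq_square)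
  qed
  have "B (B x) = A x" for x
  proof -
    have "B (B x) = (sqrt c * sqrt c) *\<^sub>R (x - Y x - (Y x - Y (Y x)))"
      by (simp add: B_def blinfun.scaleR_right blinfun.diff_right algebra_simps)
    also have "\<dots> = c *\<^sub>R (x - w x)"
      using c(1) by (simp add: Yx scaleR_2)
    also have "\<dots> = A x"
      using c(1) by (simp add: w_def)
    finally show ?thesis .
  qed
  moreover have "D (B x) = B (D x)" if "bounded_linear D" "\<And>x. D (A x) = A (D x)" for D x
  proof -
    interpret D: bounded_linear D by fact
    show ?thesis by (simp add: B_def D.scaleR D.diff com[OF that])
  qed
  ultimately show ?thesis using that[OF B Bpos] by blast
qed

section \<open>Uniqueness of the square root and the absolute value of an operator\<close>

lemma positive_op_zero:
  assumes "bounded_clinear A" "positive_op A" "cinner (A x) x = 0"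
  shows "A x = 0"
proof -
  have "(cmod (cinner (A x) (A x)))\<^sup>2 \<le> 0"
    using positive_op_Cauchy_Schwarz[OF assms(1,2), of x "A x"] assms(3) by simp
  then show ?thesis by (simp add: cinner_self)
qed

text \<open>A square root T commutes with A = T^2, hence with the constructed root S. For y = S x -
  T x this gives (S + T) y = S^2 x - T^2 x = 0; both forms are nonnegative, so S y = T y = 0 and
  |y|^2 = <x, S y - T y> = 0.\<close>

lemma positive_op_sqrt_unique:
  assumes A: "bounded_clinear A" "positive_op A"
    and B: "bounded_clinear B" "positive_op B" "\<And>x. B (B x) = A x"
    and B': "bounded_clinear B'" "positive_op B'" "\<And>x. B' (B' x) = A x"
  shows "B = B'"
proof -
  obtain S where S: "bounded_clinear S" "positive_op S" "\<And>x. S (S x) = A x"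
    "\<And>D x. bounded_linear D \<Longrightarrow> (\<And>x. D (A x) = A (D x)) \<Longrightarrow> D (S x) = S (D x)"
    using positive_op_sqrt[OF A] by blast
  have "S = T" if T: "bounded_clinear T" "positive_op T" "\<And>x. T (T x) = A x" for T
  proof
    fix x
    note lS = bounded_clinearD[OF S(1)] and lT = bounded_clinearD[OF T(1)]
    have com: "T (S z) = S (T z)" for z
      by (rule S(4)[OF lT(1)]) (simp flip: T(3))
    define y where "y = S x - T x"
    have "S y + T y = 0"
      by (simp add: y_def lS lT com S(3) T(3))
    then have sum0: "cinner (S y) y + cinner (T y) y = 0"
      by (metis cinner_add_left cinner_zero_left)
    moreover have "cinner (S y) y = complex_of_real (Re (cinner (S y) y))"
        "cinner (T y) y = complex_of_real (Re (cinner (T y) y))"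
        "0 \<le> Re (cinner (S y) y)" "0 \<le> Re (cinner (T y) y)"
      using S(2) T(2) by (auto simp: positive_op_def)
    ultimately have "cinner (S y) y = 0" "cinner (T y) y = 0"
      by (metis add_nonneg_eq_0_iff of_real_0 plus_complex.sel(1) zero_complex.sel(1))+
    then have 0: "S y = 0" "T y = 0"
      using positive_op_zero S T by blast+
    have "cinner y y = cinner x (S y - T y)"
      using positive_op_symmetric[OF S(1,2)] positive_op_symmetric[OF T(1,2)]
      by (simp add: y_def cinner_algebra lS lT)
    then have "y = 0"
      using 0 by (simp add: cinner_self)
    then show "S x = T x" by (simp add: y_def)
  qed
  then show ?thesis using B B' by metis
qed

text \<open>\<open>cadjoint A\<close> composed with A is bounded and positive, so existence and
  uniqueness of its root discharge the definite description. The norm identity reads | |A| x |^2 =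
  <G x, x> = |A x|^2.\<close>

lemma op_abs:
  assumes E: "is_cons (E :: 'h::separable_chilbert set)" and A: "bounded_clinear (A :: 'h \<Rightarrow> 'h)"
  shows "bounded_clinear (op_abs A)" "positive_op (op_abs A)" "norm (op_abs A x) = norm (A x)"
proof -
  note l = bounded_clinearD[OF A]
  define G where "G = cadjoint A \<circ> A"
  note adj = cadjoint[OF E A]
  have adj': "cinner (cadjoint A x) y = cinner x (A y)" for x y
    by (metis adj cinner_commute)
  have cl: "bounded_clinear (cadjoint A)"
  proof -
    have ext: "u = v" if "\<And>y. cinner u y = cinner v y" for u v :: 'h
      using cons_complete[OF E] that by blast
    obtain k where k: "k > 0" "\<And>x. norm (A x) \<le> norm x * k"
      using bounded_linear.pos_bounded[OF l(1)] by blast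
    have n: "norm (cadjoint A x) \<le> norm x * k" for x
    proof -
      have "(norm (cadjoint A x))\<^sup>2 = Re (cinner x (A (cadjoint A x)))"
        by (simp add: power2_norm_eq_cinner adj')
      also have "\<dots> \<le> norm x * norm (A (cadjoint A x))"
        by (meson cinner_Cauchy_Schwarz complex_Re_le_cmod order_trans)
      also have "\<dots> \<le> norm x * (norm (cadjoint A x) * k)"
        by (intro mult_left_mono k) simp
      finally show ?thesis
        using k(1) by (cases "cadjoint A x = 0") (auto simp: power2_eq_square)
    qed
    have sc: "cadjoint A (c *\<^sub>C x) = c *\<^sub>C cadjoint A x" for c x
      by (rule ext) (simp add: adj' cinner_algebra)
    show ?thesis
      unfolding bounded_clinear_def
      using n sc by (auto intro!: bounded_linear_intro[where K = k] ext simp: adj' cinner_algebra scaleR_scaleC)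
  qed
  have G: "bounded_clinear G"
    unfolding G_def comp_def by (rule bounded_clinear_compose[OF cl A])
  have "cinner (G x) x = complex_of_real ((norm (A x))\<^sup>2)" for x
    by (simp add: G_def adj' cinner_self)
  then have Gpos: "positive_op G"
    by (simp add: positive_op_def)
  have "\<exists>!B. bounded_clinear B \<and> positive_op B \<and> B \<circ> B = G"
  proof (rule ex_ex1I)
    show "\<exists>B. bounded_clinear B \<and> positive_op B \<and> B \<circ> B = G"
      using positive_op_sqrt[OF G Gpos] by (metis comp_apply ext)
  next
    fix B B'
    assume "bounded_clinear B \<and> positive_op B \<and> B \<circ> B = G" "bounded_clinear B' \<and> positive_op B' \<and> B' \<circ> B' = G"
    then show "B = B'"
      using positive_op_sqrt_unique[OF G Gpos] by (metis comp_apply)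
  qed
  from theI'[OF this]
  have *: "bounded_clinear (op_abs A) \<and> positive_op (op_abs A) \<and> op_abs A \<circ> op_abs A = G"
    by (simp add: op_abs_def G_def)
  then show B: "bounded_clinear (op_abs A)" "positive_op (op_abs A)" by auto
  have "cinner (op_abs A x) (op_abs A x) = cinner (G x) x"
    using * positive_op_symmetric[OF B, of "op_abs A x" x] by (metis comp_apply)
  also have "\<dots> = cinner (A x) (A x)"
    by (simp add: G_def adj')
  finally have "(norm (op_abs A x))\<^sup>2 = (norm (A x))\<^sup>2"
    by (simp add: power2_norm_eq_cinner)
  then show "norm (op_abs A x) = norm (A x)" by simp
qed

section \<open>Trace norm and Hilbert--Schmidt norm\<close>

text \<open>The inverse of B + r. Positivity gives r |x| <= |(B + r) x|, hence injectivity and the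
  bound 1/r; surjectivity comes from a Banach fixed point.\<close>

lemma positive_op_resolvent:
  assumes B: "bounded_clinear (B :: 'h::separable_chilbert \<Rightarrow> 'h)" "positive_op B" and r: "(r::real) > 0"
  obtains R where "bounded_clinear R" "\<And>x. B (R x) + r *\<^sub>R R x = x" "\<And>x. R (B x + r *\<^sub>R x) = x"
proof -
  note l = bounded_clinearD[OF B(1)]
  obtain k where k: "k > 0" "\<And>x. norm (B x) \<le> norm x * k"
    using bounded_linear.pos_bounded[OF l(1)] by blast
  define G where "G x = B x + r *\<^sub>R x" for x
  have G: "bounded_clinear G"
    unfolding G_def[abs_def] scaleR_scaleC
    by (intro bounded_clinear_add B bounded_clinear_scaleC)
  note lG = bounded_clinearD[OF G]
  have Bpos: "0 \<le> Re (cinner (B x) x)" "cinner (B x) x \<in> \<real>" for x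
    using B(2) by (auto simp: positive_op_def)
  have below: "r * norm x \<le> norm (G x)" for x
  proof -
    have "r * (norm x)\<^sup>2 \<le> Re (cinner (G x) x)"
      using Bpos(1)[of x] by (simp add: G_def scaleR_scaleC cinner_algebra cinner_self del: of_real_power)
    also have "\<dots> \<le> norm (G x) * norm x"
      by (meson cinner_Cauchy_Schwarz complex_Re_le_cmod order_trans)
    finally show ?thesis by (cases "x = 0") (auto simp: power2_eq_square)
  qed
  have inj: "x = y" if "G x = G y" for x y
    using below[of "x - y"] that r by (simp add: lG mult_le_0_iff)
  have surj: "\<exists>x. G x = y" for y
  proof -
    \<comment> \<open>With this c, 1 - G/c = (k - B)/c has a form between 0 and k/c times |x|^2.
      Hence x - (G x - y)/c is a contraction with factor k/c < 1, and its fixed point solves G x =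
      y.\<close>
    define c where "c = k + r"
    have c: "c > 0" using k r by (simp add: c_def)
    define w where "w x = x - (1 / c) *\<^sub>R G x" for x
    have w: "bounded_clinear w"
      unfolding w_def[abs_def] scaleR_scaleC
      by (intro bounded_clinear_diff bounded_clinear_id
          bounded_clinear_compose[OF bounded_clinear_scaleC G])
    have wq: "cinner (w x) x = complex_of_real (k / c * (norm x)\<^sup>2) - (1 / c) * cinner (B x) x" for x
    proof -
      have "(k / c) *\<^sub>R x = x - (r / c) *\<^sub>R x"
        using c by (simp add: c_def diff_divide_distrib scaleR_diff_left[of 1, simplified, symmetric])
          (simp add: field_simps)
      then have "w x = (k / c) *\<^sub>R x - (1 / c) *\<^sub>R B x"
        by (simp add: w_def G_def algebra_simps)
      then show ?thesis
        by (simp add: scaleR_scaleC cinner_algebra cinner_self)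
    qed
    have "positive_op w"
      unfolding positive_op_def wq
    proof (intro allI conjI)
      fix x
      show "complex_of_real (k / c * (norm x)\<^sup>2) - (1 / c) * cinner (B x) x \<in> \<real>"
        using Bpos(2)[of x] by (intro Reals_diff Reals_mult Reals_of_real) auto
      have "Re (cinner (B x) x) \<le> norm (B x) * norm x"
        by (meson cinner_Cauchy_Schwarz complex_Re_le_cmod order_trans)
      also have "\<dots> \<le> (norm x * k) * norm x"
        by (intro mult_right_mono k) simp
      finally have "Re (cinner (B x) x) / c \<le> k / c * (norm x)\<^sup>2"
        using c by (simp add: power2_eq_square field_simps)
      then show "0 \<le> Re (complex_of_real (k / c * (norm x)\<^sup>2) - (1 / c) * cinner (B x) x)"
        by (simp del: of_real_power of_real_mult of_real_divide)
    qed
    then have wn: "norm (w x) \<le> k / c * norm x" for x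
      by (rule positive_op_norm_le[OF w])
        (use Bpos(1) c k in \<open>auto simp: wq simp del: of_real_power of_real_mult of_real_divide\<close>)
    define g where "g x = x - (1 / c) *\<^sub>R (G x - y)" for x
    have "\<exists>!x. g x = x"
    proof (rule banach_fix_type[of "k / c"], goal_cases)
      case 3
      show ?case
      proof (intro allI)
        fix x x'
        have "g x - g x' = w (x - x')"
          by (simp add: g_def w_def lG algebra_simps)
        then show "dist (g x) (g x') \<le> k / c * dist x x'"
          using wn[of "x - x'"] by (simp add: dist_norm)
      qed
    qed (use k r c in \<open>auto simp: c_def\<close>)
    then obtain x where "g x = x" by blast
    then have "(1 / c) *\<^sub>R (G x - y) = 0" by (simp add: g_def)
    then show ?thesis using c by auto
  qed
  define R where "R y = (SOME x. G x = y)" for y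
  have GR: "G (R y) = y" for y
    unfolding R_def using surj[of y] by (rule someI_ex)
  have RG: "R (G x) = x" for x
    by (rule inj) (rule GR)
  have "bounded_clinear R"
    unfolding bounded_clinear_def
  proof (intro conjI allI bounded_linear_intro[where K = "1 / r"])
    show "R (c *\<^sub>C x) = c *\<^sub>C R x" for c x by (rule inj) (simp add: GR lG)
    show "R (c *\<^sub>R x) = c *\<^sub>R R x" for c x by (rule inj) (simp add: GR lG scaleR_scaleC)
    show "R (x + y) = R x + R y" for x y by (rule inj) (simp add: GR lG)
    show "norm (R x) \<le> norm x * (1 / r)" for x
      using below[of "R x"] r by (simp add: GR field_simps)
  qed
  then show ?thesis
    using that[of R] GR RG by (simp add: G_def)
qed

lemma has_sum_sums:
  fixes f :: "'i \<Rightarrow> 'a \<Rightarrow> 'b::topological_ab_group_add"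
  assumes "\<And>i. i \<in> I \<Longrightarrow> (f i has_sum s i) A"
  shows "((\<lambda>x. \<Sum>i\<in>I. f i x) has_sum (\<Sum>i\<in>I. s i)) A"
  using assms
proof (induction I rule: infinite_finite_induct)
  case (insert i I)
  then show ?case by (simp add: has_sum_add)
qed auto

lemma infsum_ennreal_eq_ennreal:
  assumes "(\<Sum>\<^sub>\<infinity>i\<in>A. ennreal (g i)) \<noteq> \<infinity>" "\<And>i. i \<in> A \<Longrightarrow> 0 \<le> g i"
  obtains S where "(g has_sum S) A" "(\<Sum>\<^sub>\<infinity>i\<in>A. ennreal (g i)) = ennreal S"
proof -
  define T where "T = (\<Sum>\<^sub>\<infinity>i\<in>A. ennreal (g i))"
  have fin: "sum g F \<le> enn2real T" if "finite F" "F \<subseteq> A" for F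
  proof -
    have "ennreal (sum g F) = (\<Sum>i\<in>F. ennreal (g i))"
      using assms(2) that by (subst sum_ennreal) auto
    also have "\<dots> \<le> T"
      unfolding T_def nonneg_infsum_complete[OF zero_le] using that by (intro SUP_upper) auto
    finally show ?thesis
      using assms(1) unfolding T_def[symmetric] by (metis enn2real_mono enn2real_ennreal
          infinity_ennreal_def assms(2) subsetD sum_nonneg that(2) top.not_eq_extremum)
  qed
  have s: "g summable_on A"
    by (rule nonneg_bdd_above_summable_on[OF assms(2)]) (use fin in \<open>auto intro!: bdd_aboveI[of _ "enn2real T"]\<close>)
  have "ennreal (infsum g A) = (SUP F\<in>{F. finite F \<and> F \<subseteq> A}. ennreal (sum g F))"
    by (rule infsum_nonneg_is_SUPREMUM_ennreal[OF s assms(2)])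
  also have "\<dots> = T"
    unfolding T_def nonneg_infsum_complete[OF zero_le]
    by (intro SUP_cong refl) (subst sum_ennreal, use assms(2) in auto)
  finally show ?thesis
    using that[of "infsum g A"] s unfolding T_def by auto
qed

context
  fixes E :: "'h::separable_chilbert set"
  assumes E: "is_cons E"
begin

lemma trace_norm_eq_ennreal:
  assumes "trace_norm E A \<noteq> \<infinity>"
  obtains \<tau> where "bounded_clinear A" "((\<lambda>e. Re (cinner (op_abs A e) e)) has_sum \<tau>) E"
    "trace_norm E A = ennreal \<tau>" "\<tau> \<ge> 0"
proof -
  have A: "bounded_clinear A"
    using assms by (auto simp: trace_norm_def split: if_splits)
  have pos: "0 \<le> Re (cinner (op_abs A e) e)" for e
    using op_abs(2)[OF E A] by (auto simp: positive_op_def)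
  have "(\<Sum>\<^sub>\<infinity>e\<in>E. ennreal (Re (cinner (op_abs A e) e))) \<noteq> \<infinity>"
    using assms A by (simp add: trace_norm_def)
  then obtain \<tau> where "((\<lambda>e. Re (cinner (op_abs A e) e)) has_sum \<tau>) E"
    "(\<Sum>\<^sub>\<infinity>e\<in>E. ennreal (Re (cinner (op_abs A e) e))) = ennreal \<tau>"
    using infsum_ennreal_eq_ennreal[of "\<lambda>e. Re (cinner (op_abs A e) e)" E] pos by metis
  then show ?thesis
    using that[of \<tau>] A pos by (auto simp: trace_norm_def intro: has_sum_nonneg)
qed

text \<open>With b e = <|A| e, e>, Cauchy-Schwarz gives |<|A| e, e'>|^2 <= b e * b e'. Summing over
  e' by Parseval yields |A e|^2 <= b e * \<tau>, and summing over e yields \<tau>^2.\<close>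

lemma sum_norm_sq_le_trace_norm:
  assumes F: "finite F" "F \<subseteq> E"
  shows "ennreal (L2_set (\<lambda>e. norm (A e)) F) \<le> trace_norm E A"
proof (cases "trace_norm E A = \<infinity>")
  case False
  then obtain \<tau> where A: "bounded_clinear A" and \<tau>: "((\<lambda>e. Re (cinner (op_abs A e) e)) has_sum \<tau>) E"
    "trace_norm E A = ennreal \<tau>" "\<tau> \<ge> 0"
    by (rule trace_norm_eq_ennreal)
  define B where "B = op_abs A"
  note B = op_abs[OF E A, folded B_def]
  define b where "b e = Re (cinner (B e) e)" for e
  have b0: "b e \<ge> 0" for e using B(2) by (auto simp: b_def positive_op_def)
  have bs: "(b has_sum \<tau>) E" using \<tau>(1) by (simp add: b_def[abs_def] B_def)
  have "(norm (A e))\<^sup>2 \<le> b e * \<tau>" for e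
  proof -
    have "((\<lambda>e'. (cmod (cinner (B e) e'))\<^sup>2) has_sum (norm (A e))\<^sup>2) E"
      using Parseval_norm[OF E, of "B e"] by (simp add: B(3))
    moreover have "((\<lambda>e'. b e * b e') has_sum b e * \<tau>) E"
      by (rule has_sum_cmult_right[OF bs])
    ultimately show ?thesis
      by (rule has_sum_mono) (use positive_op_Cauchy_Schwarz[OF B(1,2)] in \<open>simp add: b_def\<close>)
  qed
  then have "(\<Sum>e\<in>F. (norm (A e))\<^sup>2) \<le> (\<Sum>e\<in>F. b e * \<tau>)"
    by (intro sum_mono)
  also have "\<dots> = (\<Sum>e\<in>F. b e) * \<tau>"
    by (simp add: sum_distrib_right)
  also have "\<dots> \<le> \<tau> * \<tau>"
    using finite_sum_le_has_sum[OF bs F] b0 \<tau>(3) by (intro mult_right_mono) auto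
  finally have "L2_set (\<lambda>e. norm (A e)) F \<le> \<tau>"
    unfolding L2_set_def using \<tau>(3) by (intro real_le_lsqrt) (auto simp: power2_eq_square)
  then show ?thesis
    by (simp add: \<tau>(2) ennreal_leI)
qed simp

text \<open>The squared matrix entries are the same for V and its adjoint. Exchanging the two
  summations leaves, for each e', a sum over \<open>F\<close> that Bessel bounds by |V
  e'|^2.\<close>

lemma adjoint_norm_sq_le:
  assumes V: "bounded_clinear V" and S: "((\<lambda>e. (norm (V e))\<^sup>2) has_sum S) E"
    and F: "finite F" "F \<subseteq> E"
  shows "(\<Sum>e\<in>F. (norm (cadjoint V e))\<^sup>2) \<le> S"
proof -
  have "((\<lambda>e'. \<Sum>e\<in>F. (cmod (cinner (cadjoint V e) e'))\<^sup>2) has_sum (\<Sum>e\<in>F. (norm (cadjoint V e))\<^sup>2)) E"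
    by (intro has_sum_sums Parseval_norm[OF E])
  moreover have "(\<Sum>e\<in>F. (cmod (cinner (cadjoint V e) e'))\<^sup>2) \<le> (norm (V e'))\<^sup>2" for e'
  proof -
    have "cmod (cinner (cadjoint V e) e') = cmod (cinner (V e') e)" for e
      by (metis cadjoint[OF E V] cinner_commute complex_mod_cnj)
    then show ?thesis using Bessel[OF E F] by simp
  qed
  ultimately show ?thesis by (rule has_sum_mono[OF _ S])
qed

text \<open>With \<open>B = |A|\<close> and \<open>U = A (B + \<epsilon>)\<^sup>-\<^sup>1\<close>, a contraction replacing the partial isometry of the polar
  decomposition, \<open>A = U B + \<epsilon> U\<close>, and \<open>U B = (U B\<^sup>1\<^sup>/\<^sup>2) B\<^sup>1\<^sup>/\<^sup>2\<close> is a product of two Hilbert--Schmidt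
  operators.\<close>

lemma norm_trace_le_trace_norm:
  assumes t: "((\<lambda>e. cinner (A e) e) has_sum t) E"
  shows "ennreal (cmod t) \<le> trace_norm E A"
proof (cases "trace_norm E A = \<infinity>")
  case False
  then obtain \<tau> where A: "bounded_clinear A" and \<tau>: "((\<lambda>e. Re (cinner (op_abs A e) e)) has_sum \<tau>) E"
    "trace_norm E A = ennreal \<tau>" "\<tau> \<ge> 0"
    by (rule trace_norm_eq_ennreal)
  define B where "B = op_abs A"
  note B = op_abs[OF E A, folded B_def]
  obtain S where S: "bounded_clinear S" "positive_op S" "\<And>x. S (S x) = B x"
    using positive_op_sqrt[OF B(1,2)] by metis
  note lS = bounded_clinearD[OF S(1)] and lB = bounded_clinearD[OF B(1)] and lA = bounded_clinearD[OF A]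
  \<comment> \<open>The root S of |A| is Hilbert-Schmidt, and its squared norm is the trace norm of
    A.\<close>
  have HS: "((\<lambda>e. (norm (S e))\<^sup>2) has_sum \<tau>) E"
    using \<tau>(1) positive_op_symmetric[OF S(1,2)]
    by (simp add: B_def[symmetric] power2_norm_eq_cinner S(3)[symmetric])
  have fin: "cmod (\<Sum>e\<in>F. cinner (A e) e) \<le> \<tau>" if F: "finite F" "F \<subseteq> E" for F
  proof -
    \<comment> \<open>The remainder r U costs at most r for each vector of the fixed finite set
      \<open>F\<close>, so it vanishes as r tends to 0.\<close>
    have approx: "cmod (\<Sum>e\<in>F. cinner (A e) e) \<le> \<tau> + r * card F" if r: "r > 0" for r :: real
    proof -
      obtain R where R: "bounded_clinear R" "\<And>x. B (R x) + r *\<^sub>R R x = x" "\<And>x. R (B x + r *\<^sub>R x) = x"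
        using positive_op_resolvent[OF B(1,2) r] by metis
      define U where "U x = A (R x)" for x
      have U: "bounded_clinear U"
        unfolding U_def by (rule bounded_clinear_compose[OF A R(1)])
      note lU = bounded_clinearD[OF U]
      \<comment> \<open>Expanding |x|^2 = |B R x + r R x|^2, the cross terms are nonnegative, so |x|
        >= |B R x| = |A R x|.\<close>
      have nU: "norm (U x) \<le> norm x" for x
      proof -
        have "(norm x)\<^sup>2 = (norm (B (R x) + r *\<^sub>R R x))\<^sup>2" by (simp add: R(2))
        also have "\<dots> = (norm (B (R x)))\<^sup>2 + r\<^sup>2 * (norm (R x))\<^sup>2
            + r * (Re (cinner (B (R x)) (R x)) + Re (cinner (R x) (B (R x))))"
          unfolding power2_norm_eq_cinner
          by (simp add: cinner_algebra scaleR_scaleC algebra_simps power2_eq_square)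
        also have "\<dots> \<ge> (norm (B (R x)))\<^sup>2"
        proof -
          have "0 \<le> Re (cinner (B (R x)) (R x))"
            using B(2) by (auto simp: positive_op_def)
          moreover have "Re (cinner (R x) (B (R x))) = Re (cinner (B (R x)) (R x))"
            using positive_op_symmetric[OF B(1,2), of "R x" "R x"] by simp
          ultimately show ?thesis using r by simp
        qed
        finally have "norm (B (R x)) \<le> norm x"
          by (simp add: power2_le_iff_abs_le)
        then show ?thesis by (simp add: U_def B(3))
      qed
      have AU: "A x = U (B x) + r *\<^sub>R U x" for x
        using arg_cong[OF R(3)[of x], of A] by (simp add: U_def[symmetric] lU scaleR_scaleC)
      define V where "V x = U (S x)" for x
      have V: "bounded_clinear V"
        unfolding V_def by (rule bounded_clinear_compose[OF U S(1)])
      have "(\<lambda>e. (norm (V e))\<^sup>2) summable_on E"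
        by (rule summable_on_comparison_test[of "\<lambda>e. (norm (S e))\<^sup>2"])
          (use HS nU in \<open>auto simp: summable_on_def V_def intro!: power_mono\<close>)
      then obtain v where v: "((\<lambda>e. (norm (V e))\<^sup>2) has_sum v) E"
        by (auto simp: summable_on_def)
      have "v \<le> \<tau>"
        by (rule has_sum_mono[OF v HS]) (auto simp: V_def nU intro!: power_mono)
      have "cmod (\<Sum>e\<in>F. cinner (A e) e) \<le> (\<Sum>e\<in>F. cmod (cinner (A e) e))"
        by (rule norm_sum)
      also have "\<dots> \<le> (\<Sum>e\<in>F. norm (S e) * norm (cadjoint V e) + r)"
      proof (rule sum_mono)
        fix e assume "e \<in> F"
        then have "norm e = 1" using F cons_norm[OF E] by auto
        have "cinner (A e) e = cinner (V (S e)) e + r * cinner (U e) e"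
          by (simp add: AU V_def S(3) cinner_algebra scaleR_scaleC)
        then have "cinner (A e) e = cinner (S e) (cadjoint V e) + r * cinner (U e) e"
          by (simp add: cadjoint[OF E V])
        then have "cmod (cinner (A e) e) \<le> cmod (cinner (S e) (cadjoint V e)) + r * cmod (cinner (U e) e)"
          using norm_triangle_ineq[of "cinner (S e) (cadjoint V e)" "r * cinner (U e) e"] r
          by (simp add: norm_mult)
        also have "\<dots> \<le> norm (S e) * norm (cadjoint V e) + r * 1"
          using r cinner_Cauchy_Schwarz[of "U e" e] nU[of e] \<open>norm e = 1\<close>
          by (intro add_mono mult_left_mono cinner_Cauchy_Schwarz) auto
        finally show "cmod (cinner (A e) e) \<le> norm (S e) * norm (cadjoint V e) + r" by simp
      qed
      also have "\<dots> = (\<Sum>e\<in>F. \<bar>norm (S e)\<bar> * \<bar>norm (cadjoint V e)\<bar>) + r * card F"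
        by (simp add: sum.distrib)
      also have "(\<Sum>e\<in>F. \<bar>norm (S e)\<bar> * \<bar>norm (cadjoint V e)\<bar>)
          \<le> L2_set (\<lambda>e. norm (S e)) F * L2_set (\<lambda>e. norm (cadjoint V e)) F"
        by (rule L2_set_mult_ineq)
      also have "\<dots> \<le> sqrt \<tau> * sqrt \<tau>"
        unfolding L2_set_def
      proof (intro mult_mono real_sqrt_le_mono)
        show "(\<Sum>e\<in>F. (norm (S e))\<^sup>2) \<le> \<tau>"
          by (rule finite_sum_le_has_sum[OF HS F]) simp
        show "(\<Sum>e\<in>F. (norm (cadjoint V e))\<^sup>2) \<le> \<tau>"
          using adjoint_norm_sq_le[OF V v F] \<open>v \<le> \<tau>\<close> by simp
      qed (use \<tau>(3) in \<open>auto simp: sum_nonneg\<close>)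
      finally show ?thesis using \<tau>(3) by simp
    qed
    show ?thesis
    proof (rule field_le_epsilon)
      fix \<epsilon> :: real assume "\<epsilon> > 0"
      have "\<epsilon> / (real (card F) + 1) * real (card F) \<le> \<epsilon>"
        using \<open>\<epsilon> > 0\<close> by (simp add: field_simps)
      then show "cmod (\<Sum>e\<in>F. cinner (A e) e) \<le> \<tau> + \<epsilon>"
        using approx[of "\<epsilon> / (real (card F) + 1)"] \<open>\<epsilon> > 0\<close> by (simp add: add_pos_nonneg)
    qed
  qed
  have "cmod t \<le> \<tau>"
  proof (rule tendsto_upperbound)
    show "((\<lambda>F. cmod (\<Sum>e\<in>F. cinner (A e) e)) \<longlongrightarrow> cmod t) (finite_subsets_at_top E)"
      using t unfolding has_sum_def by (rule tendsto_norm)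
    show "\<forall>\<^sub>F F in finite_subsets_at_top E. cmod (\<Sum>e\<in>F. cinner (A e) e) \<le> \<tau>"
      by (rule eventually_finite_subsets_at_top_weakI) (use fin in auto)
  qed simp
  then show ?thesis by (simp add: \<tau>(2) ennreal_leI)
qed simp

end

text \<open>Finite sections make Hilbert--Schmidt bounds free of measurability questions.\<close>

lemma hs_norm_le:
  assumes A: "bounded_clinear A" and c: "0 \<le> c"
    and F: "\<And>F. finite F \<Longrightarrow> F \<subseteq> E \<Longrightarrow> L2_set (\<lambda>e. norm (A e)) F \<le> c"
  shows "hs_norm E A \<le> ennreal c"
proof -
  have "(\<Sum>\<^sub>\<infinity>e\<in>E. ennreal ((norm (A e))\<^sup>2)) \<le> ennreal (c\<^sup>2)"
    unfolding nonneg_infsum_complete[OF zero_le]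
  proof (rule SUP_least)
    fix F assume F': "F \<in> {F. finite F \<and> F \<subseteq> E}"
    have "(\<Sum>e\<in>F. ennreal ((norm (A e))\<^sup>2)) = ennreal ((L2_set (\<lambda>e. norm (A e)) F)\<^sup>2)"
      by (simp add: L2_set_def sum_nonneg)
    also have "\<dots> \<le> ennreal (c\<^sup>2)"
      using F F' by (intro ennreal_leI power_mono) auto
    finally show "(\<Sum>e\<in>F. ennreal ((norm (A e))\<^sup>2)) \<le> ennreal (c\<^sup>2)" .
  qed
  then have "esqrt (\<Sum>\<^sub>\<infinity>e\<in>E. ennreal ((norm (A e))\<^sup>2)) \<le> ennreal c"
    by (auto simp: esqrt_def top_unique intro!: ennreal_leI real_le_lsqrt c enn2real_leI)
  then show ?thesis using A by (simp add: hs_norm_def)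
qed

lemma hs_norm_power2:
  assumes "bounded_clinear A"
  shows "(hs_norm E A)\<^sup>2 = (\<Sum>\<^sub>\<infinity>e\<in>E. ennreal ((norm (A e))\<^sup>2))"
proof (cases "(\<Sum>\<^sub>\<infinity>e\<in>E. ennreal ((norm (A e))\<^sup>2))" rule: ennreal_cases)
  case (real t)
  then show ?thesis using assms by (simp add: hs_norm_def esqrt_def ennreal_power)
next
  case top
  then show ?thesis using assms by (simp add: hs_norm_def esqrt_def power2_eq_square ennreal_mult_top)
qed

section \<open>The kernel\<close>

lemma axis_increment_le:
  fixes g :: "real^'d \<Rightarrow> real"
  assumes diff: "\<And>x. (\<lambda>r. g (x + r *\<^sub>R axis i 1)) field_differentiable at 0"
    and b: "\<And>s. s \<in> closed_segment 0 r \<Longrightarrow> \<bar>pderiv_dir i g (x + s *\<^sub>R axis i 1)\<bar> \<le> b"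
  shows "\<bar>g (x + r *\<^sub>R axis i 1) - g x\<bar> \<le> b * \<bar>r\<bar>"
proof -
  define \<phi> where "\<phi> s = g (x + s *\<^sub>R axis i 1)" for s
  have "(\<phi> has_field_derivative pderiv_dir i g (x + s *\<^sub>R axis i 1)) (at s)" for s
  proof -
    have "((\<lambda>r. g ((x + s *\<^sub>R axis i 1) + r *\<^sub>R axis i 1)) has_field_derivative
        pderiv_dir i g (x + s *\<^sub>R axis i 1)) (at 0)"
      unfolding pderiv_dir_def using diff by (simp add: DERIV_deriv_iff_field_differentiable)
    also have "(\<lambda>r. g ((x + s *\<^sub>R axis i 1) + r *\<^sub>R axis i 1)) = (\<lambda>r. \<phi> (r + s))"
      by (simp add: \<phi>_def scaleR_add_left add_ac)
    finally show ?thesis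
      using DERIV_shift[of \<phi> "pderiv_dir i g (x + s *\<^sub>R axis i 1)" 0 s] by simp
  qed
  then have "norm (\<phi> r - \<phi> 0) \<le> b * norm (r - 0)"
    by (intro field_differentiable_bound[of "closed_segment 0 r" \<phi>
          "\<lambda>s. pderiv_dir i g (x + s *\<^sub>R axis i 1)"])
      (auto simp: b has_field_derivative_at_within)
  then show ?thesis by (simp add: \<phi>_def)
qed

text \<open>Only derivatives along the axes are available, so x is joined to y by changing one
  coordinate at a time. The path stays in the box spanned by x and y, where the bound b is assumed,
  and its length is the l1 distance.\<close>

lemma increment_le_l1:
  fixes g :: "real^'d \<Rightarrow> real"
  assumes diff: "\<And>x i. (\<lambda>r. g (x + r *\<^sub>R axis i 1)) field_differentiable at 0"
    and b: "\<And>z i. (\<And>j. z $ j \<in> closed_segment (x $ j) (y $ j)) \<Longrightarrow> \<bar>pderiv_dir i g z\<bar> \<le> b"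
  shows "\<bar>g y - g x\<bar> \<le> b * (\<Sum>i\<in>UNIV. \<bar>y $ i - x $ i\<bar>)"
proof -
  \<comment> \<open>The point of the path at which the coordinates in I have already been moved from
    x to y.\<close>
  define m where "m I = (\<chi> j. if j \<in> I then y $ j else x $ j)" for I
  have "\<bar>g (m I) - g x\<bar> \<le> b * (\<Sum>i\<in>I. \<bar>y $ i - x $ i\<bar>)" if "finite I" for I
    using that
  proof induction
    case empty
    have "m {} = x" by (simp add: m_def vec_eq_iff)
    then show ?case by simp
  next
    case (insert i I)
    have eq: "m (insert i I) = m I + (y $ i - x $ i) *\<^sub>R axis i 1"
      using insert by (auto simp: m_def vec_eq_iff axis_def)
    have "\<bar>g (m (insert i I)) - g (m I)\<bar> \<le> b * \<bar>y $ i - x $ i\<bar>"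
      unfolding eq
    proof (rule axis_increment_le[OF diff b])
      fix s j assume s: "s \<in> closed_segment 0 (y $ i - x $ i)"
      then obtain u where u: "0 \<le> u" "u \<le> 1" "s = u * (y $ i - x $ i)"
        by (auto simp: closed_segment_def)
      have "x $ i + s \<in> closed_segment (x $ i) (y $ i)"
        using u by (auto simp: closed_segment_def algebra_simps)
      then show "(m I + s *\<^sub>R axis i 1) $ j \<in> closed_segment (x $ j) (y $ j)"
        using insert by (auto simp: m_def axis_def)
    qed
    then show ?case
      using insert by (simp add: distrib_left)
  qed
  moreover have "m UNIV = y" by (simp add: m_def vec_eq_iff)
  ultimately show ?thesis by (metis finite)
qed

lemma sum_abs_le_card_norm: "(\<Sum>i\<in>UNIV. \<bar>(x :: real^'d) $ i\<bar>) \<le> CARD('d) * norm x"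
  using sum_mono[of UNIV "\<lambda>i. \<bar>x $ i\<bar>" "\<lambda>_. norm x"] component_le_norm_cart[of x] by simp

text \<open>Taylor's estimate without a Taylor polynomial: all derivatives of order 1 to lam vanish
  at 0, so integrating along an axis path from 0 lowers the order by one and gains a factor equal to
  the l1 norm of u. Neither symmetry nor continuity of the derivatives enters.\<close>

lemma kernel_Taylor:
  fixes K :: "real^'d \<Rightarrow> real"
  assumes diff: "has_pderivs_upto (lam + 1) K"
    and zero: "\<And>js. 1 \<le> length js \<Longrightarrow> length js \<le> lam \<Longrightarrow> iter_pderiv js K 0 = 0"
    and bdd: "\<And>js. length js = lam + 1 \<Longrightarrow> bounded (range (iter_pderiv js K))"
  obtains c where "c \<ge> 0"
    "\<And>js u. 1 \<le> length js \<Longrightarrow> length js \<le> lam + 1 \<Longrightarrow>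
       \<bar>iter_pderiv js K u\<bar> \<le> c * (\<Sum>i\<in>UNIV. \<bar>u $ i\<bar>) ^ (lam + 1 - length js)"
    "\<And>u. \<bar>K u - K 0\<bar> \<le> c * (\<Sum>i\<in>UNIV. \<bar>u $ i\<bar>) ^ (lam + 1)"
proof -
  have "\<exists>c. \<forall>u. \<bar>iter_pderiv js K u\<bar> \<le> c" if "length js = lam + 1" for js
    using bdd[OF that] by (auto simp: bounded_iff)
  then obtain c' where c': "\<And>js u. length js = lam + 1 \<Longrightarrow> \<bar>iter_pderiv js K u\<bar> \<le> c' js"
    by metis
  define J :: "'d list set" where "J = {js. length js = lam + 1}"
  have finJ: "finite J" unfolding J_def using finite_lists_length_eq[of "UNIV :: 'd set"] by simp
  \<comment> \<open>There are finitely many direction lists of length lam + 1, so one constant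
    bounds all top-order derivatives.\<close>
  define c where "c = (\<Sum>js\<in>J. \<bar>c' js\<bar>)"
  have c0: "c \<ge> 0" by (simp add: c_def sum_nonneg)
  have cJ: "\<bar>iter_pderiv js K u\<bar> \<le> c" if "length js = lam + 1" for js u
    using c'[OF that, of u] member_le_sum[of js J "\<lambda>js. \<bar>c' js\<bar>"] that finJ
    by (simp add: c_def J_def)
  have step: "\<bar>iter_pderiv js K u - iter_pderiv js K 0\<bar> \<le> c * (\<Sum>i\<in>UNIV. \<bar>u $ i\<bar>) ^ Suc m"
    if js: "length js \<le> lam"
      and IH: "\<And>i z. \<bar>iter_pderiv (i # js) K z\<bar> \<le> c * (\<Sum>i\<in>UNIV. \<bar>z $ i\<bar>) ^ m" for js u m
  proof -
    have "\<bar>iter_pderiv js K u - iter_pderiv js K 0\<bar>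
        \<le> (c * (\<Sum>i\<in>UNIV. \<bar>u $ i\<bar>) ^ m) * (\<Sum>i\<in>UNIV. \<bar>u $ i - 0 $ i\<bar>)"
    proof (rule increment_le_l1)
      show "(\<lambda>r. iter_pderiv js K (x + r *\<^sub>R axis i 1)) field_differentiable at 0" for x i
        using diff js by (simp add: has_pderivs_upto_def)
      fix z :: "real^'d" and i assume z: "\<And>j. z $ j \<in> closed_segment (0 $ j) (u $ j)"
      have zu: "\<bar>z $ j\<bar> \<le> \<bar>u $ j\<bar>" for j
        using z[of j] by (auto simp: closed_segment_eq_real_ivl split: if_splits)
      have "\<bar>pderiv_dir i (iter_pderiv js K) z\<bar> \<le> c * (\<Sum>i\<in>UNIV. \<bar>z $ i\<bar>) ^ m"
        using IH[of i z] by (simp add: iter_pderiv_def)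
      also have "\<dots> \<le> c * (\<Sum>i\<in>UNIV. \<bar>u $ i\<bar>) ^ m"
        by (intro mult_left_mono power_mono sum_mono zu c0 sum_nonneg) auto
      finally show "\<bar>pderiv_dir i (iter_pderiv js K) z\<bar> \<le> c * (\<Sum>i\<in>UNIV. \<bar>u $ i\<bar>) ^ m" .
    qed
    then show ?thesis by (simp add: mult_ac)
  qed
  \<comment> \<open>Induction on m, the number of orders by which js falls short of lam + 1.\<close>
  have all: "\<bar>iter_pderiv js K u\<bar> \<le> c * (\<Sum>i\<in>UNIV. \<bar>u $ i\<bar>) ^ m"
    if "length js = lam + 1 - m" "m \<le> lam" for js u m
    using that
  proof (induction m arbitrary: js u)
    case 0
    then show ?case using cJ by simp
  next
    case (Suc m)
    have "iter_pderiv js K 0 = 0" using Suc.prems by (intro zero) auto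
    then show ?case
      using step[of js m u] Suc.prems Suc.IH by simp
  qed
  show ?thesis
  proof
    show "c \<ge> 0" by fact
    show "\<bar>iter_pderiv js K u\<bar> \<le> c * (\<Sum>i\<in>UNIV. \<bar>u $ i\<bar>) ^ (lam + 1 - length js)"
      if "1 \<le> length js" "length js \<le> lam + 1" for js u
      by (rule all) (use that in auto)
    show "\<bar>K u - K 0\<bar> \<le> c * (\<Sum>i\<in>UNIV. \<bar>u $ i\<bar>) ^ (lam + 1)" for u
      using step[of "[]" lam u] all[of "[_]" lam] by (simp add: iter_pderiv_def)
  qed
qed

text \<open>The Lipschitz bound comes from the first-order Taylor estimates on the support ball.
  Flatness near 0 uses lam + 1 > \<beta> together with |u| <= 1; for |u| > 1 the trivial |K u - 1|
  <= 1 is already below |u|^\<beta>.\<close>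

lemma kernel_estimates:
  fixes K :: "real^'d \<Rightarrow> real"
  assumes \<beta>: "\<beta> > 0" and K: "kernel_cond \<beta> K"
  obtains R c where "R > 0" "c \<ge> 0" "\<And>u. K u \<noteq> 0 \<Longrightarrow> norm u \<le> R"
    "\<And>x y. \<bar>K x - K y\<bar> \<le> c * norm (x - y)" "\<And>u. \<bar>K u - 1\<bar> \<le> c * norm u powr \<beta>"
proof -
  obtain lam where lam: "real lam > max 0 (\<beta> - 1)" "has_pderivs_upto (lam + 1) K"
      "\<And>js. 1 \<le> length js \<Longrightarrow> length js \<le> lam \<Longrightarrow> iter_pderiv js K 0 = 0"
      "\<And>js. length js = lam + 1 \<Longrightarrow> bounded (range (iter_pderiv js K))"
    using K by (auto simp: kernel_cond_def)
  have K': "\<And>u. 0 \<le> K u" "\<And>u. K u \<le> 1" "K 0 = 1" "bounded {t. K t > 0}"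
    using K by (auto simp: kernel_cond_def)
  obtain R where R: "R > 0" "\<And>u. K u \<noteq> 0 \<Longrightarrow> norm u \<le> R"
  proof -
    obtain R where "\<And>u. K u > 0 \<Longrightarrow> norm u \<le> R"
      using K'(4) by (auto simp: bounded_iff)
    then have "K u \<noteq> 0 \<Longrightarrow> norm u \<le> max R 1" for u
      using K'(1)[of u] by (metis max.coboundedI1 order_le_less)
    then show ?thesis using that[of "max R 1"] by auto
  qed
  obtain c where c: "c \<ge> 0"
    "\<And>js u. 1 \<le> length js \<Longrightarrow> length js \<le> lam + 1 \<Longrightarrow>
       \<bar>iter_pderiv js K u\<bar> \<le> c * (\<Sum>i\<in>UNIV. \<bar>u $ i\<bar>) ^ (lam + 1 - length js)"
    "\<And>u. \<bar>K u - K 0\<bar> \<le> c * (\<Sum>i\<in>UNIV. \<bar>u $ i\<bar>) ^ (lam + 1)"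
    using kernel_Taylor[OF lam(2,3,4)] by metis
  define d where "d = real CARD('d)"
  have d: "d \<ge> 1" by (simp add: d_def Suc_leI)
  have pd: "\<bar>pderiv_dir i K u\<bar> \<le> c * (d * R) ^ lam" for i u
  proof (cases "norm u \<le> R")
    case True
    have "\<bar>pderiv_dir i K u\<bar> \<le> c * (\<Sum>i\<in>UNIV. \<bar>u $ i\<bar>) ^ lam"
      using c(2)[of "[i]" u] by (simp add: iter_pderiv_def)
    also have "\<dots> \<le> c * (d * R) ^ lam"
    proof -
      have "d * norm u \<le> d * R" using True d by (intro mult_left_mono) auto
      then have "(\<Sum>i\<in>UNIV. \<bar>u $ i\<bar>) \<le> d * R"
        using sum_abs_le_card_norm[of u] unfolding d_def by (rule order_trans[rotated])
      then show ?thesis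
        by (intro mult_left_mono power_mono c sum_nonneg) auto
    qed
    finally show ?thesis .
  next
    case False
    \<comment> \<open>Outside the closed ball K vanishes on a neighbourhood, so the derivative is
      that of the zero function.\<close>
    define S where "S = (\<lambda>r::real. u + r *\<^sub>R axis i 1) -` {z. R < norm z}"
    have "open S"
      unfolding S_def by (rule open_vimage) (auto intro!: open_Collect_less continuous_intros)
    moreover have "0 \<in> S" using False by (simp add: S_def)
    ultimately have "\<forall>\<^sub>F r in nhds 0. r \<in> S" by (rule eventually_nhds_in_open)
    then have "\<forall>\<^sub>F r in nhds 0. K (u + r *\<^sub>R axis i 1) = 0"
      by (rule eventually_mono) (use R(2) in \<open>force simp: S_def\<close>)
    then have "pderiv_dir i K u = deriv (\<lambda>r::real. 0::real) 0"
      unfolding pderiv_dir_def by (rule deriv_cong_ev) simp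
    then show ?thesis using c(1) d R(1) by simp
  qed
  define c1 where "c1 = c * (d * R) ^ lam * d"
  have lip: "\<bar>K x - K y\<bar> \<le> c1 * norm (x - y)" for x y
  proof -
    have "\<bar>K x - K y\<bar> \<le> (c * (d * R) ^ lam) * (\<Sum>i\<in>UNIV. \<bar>x $ i - y $ i\<bar>)"
    proof (rule increment_le_l1[OF _ pd])
      show "(\<lambda>r. K (x + r *\<^sub>R axis i 1)) field_differentiable at 0" for x i
        using lam(2)[unfolded has_pderivs_upto_def, rule_format, of "[]" x i] by (simp add: iter_pderiv_def)
    qed
    also have "\<dots> \<le> (c * (d * R) ^ lam) * (d * norm (x - y))"
      using sum_abs_le_card_norm[of "x - y"] c(1) d R(1) by (intro mult_left_mono) (auto simp: d_def)
    finally show ?thesis by (simp add: c1_def mult_ac)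
  qed
  define c2 where "c2 = c * d ^ (lam + 1)"
  have tay: "\<bar>K u - 1\<bar> \<le> max c2 1 * norm u powr \<beta>" for u
  proof (cases "norm u \<le> 1")
    case True
    have "\<bar>K u - 1\<bar> \<le> c * (\<Sum>i\<in>UNIV. \<bar>u $ i\<bar>) ^ (lam + 1)"
      using c(3)[of u] K'(3) by simp
    also have "\<dots> \<le> c * (d * norm u) ^ (lam + 1)"
      using sum_abs_le_card_norm[of u] by (intro mult_left_mono power_mono c sum_nonneg) (auto simp: d_def)
    also have "\<dots> = c2 * norm u ^ (lam + 1)"
      by (simp add: c2_def power_mult_distrib mult_ac)
    also have "norm u ^ (lam + 1) \<le> norm u powr \<beta>"
    proof (cases "u = 0")
      case False
      then have "norm u ^ (lam + 1) = norm u powr (real (lam + 1))"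
        by (subst powr_realpow) auto
      also have "\<dots> \<le> norm u powr \<beta>"
        using True lam(1) by (intro powr_mono') auto
      finally show ?thesis .
    qed simp
    then have "c2 * norm u ^ (lam + 1) \<le> max c2 1 * norm u powr \<beta>"
      by (intro mult_mono) auto
    finally show ?thesis .
  next
    case False
    have "\<bar>K u - 1\<bar> \<le> 1" using K'(1,2)[of u] by linarith
    also have "1 \<le> norm u powr \<beta>" using False \<beta> by (intro ge_one_powr_ge_zero) auto
    also have "\<dots> \<le> max c2 1 * norm u powr \<beta>"
      by (metis max.cobounded2 mult_1 mult_right_mono powr_ge_zero)
    finally show ?thesis .
  qed
  define c3 where "c3 = max c1 (max c2 1)"
  show ?thesis
  proof (rule that[of R c3])
    show "\<bar>K x - K y\<bar> \<le> c3 * norm (x - y)" for x y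
      by (rule order_trans[OF lip]) (auto simp: c3_def intro!: mult_right_mono)
    show "\<bar>K u - 1\<bar> \<le> c3 * norm u powr \<beta>" for u
      by (rule order_trans[OF tay]) (auto simp: c3_def intro!: mult_right_mono)
  qed (use R in \<open>auto simp: c3_def\<close>)
qed

section \<open>Lattice sums\<close>

definition latt :: "real \<Rightarrow> ('d::finite \<Rightarrow> int) \<Rightarrow> real^'d" where
  "latt \<delta> k = (\<chi> l. \<delta> * of_int (k l))"

definition cell :: "real \<Rightarrow> real^'d::finite \<Rightarrow> 'd \<Rightarrow> int" where
  "cell \<delta> x = (\<lambda>l. \<lfloor>x $ l / \<delta>\<rfloor>)"

text \<open>The lower corner of the cell of x. Composition with it turns a function on the lattice
  into a step function whose integral is \<delta>^d times the lattice sum.\<close>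

definition lattice_point :: "real \<Rightarrow> real^'d::finite \<Rightarrow> real^'d" where
  "lattice_point \<delta> x = latt \<delta> (cell \<delta> x)"

lemma latt_diff: "latt \<delta> j - latt \<delta> k = latt \<delta> (\<lambda>l. j l - k l)"
  by (simp add: latt_def vec_eq_iff algebra_simps)

lemma inj_latt: "\<delta> > 0 \<Longrightarrow> inj (latt \<delta>)"
  by (auto simp: inj_def latt_def vec_eq_iff)

text \<open>The Euclidean norm is bounded by the l1 norm, with at most \<delta> per coordinate. The
  resulting factor \<open>CARD('d)\<close> is the source of the smallness conditions on
  \<open>CARD('d) * \<delta>\<close> below.\<close>

lemma lattice_point_close:
  fixes \<delta> :: real
  assumes "\<delta> > 0"
  shows "norm (lattice_point \<delta> (x :: real^'d) - x) \<le> CARD('d) * \<delta>"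
proof -
  have "\<bar>(lattice_point \<delta> x - x) $ l\<bar> \<le> \<delta>" for l
  proof -
    have "x $ l = \<delta> * (x $ l / \<delta>)" using assms by simp
    then have "lattice_point \<delta> x $ l - x $ l = \<delta> * (of_int \<lfloor>x $ l / \<delta>\<rfloor> - x $ l / \<delta>)"
      by (simp add: lattice_point_def latt_def cell_def algebra_simps)
    moreover have "\<bar>of_int \<lfloor>x $ l / \<delta>\<rfloor> - x $ l / \<delta>\<bar> \<le> 1" by linarith
    ultimately show ?thesis using assms by (simp add: abs_mult mult_left_le)
  qed
  then have "(\<Sum>l\<in>UNIV. \<bar>(lattice_point \<delta> x - x) $ l\<bar>) \<le> (\<Sum>l\<in>(UNIV :: 'd set). \<delta>)"
    by (intro sum_mono)
  then show ?thesis using norm_le_l1_cart[of "lattice_point \<delta> x - x"] by simp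
qed

text \<open>The half-open cell lies between an open and a closed box of equal volume.\<close>

lemma
  fixes k :: "'d::finite \<Rightarrow> int"
  assumes "\<delta> > 0"
  shows cell_sets: "{x. cell \<delta> x = k} \<in> sets borel"
    and emeasure_cell: "emeasure lborel {x. cell \<delta> x = k} = ennreal (\<delta> ^ CARD('d))"
proof -
  have eq: "{x. cell \<delta> x = k} = (\<Inter>l. {x. \<delta> * of_int (k l) \<le> x $ l} \<inter> {x. x $ l < \<delta> * (of_int (k l) + 1)})"
    using assms by (auto simp: cell_def fun_eq_iff floor_eq_iff field_simps)
  show sets: "{x. cell \<delta> x = k} \<in> sets borel"
    unfolding eq by measurable
  define a b :: "real^'d" where "a = (\<chi> l. \<delta> * of_int (k l))" and "b = (\<chi> l. \<delta> * (of_int (k l) + 1))"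
  have sub: "box a b \<subseteq> {x. cell \<delta> x = k}" "{x. cell \<delta> x = k} \<subseteq> cbox a b"
    unfolding eq by (auto simp: mem_box_cart a_def b_def less_imp_le)
  have ne: "cbox a b \<noteq> {}"
    using assms by (auto simp: a_def b_def interval_eq_empty_cart intro!: mult_left_mono)
  have "measure lborel (cbox a b) = \<delta> ^ CARD('d)"
    using ne by (simp add: content_cbox_if_cart a_def b_def algebra_simps)
  moreover have "emeasure lborel (cbox a b) = ennreal (measure lborel (cbox a b))"
    using emeasure_lborel_cbox_finite[of a b] by (intro emeasure_eq_ennreal_measure) auto
  moreover have "emeasure lborel (box a b) = emeasure lborel (cbox a b)"
    by (simp add: emeasure_lborel_box_eq emeasure_lborel_cbox_eq)
  ultimately show "emeasure lborel {x. cell \<delta> x = k} = ennreal (\<delta> ^ CARD('d))"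
    using emeasure_mono[OF sub(1), of lborel] emeasure_mono[OF sub(2), of lborel] sets
    by (intro antisym) auto
qed

text \<open>The index set is countable, so measurability needs checking only on single cells;
  afterwards every function of the cell index is measurable.\<close>

lemma cell_measurable [measurable]:
  assumes "\<delta> > 0"
  shows "cell \<delta> \<in> measurable lebesgue (count_space (UNIV :: ('d::finite \<Rightarrow> int) set))"
proof -
  have "cell \<delta> -` {k} \<inter> space lebesgue \<in> sets lebesgue" for k :: "'d \<Rightarrow> int"
    using cell_sets[OF assms, of k] by (simp add: vimage_def)
  then show ?thesis
    by (subst measurable_count_space_eq2_countable) auto
qed

text \<open>The finite sum is the integral of the step function restricted to the cells in S. The
  values g are arbitrary, which allows nesting: for two summation variables g may itself be an inner
  sum.\<close>

lemma lattice_sum_le_nn_integral: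
  fixes g :: "('d::finite \<Rightarrow> int) \<Rightarrow> ennreal"
  assumes "\<delta> > 0" "finite S"
  shows "(\<Sum>k\<in>S. ennreal (\<delta> ^ CARD('d)) * g k) \<le> (\<integral>\<^sup>+x. g (cell \<delta> x) \<partial>lebesgue)"
proof -
  have [measurable]: "{x. cell \<delta> x = k} \<in> sets lebesgue" for k :: "'d \<Rightarrow> int"
    using cell_sets[OF assms(1), of k] by simp
  have em: "emeasure lebesgue {x. cell \<delta> x = k} = ennreal (\<delta> ^ CARD('d))" for k :: "'d \<Rightarrow> int"
    using emeasure_cell[OF assms(1), of k] cell_sets[OF assms(1), of k] by simp
  have "(\<integral>\<^sup>+x. (\<Sum>k\<in>S. g k * indicator {x. cell \<delta> x = k} x) \<partial>lebesgue)
      = (\<Sum>k\<in>S. g k * emeasure lebesgue {x. cell \<delta> x = k})"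
    by (subst nn_integral_sum) (simp_all add: nn_integral_cmult_indicator)
  also have "\<dots> = (\<Sum>k\<in>S. ennreal (\<delta> ^ CARD('d)) * g k)"
    by (intro sum.cong) (simp_all add: em mult.commute del: emeasure_completion)
  finally have "(\<Sum>k\<in>S. ennreal (\<delta> ^ CARD('d)) * g k)
      = (\<integral>\<^sup>+x. (\<Sum>k\<in>S. g k * indicator {x. cell \<delta> x = k} x) \<partial>lebesgue)" by simp
  also have "\<dots> \<le> (\<integral>\<^sup>+x. g (cell \<delta> x) \<partial>lebesgue)"
  proof (rule nn_integral_mono)
    fix x :: "real^'d"
    have "(\<Sum>k\<in>S. g k * indicator {x. cell \<delta> x = k} x) = (\<Sum>k\<in>S. if cell \<delta> x = k then g k else 0)"
      by (intro sum.cong) (auto simp: indicator_def)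
    also have "\<dots> \<le> g (cell \<delta> x)"
      using assms(2) by (simp add: sum.delta)
    finally show "(\<Sum>k\<in>S. g k * indicator {x. cell \<delta> x = k} x) \<le> g (cell \<delta> x)" .
  qed
  finally show ?thesis .
qed

lemma has_bochner_integral_lattice_sum:
  fixes g :: "('d::finite \<Rightarrow> int) \<Rightarrow> 'b::{banach,second_countable_topology}"
  assumes \<delta>: "\<delta> > 0" and S: "finite S" "\<And>k. k \<notin> S \<Longrightarrow> g k = 0"
  shows "has_bochner_integral lebesgue (\<lambda>x. g (cell \<delta> x)) (\<Sum>k\<in>S. \<delta> ^ CARD('d) *\<^sub>R g k)"
proof -
  have m: "measure lebesgue {x. cell \<delta> x = k} = \<delta> ^ CARD('d)"
      "{x. cell \<delta> x = k} \<in> sets lebesgue" "emeasure lebesgue {x. cell \<delta> x = k} < \<infinity>" for k :: "'d \<Rightarrow> int"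
    using emeasure_cell[OF \<delta>, of k] cell_sets[OF \<delta>, of k] \<delta> by (auto simp: measure_def)
  have "has_bochner_integral lebesgue (\<lambda>x. \<Sum>k\<in>S. indicator {x. cell \<delta> x = k} x *\<^sub>R g k)
      (\<Sum>k\<in>S. measure lebesgue {x. cell \<delta> x = k} *\<^sub>R g k)"
    using m by (intro has_bochner_integral_sum has_bochner_integral_scaleR_left
        has_bochner_integral_real_indicator) auto
  moreover have "(\<Sum>k\<in>S. indicator {x. cell \<delta> x = k} x *\<^sub>R g k) = g (cell \<delta> x)" for x
  proof -
    have "(\<Sum>k\<in>S. indicator {x. cell \<delta> x = k} x *\<^sub>R g k) = (\<Sum>k\<in>S. if cell \<delta> x = k then g k else 0)"
      by (intro sum.cong) (auto simp: indicator_def)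
    also have "\<dots> = g (cell \<delta> x)"
      using S by (simp add: sum.delta)
    finally show ?thesis .
  qed
  ultimately show ?thesis by (simp add: m)
qed

section \<open>Index boxes, lags and overlap volumes\<close>

abbreviation volume :: "('d::finite \<Rightarrow> nat) \<Rightarrow> real \<Rightarrow> real" where
  "volume N \<delta> \<equiv> measure lebesgue (region N \<delta>)"

abbreviation overlap :: "('d::finite \<Rightarrow> nat) \<Rightarrow> real \<Rightarrow> real^'d \<Rightarrow> real" where
  "overlap N \<delta> h \<equiv> measure lebesgue (region N \<delta> \<inter> (\<lambda>x. x - h) ` region N \<delta>)"

definition index_box :: "('d::finite \<Rightarrow> nat) \<Rightarrow> ('d \<Rightarrow> int) set" where
  "index_box N = {k. \<forall>l. k l \<in> {1..int (N l)}}"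

text \<open>The inequality is strict because differences of indices from 1 to \<open>N l\<close>
  have modulus at most \<open>N l - 1\<close>; these are exactly the lags with positive
  overlap.\<close>

definition lag_box :: "('d::finite \<Rightarrow> nat) \<Rightarrow> ('d \<Rightarrow> int) set" where
  "lag_box N = {k. \<forall>l. \<bar>k l\<bar> < int (N l)}"

abbreviation lag_count :: "('d::finite \<Rightarrow> nat) \<Rightarrow> ('d \<Rightarrow> int) \<Rightarrow> nat" where
  "lag_count N m \<equiv> card {i \<in> index_box N. (\<lambda>l. i l + m l) \<in> index_box N}"

lemma card_fun_box:
  fixes A :: "'d::finite \<Rightarrow> 'a set"
  shows "card {k. \<forall>l. k l \<in> A l} = (\<Prod>l\<in>UNIV. card (A l))"
    and "(\<And>l. finite (A l)) \<Longrightarrow> finite {k. \<forall>l. k l \<in> A l}"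
proof -
  have eq: "{k. \<forall>l. k l \<in> A l} = PiE UNIV A" by (auto simp: PiE_def Pi_def)
  show "card {k. \<forall>l. k l \<in> A l} = (\<Prod>l\<in>UNIV. card (A l))"
    unfolding eq by (rule card_PiE) simp
  show "(\<And>l. finite (A l)) \<Longrightarrow> finite {k. \<forall>l. k l \<in> A l}"
    unfolding eq by (rule finite_PiE) auto
qed

lemma finite_index_box [simp]: "finite (index_box N)"
  unfolding index_box_def by (rule card_fun_box(2)) simp

lemma finite_lag_box [simp]: "finite (lag_box N)"
proof -
  have "\<bar>k l\<bar> < int (N l) \<longleftrightarrow> k l \<in> {- int (N l)<..<int (N l)}" for k l
    by auto
  then have "lag_box N = {k. \<forall>l. k l \<in> {- int (N l)<..<int (N l)}}"
    unfolding lag_box_def by simp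
  then show ?thesis using card_fun_box(2)[of "\<lambda>l. {- int (N l)<..<int (N l)}"] by simp
qed

lemma card_index_box: "card (index_box N) = (\<Prod>l\<in>UNIV. N l)"
  unfolding index_box_def card_fun_box(1) by simp

text \<open>In each coordinate the admissible indices form an integer interval with N - |m|
  elements, or an empty one.\<close>

lemma card_index_box_shift:
  "real (lag_count N m)
    = (\<Prod>l\<in>UNIV. max 0 (real (N l) - \<bar>real_of_int (m l)\<bar>))"
proof -
  have eq: "{i \<in> index_box N. (\<lambda>l. i l + m l) \<in> index_box N}
      = {i. \<forall>l. i l \<in> {max 1 (1 - m l)..min (int (N l)) (int (N l) - m l)}}"
    by (auto simp: index_box_def) (smt (verit))+
  show ?thesis
    unfolding eq card_fun_box(1) of_nat_prod
    by (intro prod.cong refl) (auto simp: max_def min_def)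
qed

lemma grid_eq: "grid N \<delta> = latt \<delta> ` index_box N"
proof (intro equalityI subsetI)
  fix t assume "t \<in> grid N \<delta>"
  then obtain k where k: "\<And>l. k l \<in> {1..N l}" "\<And>l. t $ l = real (k l) * \<delta>"
    unfolding grid_def by (auto simp: choice_iff Bex_def)
  then have "t = latt \<delta> (\<lambda>l. int (k l))" "(\<lambda>l. int (k l)) \<in> index_box N"
    by (auto simp: latt_def vec_eq_iff index_box_def)
  then show "t \<in> latt \<delta> ` index_box N" by blast
next
  fix t assume "t \<in> latt \<delta> ` index_box N"
  then obtain k where k: "k \<in> index_box N" "t = latt \<delta> k" by auto
  show "t \<in> grid N \<delta>"
    unfolding grid_def
  proof (intro CollectI allI)
    fix l
    have "nat (k l) \<in> {1..N l}" "t $ l = real (nat (k l)) * \<delta>"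
      using k by (auto simp: index_box_def latt_def nat_le_iff le_nat_iff dest: spec[of _ l])
    then show "\<exists>j\<in>{1..N l}. t $ l = real j * \<delta>" by blast
  qed
qed

lemma finite_grid [simp]: "finite (grid N \<delta>)"
  by (simp add: grid_eq)

lemma card_grid: "\<delta> > 0 \<Longrightarrow> card (grid N \<delta>) = (\<Prod>l\<in>UNIV. N l)"
  unfolding grid_eq by (subst card_image[OF inj_on_subset[OF inj_latt subset_UNIV]]) (simp_all add: card_index_box)

text \<open>The continuous counterpart of \<open>card_index_box_shift\<close>: at a lattice lag
  every factor is \<delta> times the corresponding factor of the count.\<close>

lemma measure_region_shift:
  fixes N :: "'d::finite \<Rightarrow> nat"
  assumes "\<delta> > 0"
  shows "overlap N \<delta> h
    = (\<Prod>l\<in>UNIV. max 0 (real (N l) * \<delta> - \<bar>h $ l\<bar>))"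
proof -
  define a b :: "real^'d" where "a = (\<chi> l. max 0 (- h $ l))"
    and "b = (\<chi> l. min (real (N l) * \<delta>) (real (N l) * \<delta> - h $ l))"
  have "(\<lambda>x. x - h) ` region N \<delta> = {x. x + h \<in> region N \<delta>}"
    by (auto simp: image_iff intro: exI[of _ "_ + h"]) (metis add_diff_cancel)
  then have eq: "region N \<delta> \<inter> (\<lambda>x. x - h) ` region N \<delta> = cbox a b"
    by (auto simp: region_def mem_box_cart a_def b_def) (smt (verit))+
  have "measure lebesgue (cbox a b) = measure lborel (cbox a b)"
    by simp
  also have "\<dots> = (\<Prod>l\<in>UNIV. max 0 (real (N l) * \<delta> - \<bar>h $ l\<bar>))"
  proof (cases "cbox a b = {}")
    case True
    then obtain l where l: "b $ l < a $ l" by (auto simp: interval_eq_empty_cart)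
    have "0 \<le> real (N l) * \<delta>" using assms by simp
    then have "max 0 (real (N l) * \<delta> - \<bar>h $ l\<bar>) = 0"
      using l by (auto simp: a_def b_def max_def min_def split: if_splits)
    then show ?thesis using True by (auto simp: content_cbox_if_cart intro!: prod_zero[symmetric])
  next
    case False
    have "b $ l - a $ l = max 0 (real (N l) * \<delta> - \<bar>h $ l\<bar>)" for l
    proof -
      have "a $ l \<le> b $ l" using False by (auto simp: interval_eq_empty_cart not_less)
      then show ?thesis by (auto simp: a_def b_def max_def min_def split: if_splits)
    qed
    then show ?thesis using False by (simp add: content_cbox_if_cart)
  qed
  finally show ?thesis using eq by simp
qed

lemma measure_region:
  assumes "\<delta> > 0"
  shows "volume N \<delta> = (\<Prod>l\<in>UNIV. real (N l) * \<delta>)"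
  using measure_region_shift[OF assms, of N 0] assms by simp

lemma card_grid_measure:
  fixes N :: "'d::finite \<Rightarrow> nat"
  assumes "\<delta> > 0"
  shows "\<delta> ^ CARD('d) * real (card (grid N \<delta>)) = volume N \<delta>"
  using assms by (simp add: card_grid measure_region prod.distrib mult.commute)

text \<open>Grouping by the lag: the pairs with lag m are parametrized by their second
  index.\<close>

lemma sum_grid_pairs:
  fixes \<Phi> :: "real^'d::finite \<Rightarrow> 'b::real_vector"
  assumes \<delta>: "\<delta> > 0"
  shows "(\<Sum>t\<in>grid N \<delta>. \<Sum>s\<in>grid N \<delta>. \<Phi> (t - s))
    = (\<Sum>m\<in>lag_box N. real (lag_count N m) *\<^sub>R \<Phi> (latt \<delta> m))"
proof -
  let ?I = "index_box N"
  define g :: "('d \<Rightarrow> int) \<times> ('d \<Rightarrow> int) \<Rightarrow> 'd \<Rightarrow> int" where "g p = (\<lambda>l. fst p l - snd p l)" for p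
  have inj: "inj_on (latt \<delta>) ?I" using inj_latt[OF \<delta>] inj_on_subset by blast
  have "(\<Sum>t\<in>grid N \<delta>. \<Sum>s\<in>grid N \<delta>. \<Phi> (t - s)) = (\<Sum>j\<in>?I. \<Sum>i\<in>?I. \<Phi> (latt \<delta> j - latt \<delta> i))"
    unfolding grid_eq by (simp add: sum.reindex[OF inj])
  also have "\<dots> = (\<Sum>p\<in>?I \<times> ?I. \<Phi> (latt \<delta> (g p)))"
    by (simp add: sum.cartesian_product latt_diff g_def case_prod_beta)
  also have "\<dots> = (\<Sum>m\<in>lag_box N. \<Sum>p | p \<in> ?I \<times> ?I \<and> g p = m. \<Phi> (latt \<delta> (g p)))"
  proof (rule sum.group[symmetric])
    show "g ` (?I \<times> ?I) \<subseteq> lag_box N"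
    proof
      fix m assume "m \<in> g ` (?I \<times> ?I)"
      then obtain j i where "m = g (j, i)" "j \<in> ?I" "i \<in> ?I" by auto
      then show "m \<in> lag_box N"
        unfolding lag_box_def index_box_def g_def by (auto simp: abs_less_iff) (smt (verit))+
    qed
  qed auto
  also have "\<dots> = (\<Sum>m\<in>lag_box N. real (lag_count N m) *\<^sub>R \<Phi> (latt \<delta> m))"
  proof (rule sum.cong[OF refl])
    fix m
    have "{p \<in> ?I \<times> ?I. g p = m} = (\<lambda>i. (\<lambda>l. i l + m l, i)) ` {i \<in> ?I. (\<lambda>l. i l + m l) \<in> ?I}"
    proof (intro equalityI subsetI)
      fix p assume p: "p \<in> {p \<in> ?I \<times> ?I. g p = m}"
      have "fst p = (\<lambda>l. snd p l + m l)"
        using p by (auto simp: g_def)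
      then have "p = (\<lambda>l. snd p l + m l, snd p)" "(\<lambda>l. snd p l + m l) = fst p"
        by (simp_all add: prod_eq_iff)
      then show "p \<in> (\<lambda>i. (\<lambda>l. i l + m l, i)) ` {i \<in> ?I. (\<lambda>l. i l + m l) \<in> ?I}"
        using p by (intro image_eqI[of _ _ "snd p"]) auto
    qed (auto simp: g_def)
    then have "card {p \<in> ?I \<times> ?I. g p = m} = lag_count N m"
      by (simp add: card_image inj_on_def)
    moreover have "(\<Sum>p | p \<in> ?I \<times> ?I \<and> g p = m. \<Phi> (latt \<delta> (g p))) = (\<Sum>p | p \<in> ?I \<times> ?I \<and> g p = m. \<Phi> (latt \<delta> m))"
      by (intro sum.cong) auto
    ultimately show "(\<Sum>p | p \<in> ?I \<times> ?I \<and> g p = m. \<Phi> (latt \<delta> (g p)))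
        = real (lag_count N m) *\<^sub>R \<Phi> (latt \<delta> m)"
      by (simp add: sum_constant_scaleR)
  qed
  finally show ?thesis .
qed

text \<open>The normalization \<open>|T \<inter> (T - h)|\<close> is exactly the volume \<open>\<delta>\<^sup>d\<close> times the number of grid pairs
  with lag \<open>h\<close>.\<close>

lemma sum_grid_pairs_normalized:
  fixes \<Phi> :: "real^'d::finite \<Rightarrow> 'b::real_vector"
  assumes \<delta>: "\<delta> > 0"
  shows "\<delta> ^ (2 * CARD('d)) *\<^sub>R (\<Sum>t\<in>grid N \<delta>. \<Sum>s\<in>grid N \<delta>.
      (1 / overlap N \<delta> (t - s)) *\<^sub>R \<Phi> (t - s))
    = (\<Sum>m\<in>lag_box N. \<delta> ^ CARD('d) *\<^sub>R \<Phi> (latt \<delta> m))"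
proof -
  define \<Psi> where "\<Psi> h = (1 / overlap N \<delta> h) *\<^sub>R \<Phi> h" for h
  have "\<delta> ^ (2 * CARD('d)) *\<^sub>R (real (lag_count N m) *\<^sub>R \<Psi> (latt \<delta> m))
      = \<delta> ^ CARD('d) *\<^sub>R \<Phi> (latt \<delta> m)" if "m \<in> lag_box N" for m
  proof -
    define q where "q = (\<Prod>l\<in>UNIV. real (N l) - \<bar>real_of_int (m l)\<bar>)"
    have pos: "0 < real (N l) - \<bar>real_of_int (m l)\<bar>" for l
    proof -
      have "\<bar>m l\<bar> < int (N l)" using that by (simp add: lag_box_def)
      then have "real_of_int \<bar>m l\<bar> < real_of_int (int (N l))" by (simp only: of_int_less_iff)
      then show ?thesis by simp
    qed
    have q: "q > 0" unfolding q_def by (rule prod_pos) (rule pos)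
    have card: "real (lag_count N m) = q"
      unfolding card_index_box_shift q_def
    proof (intro prod.cong refl)
      show "max 0 (real (N l) - \<bar>real_of_int (m l)\<bar>) = real (N l) - \<bar>real_of_int (m l)\<bar>" for l
        using pos[of l] by simp
    qed
    have "measure lebesgue (region N \<delta> \<inter> (\<lambda>x. x - latt \<delta> m) ` region N \<delta>)
        = (\<Prod>l\<in>UNIV. \<delta> * (real (N l) - \<bar>real_of_int (m l)\<bar>))"
      unfolding measure_region_shift[OF \<delta>]
    proof (intro prod.cong refl)
      fix l
      have "real (N l) * \<delta> - \<bar>latt \<delta> m $ l\<bar> = \<delta> * (real (N l) - \<bar>real_of_int (m l)\<bar>)"
        using \<delta> by (simp add: latt_def abs_mult algebra_simps)
      moreover have "0 \<le> \<delta> * (real (N l) - \<bar>real_of_int (m l)\<bar>)"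
        using \<delta> pos[of l] by simp
      ultimately show "max 0 (real (N l) * \<delta> - \<bar>latt \<delta> m $ l\<bar>) = \<delta> * (real (N l) - \<bar>real_of_int (m l)\<bar>)"
        by simp
    qed
    also have "\<dots> = \<delta> ^ CARD('d) * q" by (simp add: prod.distrib q_def)
    finally show ?thesis
      using q \<delta> unfolding \<Psi>_def card by (simp add: power_mult power2_eq_square mult_2 power_add)
  qed
  then have "(\<Sum>m\<in>lag_box N. \<delta> ^ (2 * CARD('d)) *\<^sub>R (real (lag_count N m) *\<^sub>R \<Psi> (latt \<delta> m)))
      = (\<Sum>m\<in>lag_box N. \<delta> ^ CARD('d) *\<^sub>R \<Phi> (latt \<delta> m))"
    by (intro sum.cong) auto
  then show ?thesis
    using sum_grid_pairs[OF \<delta>, of \<Psi> N] by (simp add: \<Psi>_def scaleR_sum_right)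
qed

text \<open>The ball is enlarged to a cube of lags with r = floor(\<rho>/\<delta>). It has 2 r + 1
  points per axis, and \<delta> (2 r + 1) <= 2 \<rho> + \<delta>.\<close>

lemma card_grid_ball_le:
  fixes t :: "real^'d::finite"
  assumes \<delta>: "\<delta> > 0" and \<rho>: "\<rho> \<ge> 0" and t: "t \<in> grid N \<delta>"
  shows "\<delta> ^ CARD('d) * real (card {s \<in> grid N \<delta>. norm (t - s) \<le> \<rho>}) \<le> (2 * \<rho> + \<delta>) ^ CARD('d)"
proof -
  define r where "r = \<lfloor>\<rho> / \<delta>\<rfloor>"
  have r: "r \<ge> 0" using \<delta> \<rho> by (simp add: r_def)
  define A :: "('d \<Rightarrow> int) set" where "A = {m. \<forall>l. m l \<in> {- r..r}}"
  have A: "finite A" "card A = (nat (2 * r + 1)) ^ CARD('d)"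
    unfolding A_def using card_fun_box[of "\<lambda>_::'d. {- r..r}"] by (simp_all add: algebra_simps)
  have "{s \<in> grid N \<delta>. norm (t - s) \<le> \<rho>} \<subseteq> (\<lambda>m. t - latt \<delta> m) ` A"
  proof
    fix s assume s: "s \<in> {s \<in> grid N \<delta>. norm (t - s) \<le> \<rho>}"
    obtain j i where ji: "t = latt \<delta> j" "s = latt \<delta> i" using s t by (auto simp: grid_eq)
    define m where "m = (\<lambda>l. j l - i l)"
    have ts: "t - s = latt \<delta> m" by (simp add: ji latt_diff m_def)
    have "m l \<in> {- r..r}" for l
    proof -
      have "\<delta> * \<bar>real_of_int (m l)\<bar> \<le> \<rho>"
      proof -
        have "\<delta> * \<bar>real_of_int (m l)\<bar> = \<bar>(t - s) $ l\<bar>"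
          using \<delta> by (simp add: ts latt_def abs_mult)
        also have "\<dots> \<le> norm (t - s)" by (rule component_le_norm_cart)
        finally show ?thesis using s by simp
      qed
      then have "real_of_int \<bar>m l\<bar> \<le> \<rho> / \<delta>" using \<delta> by (simp add: field_simps)
      then have "\<bar>m l\<bar> \<le> r" unfolding r_def by (simp only: le_floor_iff)
      then show ?thesis by auto
    qed
    then have "m \<in> A" by (simp add: A_def)
    moreover have "s = t - latt \<delta> m" using ts by (simp add: algebra_simps)
    ultimately show "s \<in> (\<lambda>m. t - latt \<delta> m) ` A" by blast
  qed
  then have "card {s \<in> grid N \<delta>. norm (t - s) \<le> \<rho>} \<le> card A"
    by (meson A(1) card_image_le card_mono finite_imageI order_trans)
  then have "\<delta> ^ CARD('d) * real (card {s \<in> grid N \<delta>. norm (t - s) \<le> \<rho>}) \<le> \<delta> ^ CARD('d) * real (card A)"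
    using \<delta> by (intro mult_left_mono) auto
  also have "\<dots> = (\<delta> * (2 * real_of_int r + 1)) ^ CARD('d)"
    using r unfolding A(2) of_nat_power by (simp add: power_mult_distrib)
  also have "\<dots> \<le> (2 * \<rho> + \<delta>) ^ CARD('d)"
  proof (rule power_mono)
    have "real_of_int r \<le> \<rho> / \<delta>" by (simp add: r_def)
    then have "\<delta> * real_of_int r \<le> \<rho>" using \<delta> by (simp add: field_simps)
    then show "\<delta> * (2 * real_of_int r + 1) \<le> 2 * \<rho> + \<delta>" by (simp add: algebra_simps)
  qed (use r \<delta> in auto)
  finally show ?thesis .
qed

section \<open>Second and fourth order structure of the process\<close>

lemma has_sum_difference:
  fixes f g :: "'a \<Rightarrow> 'b::topological_ab_group_add"
  assumes "(f has_sum a) A" "(g has_sum b) A"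
  shows "((\<lambda>x. f x - g x) has_sum a - b) A"
  using has_sum_add[OF assms(1), of "\<lambda>x. - g x" "- b"] assms(2) by (simp add: has_sum_uminus)

text \<open>Dominated convergence along an enumeration of the index set gives an ordered series. The
  same dominating function bounds the sum of the norms, which upgrades it to unordered
  summation.\<close>

lemma has_sum_integral:
  fixes f :: "'i \<Rightarrow> 'a \<Rightarrow> 'b::{banach,second_countable_topology}"
  assumes E: "countable E"
    and f: "\<And>e. e \<in> E \<Longrightarrow> integrable M (f e)"
    and g: "g \<in> borel_measurable M"
    and sum: "\<And>x. x \<in> space M \<Longrightarrow> ((\<lambda>e. f e x) has_sum g x) E"
    and B: "integrable M B" "\<And>x F. x \<in> space M \<Longrightarrow> finite F \<Longrightarrow> F \<subseteq> E \<Longrightarrow> (\<Sum>e\<in>F. norm (f e x)) \<le> B x"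
  shows "((\<lambda>e. \<integral>x. f e x \<partial>M) has_sum (\<integral>x. g x \<partial>M)) E"
proof (cases "finite E")
  case True
  have "(\<integral>x. g x \<partial>M) = (\<integral>x. (\<Sum>e\<in>E. f e x) \<partial>M)"
    using sum has_sum_unique[OF _ has_sum_finite[OF True]] by (intro Bochner_Integration.integral_cong) auto
  also have "\<dots> = (\<Sum>e\<in>E. \<integral>x. f e x \<partial>M)"
    by (rule Bochner_Integration.integral_sum) (rule f)
  finally show ?thesis using True by simp
next
  case False
  define b where "b = from_nat_into E"
  have bij: "bij_betw b UNIV E"
    unfolding b_def by (rule bij_betw_from_nat_into[OF E False])
  then have bE: "b i \<in> E" for i by (auto simp: bij_betw_def)
  have inj: "inj_on b I" for I using bij by (auto simp: bij_betw_def inj_on_def)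
  have lim: "(\<lambda>n. \<Sum>i<n. f (b i) x) \<longlonglongrightarrow> g x" if "x \<in> space M" for x
    using has_sum_imp_sums[of "\<lambda>i. f (b i) x"] sum[OF that]
    by (simp add: has_sum_reindex_bij_betw[OF bij, of "\<lambda>e. f e x"] sums_def)
  have bound: "(\<Sum>i<n. norm (f (b i) x)) \<le> B x" if "x \<in> space M" for n x
    using B(2)[OF that, of "b ` {..<n}"] bE by (auto simp: sum.reindex[OF inj])
  have "(\<lambda>n. \<integral>x. (\<Sum>i<n. f (b i) x) \<partial>M) \<longlonglongrightarrow> (\<integral>x. g x \<partial>M)"
  proof (rule integral_dominated_convergence[where w = B])
    show "(\<lambda>x. \<Sum>i<n. f (b i) x) \<in> borel_measurable M" for n
      by (rule borel_measurable_sum) (use f bE in auto)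
    show "AE x in M. norm (\<Sum>i<n. f (b i) x) \<le> B x" for n
      by (intro AE_I2 order_trans[OF norm_sum bound])
  qed (use g B lim in auto)
  moreover have "(\<integral>x. (\<Sum>i<n. f (b i) x) \<partial>M) = (\<Sum>i<n. \<integral>x. f (b i) x \<partial>M)" for n
    by (rule Bochner_Integration.integral_sum) (rule f[OF bE])
  ultimately have sums: "(\<lambda>i. \<integral>x. f (b i) x \<partial>M) sums (\<integral>x. g x \<partial>M)"
    by (simp add: sums_def)
  have "(\<Sum>i<n. norm (\<integral>x. f (b i) x \<partial>M)) \<le> (\<integral>x. B x \<partial>M)" for n
  proof -
    have "(\<Sum>i<n. norm (\<integral>x. f (b i) x \<partial>M)) \<le> (\<Sum>i<n. \<integral>x. norm (f (b i) x) \<partial>M)"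
      by (intro sum_mono integral_norm_bound)
    also have "\<dots> = (\<integral>x. (\<Sum>i<n. norm (f (b i) x)) \<partial>M)"
      by (rule Bochner_Integration.integral_sum[symmetric]) (rule integrable_norm[OF f[OF bE]])
    also have "\<dots> \<le> (\<integral>x. B x \<partial>M)"
      by (intro integral_mono B bound Bochner_Integration.integrable_sum integrable_norm f bE)
    finally show ?thesis .
  qed
  then have "(\<Sum>i\<le>n. norm (\<integral>x. f (b i) x \<partial>M)) \<le> (\<integral>x. B x \<partial>M)" for n
    unfolding lessThan_Suc_atMost[symmetric] .
  then have "summable (\<lambda>i. norm (\<integral>x. f (b i) x \<partial>M))"
    by (rule bounded_imp_summable[rotated]) simp
  from norm_summable_imp_has_sum[OF this sums] show ?thesis
    by (simp add: has_sum_reindex_bij_betw[OF bij, of "\<lambda>e. \<integral>x. f e x \<partial>M"])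
qed

lemma sum_cinner_mult_le:
  assumes E: "is_cons E" and F: "finite F" "F \<subseteq> E"
  shows "(\<Sum>e\<in>F. cmod (cinner x e) * cmod (cinner e y)) \<le> norm x * norm y"
proof -
  have "(\<Sum>e\<in>F. \<bar>cmod (cinner x e)\<bar> * \<bar>cmod (cinner e y)\<bar>)
      \<le> L2_set (\<lambda>e. cmod (cinner x e)) F * L2_set (\<lambda>e. cmod (cinner e y)) F"
    by (rule L2_set_mult_ineq)
  also have "\<dots> \<le> norm x * norm y"
  proof (rule mult_mono)
    show "L2_set (\<lambda>e. cmod (cinner x e)) F \<le> norm x"
      unfolding L2_set_def by (rule real_le_lsqrt) (use Bessel[OF E F] in auto)
    have "cmod (cinner e y) = cmod (cinner y e)" for e
      by (metis cinner_commute complex_mod_cnj)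
    then show "L2_set (\<lambda>e. cmod (cinner e y)) F \<le> norm y"
      unfolding L2_set_def by (intro real_le_lsqrt) (use Bessel[OF E F, of y] in auto)
  qed auto
  finally show ?thesis by simp
qed

text \<open>The inequality of means applied twice. With moduli as factors it makes fourfold products
  of the process integrable; with two factors equal to 1 it covers twofold products.\<close>

lemma prod4_le:
  fixes a b c d :: real
  shows "a * b * c * d \<le> a ^ 4 + b ^ 4 + c ^ 4 + d ^ 4"
proof -
  have "0 \<le> (a * b - c * d)\<^sup>2" "0 \<le> (a\<^sup>2 - b\<^sup>2)\<^sup>2" "0 \<le> (c\<^sup>2 - d\<^sup>2)\<^sup>2" by simp_all
  moreover have "0 \<le> a ^ 4" "0 \<le> b ^ 4" "0 \<le> c ^ 4" "0 \<le> d ^ 4" by simp_all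
  ultimately show ?thesis by (simp add: power2_eq_square power4_eq_xxxx algebra_simps)
qed

locale stationary_process = prob_space M
  for M :: "'w measure" +
  fixes E :: "'h::separable_chilbert set" and X :: "real^'d \<Rightarrow> 'w \<Rightarrow> 'h" and C :: "real^'d \<Rightarrow> 'h \<Rightarrow> 'h"
  assumes E: "is_cons E"
    and X_meas [measurable]: "\<And>t. X t \<in> borel_measurable M"
    and X_real: "\<And>t \<omega>. \<omega> \<in> space M \<Longrightarrow> is_real E (X t \<omega>)"
    and X4: "\<And>t. integrable M (\<lambda>\<omega>. (norm (X t \<omega>)) ^ 4)"
    and X_stat: "so_stationary M X C"
begin

section \<open>Moments, traces and Hilbert-Schmidt norms of the covariance\<close>

lemma integrable_norm4:
  "integrable M (\<lambda>\<omega>. norm (X t \<omega>) * norm (X s \<omega>) * norm (X u \<omega>) * norm (X v \<omega>))"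
proof (rule Bochner_Integration.integrable_bound)
  show "integrable M (\<lambda>\<omega>. norm (X t \<omega>) ^ 4 + norm (X s \<omega>) ^ 4 + norm (X u \<omega>) ^ 4 + norm (X v \<omega>) ^ 4)"
    by (intro Bochner_Integration.integrable_add X4)
  show "AE \<omega> in M. norm (norm (X t \<omega>) * norm (X s \<omega>) * norm (X u \<omega>) * norm (X v \<omega>))
      \<le> norm (norm (X t \<omega>) ^ 4 + norm (X s \<omega>) ^ 4 + norm (X u \<omega>) ^ 4 + norm (X v \<omega>) ^ 4)"
    using prod4_le by (intro AE_I2) (simp add: abs_mult)
qed measurable

lemma integrable_norm2: "integrable M (\<lambda>\<omega>. norm (X t \<omega>) * norm (X s \<omega>))"
proof (rule Bochner_Integration.integrable_bound[where f = "\<lambda>\<omega>. norm (X t \<omega>) ^ 4 + norm (X s \<omega>) ^ 4 + 1 + 1"])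
  have "norm (X t \<omega>) * norm (X s \<omega>) \<le> norm (X t \<omega>) ^ 4 + norm (X s \<omega>) ^ 4 + 1 + 1" for \<omega>
    using prod4_le[of "norm (X t \<omega>)" "norm (X s \<omega>)" 1 1] by simp
  then show "AE \<omega> in M. norm (norm (X t \<omega>) * norm (X s \<omega>)) \<le> norm (norm (X t \<omega>) ^ 4 + norm (X s \<omega>) ^ 4 + 1 + 1)"
    by (intro AE_I2) (simp add: abs_mult)
qed (auto intro!: Bochner_Integration.integrable_add X4)

lemma norm_tensor_le: "norm (tensor x y z) \<le> norm z * (norm x * norm (y :: 'h))"
  using mult_right_mono[OF cinner_Cauchy_Schwarz[of z y], of "norm x"]
  by (simp add: tensor_def norm_scaleC mult_ac)

lemma tensor_measurable [measurable]: "(\<lambda>\<omega>. tensor (X t \<omega>) (X s \<omega>) z) \<in> borel_measurable M"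
  unfolding tensor_def by measurable

lemma integrable_tensor: "integrable M (\<lambda>\<omega>. tensor (X t \<omega>) (X s \<omega>) z)"
proof (rule Bochner_Integration.integrable_bound)
  show "integrable M (\<lambda>\<omega>. norm z * (norm (X t \<omega>) * norm (X s \<omega>)))"
    by (intro integrable_mult_right integrable_norm2)
  show "AE \<omega> in M. norm (tensor (X t \<omega>) (X s \<omega>) z) \<le> norm (norm z * (norm (X t \<omega>) * norm (X s \<omega>)))"
    by (intro AE_I2) (simp add: abs_mult norm_tensor_le)
qed simp

lemma op_integral_tensor: "op_integral M (\<lambda>\<omega>. tensor (X t \<omega>) (X s \<omega>)) = C (t - s)"
  using X_stat[unfolded so_stationary_def, rule_format, of s "t - s"] by simp

lemma C_eq: "C (t - s) z = (\<integral>\<omega>. tensor (X t \<omega>) (X s \<omega>) z \<partial>M)"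
  using op_integral_tensor[of t s] by (auto simp: op_integral_def fun_eq_iff)

lemma bounded_clinear_C: "bounded_clinear (C h)"
proof -
  have eq: "C h z = (\<integral>\<omega>. tensor (X h \<omega>) (X 0 \<omega>) z \<partial>M)" for z
    using C_eq[of h 0 z] by simp
  show ?thesis
    unfolding bounded_clinear_def
  proof (intro conjI allI bounded_linear_intro[where K = "\<integral>\<omega>. norm (X h \<omega>) * norm (X 0 \<omega>) \<partial>M"])
    show "C h (x + y) = C h x + C h y" for x y
      unfolding eq Bochner_Integration.integral_add[OF integrable_tensor integrable_tensor, symmetric]
      by (simp add: tensor_def cinner_algebra scaleC_add_left)
    show "C h (c *\<^sub>C x) = c *\<^sub>C C h x" for c x
      unfolding eq integral_scaleC_right(2)[OF integrable_tensor, symmetric]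
      by (simp add: tensor_def cinner_algebra scaleC_scaleC)
    then show "C h (r *\<^sub>R x) = r *\<^sub>R C h x" for r x
      by (simp add: scaleR_scaleC)
    show "norm (C h x) \<le> norm x * (\<integral>\<omega>. norm (X h \<omega>) * norm (X 0 \<omega>) \<partial>M)" for x
    proof -
      have "norm (C h x) \<le> (\<integral>\<omega>. norm (tensor (X h \<omega>) (X 0 \<omega>) x) \<partial>M)"
        unfolding eq by (rule integral_norm_bound)
      also have "\<dots> \<le> (\<integral>\<omega>. norm x * (norm (X h \<omega>) * norm (X 0 \<omega>)) \<partial>M)"
        by (intro integral_mono integrable_norm integrable_tensor integrable_mult_right integrable_norm2
            norm_tensor_le)
      finally show ?thesis by simp
    qed
  qed
qed

text \<open>The trace of \<open>C h\<close>, written as an expectation of an inner product;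
  \<open>has_sum_trace\<close> links the two.\<close>

definition tr_cov :: "real^'d \<Rightarrow> complex" where
  "tr_cov h = (\<integral>\<omega>. cinner (X h \<omega>) (X 0 \<omega>) \<partial>M)"

text \<open>Parseval holds for each outcome, and the product of the two norms dominates every finite
  partial sum, so the expectation may be taken termwise.\<close>

lemma has_sum_trace: "((\<lambda>e. cinner (C (t - s) e) e) has_sum (\<integral>\<omega>. cinner (X t \<omega>) (X s \<omega>) \<partial>M)) E"
proof -
  have "((\<lambda>e. \<integral>\<omega>. cinner (tensor (X t \<omega>) (X s \<omega>) e) e \<partial>M) has_sum (\<integral>\<omega>. cinner (X t \<omega>) (X s \<omega>) \<partial>M)) E"
  proof (rule has_sum_integral[where B = "\<lambda>\<omega>. norm (X t \<omega>) * norm (X s \<omega>)"])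
    show "integrable M (\<lambda>\<omega>. cinner (tensor (X t \<omega>) (X s \<omega>) e) e)" for e
      by (intro integral_cinner_left integrable_tensor)
    show "((\<lambda>e. cinner (tensor (X t \<omega>) (X s \<omega>) e) e) has_sum cinner (X t \<omega>) (X s \<omega>)) E" for \<omega>
      using Parseval[OF E, of "X t \<omega>" "X s \<omega>"] by (simp add: tensor_def cinner_algebra mult.commute)
    show "(\<Sum>e\<in>F. norm (cinner (tensor (X t \<omega>) (X s \<omega>) e) e)) \<le> norm (X t \<omega>) * norm (X s \<omega>)"
      if "finite F" "F \<subseteq> E" for F \<omega>
      using sum_cinner_mult_le[OF E that, of "X t \<omega>" "X s \<omega>"]
      by (simp add: tensor_def cinner_algebra norm_mult mult.commute)
  qed (use countable_cons[OF E] integrable_norm2 in auto)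
  then show ?thesis
    by (simp add: C_eq integral_cinner_left(2)[OF integrable_tensor])
qed

text \<open>Stationarity is assumed for the operators; it transfers to the scalar expectation
  because that is the trace of \<open>C (t - s)\<close>.\<close>

lemma tr_cov_eq: "(\<integral>\<omega>. cinner (X t \<omega>) (X s \<omega>) \<partial>M) = tr_cov (t - s)"
  using has_sum_unique[OF has_sum_trace[of t s]] has_sum_trace[of "t - s" 0]
  unfolding tr_cov_def by simp

lemma norm_tr_cov_le: "ennreal (cmod (tr_cov h)) \<le> trace_norm E (C h)"
  using has_sum_trace[of h 0] tr_cov_eq[of h 0] by (intro norm_trace_le_trace_norm[OF E]) simp

lemma norm_tr_cov_diff_le: "ennreal (cmod (tr_cov y - tr_cov h)) \<le> trace_norm E (C y - C h)"
proof (rule norm_trace_le_trace_norm[OF E])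
  have "((\<lambda>e. cinner (C y e) e - cinner (C h e) e) has_sum tr_cov y - tr_cov h) E"
    using has_sum_trace[of y 0] has_sum_trace[of h 0] tr_cov_eq[of _ 0]
    by (intro has_sum_difference) auto
  then show "((\<lambda>e. cinner ((C y - C h) e) e) has_sum tr_cov y - tr_cov h) E"
    by (simp add: cinner_algebra)
qed

text \<open>The Hilbert-Schmidt norm of \<open>C h\<close> as a real number. Unlike the trace norm,
  it is shown below to be a genuine sum at every single h.\<close>

definition hs_cov :: "real^'d \<Rightarrow> real" where
  "hs_cov h = sqrt (\<Sum>\<^sub>\<infinity>e\<in>E. (norm (C h e))\<^sup>2)"

text \<open>Jensen for each basis vector, then Bessel under the expectation. The fourth moments make
  every \<open>C h\<close> Hilbert-Schmidt, whereas integrability of the trace norm says nothing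
  about a given lattice point.\<close>

lemma sum_norm_C_le:
  assumes F: "finite F" "F \<subseteq> E"
  shows "(\<Sum>e\<in>F. (norm (C h e))\<^sup>2) \<le> (\<integral>\<omega>. norm (X h \<omega>) * norm (X h \<omega>) * norm (X 0 \<omega>) * norm (X 0 \<omega>) \<partial>M)"
proof -
  have int: "integrable M (\<lambda>\<omega>. (norm (tensor (X h \<omega>) (X 0 \<omega>) e))\<^sup>2)" for e
  proof (rule Bochner_Integration.integrable_bound)
    show "integrable M (\<lambda>\<omega>. (norm e)\<^sup>2 * (norm (X h \<omega>) * norm (X h \<omega>) * norm (X 0 \<omega>) * norm (X 0 \<omega>)))"
      by (intro integrable_mult_right integrable_norm4)
    show "AE \<omega> in M. norm ((norm (tensor (X h \<omega>) (X 0 \<omega>) e))\<^sup>2)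
        \<le> norm ((norm e)\<^sup>2 * (norm (X h \<omega>) * norm (X h \<omega>) * norm (X 0 \<omega>) * norm (X 0 \<omega>)))"
    proof (rule AE_I2)
      fix \<omega>
      have "(norm (tensor (X h \<omega>) (X 0 \<omega>) e))\<^sup>2 \<le> (norm e * (norm (X h \<omega>) * norm (X 0 \<omega>)))\<^sup>2"
        by (intro power_mono norm_tensor_le) auto
      then show "norm ((norm (tensor (X h \<omega>) (X 0 \<omega>) e))\<^sup>2)
          \<le> norm ((norm e)\<^sup>2 * (norm (X h \<omega>) * norm (X h \<omega>) * norm (X 0 \<omega>) * norm (X 0 \<omega>)))"
        by (simp add: power2_eq_square mult_ac abs_mult)
    qed
  qed simp
  have "(norm (C h e))\<^sup>2 \<le> (\<integral>\<omega>. (norm (tensor (X h \<omega>) (X 0 \<omega>) e))\<^sup>2 \<partial>M)" for e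
  proof -
    have "norm (C h e) \<le> (\<integral>\<omega>. norm (tensor (X h \<omega>) (X 0 \<omega>) e) \<partial>M)"
      using C_eq[of h 0 e] integral_norm_bound[of M "\<lambda>\<omega>. tensor (X h \<omega>) (X 0 \<omega>) e"] by simp
    then have "(norm (C h e))\<^sup>2 \<le> (\<integral>\<omega>. norm (tensor (X h \<omega>) (X 0 \<omega>) e) \<partial>M)\<^sup>2"
      by (intro power_mono) auto
    \<comment> \<open>Jensen's inequality for the square, read off from the nonnegativity of the
      variance.\<close>
    also have "\<dots> \<le> (\<integral>\<omega>. (norm (tensor (X h \<omega>) (X 0 \<omega>) e))\<^sup>2 \<partial>M)"
      using variance_positive[of "\<lambda>\<omega>. norm (tensor (X h \<omega>) (X 0 \<omega>) e)"]
        variance_eq[OF integrable_norm[OF integrable_tensor] int, of e] by linarith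
    finally show ?thesis .
  qed
  then have "(\<Sum>e\<in>F. (norm (C h e))\<^sup>2) \<le> (\<Sum>e\<in>F. \<integral>\<omega>. (norm (tensor (X h \<omega>) (X 0 \<omega>) e))\<^sup>2 \<partial>M)"
    by (intro sum_mono)
  also have "\<dots> = (\<integral>\<omega>. (\<Sum>e\<in>F. (norm (tensor (X h \<omega>) (X 0 \<omega>) e))\<^sup>2) \<partial>M)"
    by (rule Bochner_Integration.integral_sum[symmetric]) (rule int)
  also have "\<dots> \<le> (\<integral>\<omega>. norm (X h \<omega>) * norm (X h \<omega>) * norm (X 0 \<omega>) * norm (X 0 \<omega>) \<partial>M)"
  proof (intro integral_mono Bochner_Integration.integrable_sum int integrable_norm4)
    fix \<omega>
    have "(\<Sum>e\<in>F. (norm (tensor (X h \<omega>) (X 0 \<omega>) e))\<^sup>2)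
        = (norm (X h \<omega>))\<^sup>2 * (\<Sum>e\<in>F. (cmod (cinner (X 0 \<omega>) e))\<^sup>2)"
      unfolding sum_distrib_left
    proof (intro sum.cong refl)
      fix e
      have "cmod (cinner e (X 0 \<omega>)) = cmod (cinner (X 0 \<omega>) e)"
        by (metis cinner_commute complex_mod_cnj)
      then show "(norm (tensor (X h \<omega>) (X 0 \<omega>) e))\<^sup>2 = (norm (X h \<omega>))\<^sup>2 * (cmod (cinner (X 0 \<omega>) e))\<^sup>2"
        by (simp add: tensor_def norm_scaleC power_mult_distrib)
    qed
    also have "\<dots> \<le> (norm (X h \<omega>))\<^sup>2 * (norm (X 0 \<omega>))\<^sup>2"
      by (intro mult_left_mono Bessel[OF E F]) simp
    finally show "(\<Sum>e\<in>F. (norm (tensor (X h \<omega>) (X 0 \<omega>) e))\<^sup>2)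
        \<le> norm (X h \<omega>) * norm (X h \<omega>) * norm (X 0 \<omega>) * norm (X 0 \<omega>)"
      by (simp add: power2_eq_square mult_ac)
  qed
  finally show ?thesis .
qed

lemma has_sum_hs_cov: "((\<lambda>e. (norm (C h e))\<^sup>2) has_sum (hs_cov h)\<^sup>2) E"
proof -
  have "(\<lambda>e. (norm (C h e))\<^sup>2) summable_on E"
    by (rule nonneg_bdd_above_summable_on) (use sum_norm_C_le[of _ h] in \<open>auto intro!: bdd_aboveI2\<close>)
  then show ?thesis
    by (simp add: hs_cov_def infsum_nonneg)
qed

lemma hs_cov_nonneg: "0 \<le> hs_cov h"
  by (simp add: hs_cov_def infsum_nonneg)

lemma L2_set_C_le: "finite F \<Longrightarrow> F \<subseteq> E \<Longrightarrow> L2_set (\<lambda>e. norm (C h e)) F \<le> hs_cov h"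
  unfolding L2_set_def by (rule real_le_lsqrt[OF hs_cov_nonneg]) (rule finite_sum_le_has_sum[OF has_sum_hs_cov], auto)

lemma hs_cov_le:
  assumes "\<And>F. finite F \<Longrightarrow> F \<subseteq> E \<Longrightarrow> L2_set (\<lambda>e. norm (C h e)) F \<le> b" "0 \<le> b"
  shows "hs_cov h \<le> b"
proof -
  have "(hs_cov h)\<^sup>2 \<le> b\<^sup>2"
  proof (rule has_sum_le_finite_sums[OF has_sum_hs_cov])
    fix F assume F: "finite F" "F \<subseteq> E"
    have "(L2_set (\<lambda>e. norm (C h e)) F)\<^sup>2 \<le> b\<^sup>2"
      by (intro power_mono assms F) auto
    then show "(\<Sum>e\<in>F. (norm (C h e))\<^sup>2) \<le> b\<^sup>2"
      by (simp add: L2_set_def sum_nonneg)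
  qed
  then show ?thesis using assms(2) by (rule power2_le_imp_le)
qed

lemma hs_cov_le_trace_norm: "ennreal (hs_cov h) \<le> trace_norm E (C h)"
proof (cases "trace_norm E (C h)" rule: ennreal_cases)
  case (real b)
  have "hs_cov h \<le> b"
    using sum_norm_sq_le_trace_norm[OF E, of _ "C h"] real by (intro hs_cov_le) auto
  then show ?thesis using real by (simp add: ennreal_leI)
qed simp

text \<open>Minkowski on finite sections. One side suffices: only upward jumps from h to y can
  enlarge a lattice sum over the integral.\<close>

lemma hs_cov_diff_le: "ennreal (hs_cov y - hs_cov h) \<le> trace_norm E (C y - C h)"
proof (cases "trace_norm E (C y - C h)" rule: ennreal_cases)
  case (real b)
  have "hs_cov y \<le> b + hs_cov h"
  proof (rule hs_cov_le)
    fix F assume F: "finite F" "F \<subseteq> E"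
    have "L2_set (\<lambda>e. norm (C y e)) F \<le> L2_set (\<lambda>e. norm ((C y - C h) e) + norm (C h e)) F"
      by (rule L2_set_mono) (auto simp: norm_triangle_sub add.commute)
    also have "\<dots> \<le> L2_set (\<lambda>e. norm ((C y - C h) e)) F + L2_set (\<lambda>e. norm (C h e)) F"
      by (rule L2_set_triangle_ineq)
    also have "\<dots> \<le> b + hs_cov h"
      using sum_norm_sq_le_trace_norm[OF E F, of "C y - C h"] real L2_set_C_le[OF F, of h]
      by (intro add_mono) auto
    finally show "L2_set (\<lambda>e. norm (C y e)) F \<le> b + hs_cov h" .
  qed (use real hs_cov_nonneg in auto)
  then show ?thesis using real by (simp add: ennreal_leI)
qed simp

lemma has_sum_hs_inner_C:
  "((\<lambda>e. cinner (C a e) (C b e)) has_sum hs_inner E (C a) (C b)) E"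
  "cmod (hs_inner E (C a) (C b)) \<le> hs_cov a * hs_cov b"
proof -
  have fin: "(\<Sum>e\<in>F. cmod (cinner (C a e) (C b e))) \<le> hs_cov a * hs_cov b" if F: "finite F" "F \<subseteq> E" for F
  proof -
    have "(\<Sum>e\<in>F. cmod (cinner (C a e) (C b e))) \<le> (\<Sum>e\<in>F. \<bar>norm (C a e)\<bar> * \<bar>norm (C b e)\<bar>)"
      by (intro sum_mono) (simp add: cinner_Cauchy_Schwarz)
    also have "\<dots> \<le> L2_set (\<lambda>e. norm (C a e)) F * L2_set (\<lambda>e. norm (C b e)) F"
      by (rule L2_set_mult_ineq)
    also have "\<dots> \<le> hs_cov a * hs_cov b"
      by (intro mult_mono L2_set_C_le F hs_cov_nonneg L2_set_nonneg)
    finally show ?thesis .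
  qed
  have s: "(\<lambda>e. cmod (cinner (C a e) (C b e))) summable_on E"
    by (rule nonneg_bdd_above_summable_on) (use fin in \<open>auto intro!: bdd_aboveI2\<close>)
  then show 1: "((\<lambda>e. cinner (C a e) (C b e)) has_sum hs_inner E (C a) (C b)) E"
    unfolding hs_inner_def by (rule has_sum_infsum[OF abs_summable_summable])
  have "cmod (hs_inner E (C a) (C b)) \<le> (\<Sum>\<^sub>\<infinity>e\<in>E. cmod (cinner (C a e) (C b e)))"
    unfolding hs_inner_def by (rule norm_infsum_bound) (use s in simp)
  also have "\<dots> \<le> hs_cov a * hs_cov b"
    by (rule infsum_le_finite_sums[OF s fin])
  finally show "cmod (hs_inner E (C a) (C b)) \<le> hs_cov a * hs_cov b" .
qed

section \<open>Covariances of tensor products and the variance of linear combinations\<close>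

abbreviation cum :: "real^'d \<Rightarrow> real^'d \<Rightarrow> real^'d \<Rightarrow> real^'d \<Rightarrow> complex" where
  "cum t s t' s' \<equiv> cum4 E M (X t) (X s) (X t') (X s')"

text \<open>For p = (t, s) and q = (t', s') this is the Hilbert-Schmidt covariance of X(t) \<otimes>
  X(s) and X(t') \<otimes> X(s'), obtained by solving the definition of the cumulant for its first
  two terms.\<close>

definition quad_cov :: "(real^'d) \<times> (real^'d) \<Rightarrow> (real^'d) \<times> (real^'d) \<Rightarrow> complex" where
  "quad_cov p q = cum (fst p) (snd p) (fst q) (snd q)
     + tr_cov (fst p - fst q) * tr_cov (snd q - snd p)
     + hs_inner E (C (fst p - snd q)) (C (fst q - snd p))"

text \<open>The contribution of one basis vector e to that covariance.\<close>

definition cov_at :: "'h \<Rightarrow> (real^'d) \<times> (real^'d) \<Rightarrow> (real^'d) \<times> (real^'d) \<Rightarrow> complex" where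
  "cov_at e p q = (\<integral>\<omega>. cinner (tensor (X (fst p) \<omega>) (X (snd p) \<omega>) e) (tensor (X (fst q) \<omega>) (X (snd q) \<omega>) e) \<partial>M)
     - cinner (C (fst p - snd p) e) (C (fst q - snd q) e)"

lemma integrable_cinner_tensor:
  "integrable M (\<lambda>\<omega>. cinner (tensor (X t \<omega>) (X s \<omega>) e) (tensor (X t' \<omega>) (X s' \<omega>) e))"
proof (rule Bochner_Integration.integrable_bound)
  show "integrable M (\<lambda>\<omega>. (norm e)\<^sup>2 * (norm (X t \<omega>) * norm (X s \<omega>) * norm (X t' \<omega>) * norm (X s' \<omega>)))"
    by (intro integrable_mult_right integrable_norm4)
  show "AE \<omega> in M. norm (cinner (tensor (X t \<omega>) (X s \<omega>) e) (tensor (X t' \<omega>) (X s' \<omega>) e))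
      \<le> norm ((norm e)\<^sup>2 * (norm (X t \<omega>) * norm (X s \<omega>) * norm (X t' \<omega>) * norm (X s' \<omega>)))"
  proof (rule AE_I2)
    fix \<omega>
    have "norm (cinner (tensor (X t \<omega>) (X s \<omega>) e) (tensor (X t' \<omega>) (X s' \<omega>) e))
        \<le> norm (tensor (X t \<omega>) (X s \<omega>) e) * norm (tensor (X t' \<omega>) (X s' \<omega>) e)"
      by (rule cinner_Cauchy_Schwarz)
    also have "\<dots> \<le> (norm e * (norm (X t \<omega>) * norm (X s \<omega>))) * (norm e * (norm (X t' \<omega>) * norm (X s' \<omega>)))"
      by (intro mult_mono norm_tensor_le) auto
    finally show "norm (cinner (tensor (X t \<omega>) (X s \<omega>) e) (tensor (X t' \<omega>) (X s' \<omega>) e))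
        \<le> norm ((norm e)\<^sup>2 * (norm (X t \<omega>) * norm (X s \<omega>) * norm (X t' \<omega>) * norm (X s' \<omega>)))"
      by (simp add: power2_eq_square mult_ac abs_mult)
  qed
qed simp

text \<open>For each outcome Parseval sums the tensor terms to <X(s'), X(s)> <X(t), X(t')>, and the
  exchange with the expectation is dominated by the product of the four norms.\<close>

lemma has_sum_cov_at: "((\<lambda>e. cov_at e p q) has_sum quad_cov p q) E"
proof -
  obtain t s t' s' where pq: "p = (t, s)" "q = (t', s')" by (metis prod.exhaust)
  define g where "g \<omega> = cinner (X s' \<omega>) (X s \<omega>) * cinner (X t \<omega>) (X t' \<omega>)" for \<omega>
  have ptw: "cinner (tensor (X t \<omega>) (X s \<omega>) e) (tensor (X t' \<omega>) (X s' \<omega>) e)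
      = cinner (X s' \<omega>) e * cinner e (X s \<omega>) * cinner (X t \<omega>) (X t' \<omega>)" for \<omega> e
    using cinner_commute[of "X s' \<omega>" e] by (simp add: tensor_def cinner_algebra)
  have gs: "((\<lambda>e. cinner (tensor (X t \<omega>) (X s \<omega>) e) (tensor (X t' \<omega>) (X s' \<omega>) e)) has_sum g \<omega>) E" for \<omega>
    unfolding ptw g_def by (rule has_sum_cmult_left[OF Parseval[OF E]])
  then have hs: "hs_inner E (tensor (X t \<omega>) (X s \<omega>)) (tensor (X t' \<omega>) (X s' \<omega>)) = g \<omega>" for \<omega>
    unfolding hs_inner_def by (rule infsumI)
  have 1: "((\<lambda>e. \<integral>\<omega>. cinner (tensor (X t \<omega>) (X s \<omega>) e) (tensor (X t' \<omega>) (X s' \<omega>) e) \<partial>M)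
      has_sum (\<integral>\<omega>. g \<omega> \<partial>M)) E"
  proof (rule has_sum_integral[where B = "\<lambda>\<omega>. norm (X s' \<omega>) * norm (X s \<omega>) * norm (X t \<omega>) * norm (X t' \<omega>)"])
    show "(\<Sum>e\<in>F. cmod (cinner (tensor (X t \<omega>) (X s \<omega>) e) (tensor (X t' \<omega>) (X s' \<omega>) e)))
        \<le> norm (X s' \<omega>) * norm (X s \<omega>) * norm (X t \<omega>) * norm (X t' \<omega>)" if F: "finite F" "F \<subseteq> E" for F \<omega>
    proof -
      have "(\<Sum>e\<in>F. cmod (cinner (tensor (X t \<omega>) (X s \<omega>) e) (tensor (X t' \<omega>) (X s' \<omega>) e)))
          = (\<Sum>e\<in>F. cmod (cinner (X s' \<omega>) e) * cmod (cinner e (X s \<omega>))) * cmod (cinner (X t \<omega>) (X t' \<omega>))"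
        by (simp add: ptw norm_mult sum_distrib_right)
      also have "\<dots> \<le> (norm (X s' \<omega>) * norm (X s \<omega>)) * (norm (X t \<omega>) * norm (X t' \<omega>))"
        by (intro mult_mono sum_cinner_mult_le[OF E F] cinner_Cauchy_Schwarz) auto
      finally show ?thesis by (simp add: mult_ac)
    qed
    show "g \<in> borel_measurable M" unfolding g_def by measurable
  qed (use countable_cons[OF E] integrable_cinner_tensor integrable_norm4 gs in auto)
  have "((\<lambda>e. cov_at e p q) has_sum ((\<integral>\<omega>. g \<omega> \<partial>M) - hs_inner E (C (t - s)) (C (t' - s')))) E"
    unfolding cov_at_def pq fst_conv snd_conv by (intro has_sum_difference 1 has_sum_hs_inner_C)
  \<comment> \<open>Reality of the process enters here: conjugation is the identity on its values,
    so the last cumulant term is an inner product of covariances.\<close>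
  moreover have "op_integral M (\<lambda>\<omega>. tensor (X a \<omega>) (conj_wrt E (X b \<omega>))) = C (a - b)" for a b
    unfolding op_integral_tensor[symmetric] op_integral_def
    by (intro ext Bochner_Integration.integral_cong) (auto simp: conj_wrt_real[OF E X_real])
  then have "quad_cov p q = (\<integral>\<omega>. g \<omega> \<partial>M) - hs_inner E (C (t - s)) (C (t' - s'))"
    by (simp add: quad_cov_def pq cum4_def hs op_integral_tensor tr_cov_eq)
  ultimately show ?thesis by simp
qed

text \<open>The variance at e is a sesquilinear form in the coefficients with entries
  \<open>cov_at e\<close>. These variances are nonnegative, so a sum over \<open>F\<close> is at
  most the sum over all of \<open>E\<close>, which is the form with entries \<open>quad_cov\<close>;
  hence a bound free of \<open>F\<close>.\<close>

lemma variance_quadratic_form: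
  fixes a :: "(real^'d) \<times> (real^'d) \<Rightarrow> complex"
  assumes P: "finite P" and F: "finite F" "F \<subseteq> E"
  defines "Z \<equiv> \<lambda>\<omega> e. \<Sum>p\<in>P. a p *\<^sub>C (tensor (X (fst p) \<omega>) (X (snd p) \<omega>) e - C (fst p - snd p) e)"
  shows "integrable M (\<lambda>\<omega>. (norm (Z \<omega> e))\<^sup>2)"
    and "(\<Sum>e\<in>F. \<integral>\<omega>. (norm (Z \<omega> e))\<^sup>2 \<partial>M) \<le> (\<Sum>p\<in>P. \<Sum>q\<in>P. cmod (a p) * cmod (a q) * cmod (quad_cov p q))"
proof -
  define T where "T p \<omega> e = tensor (X (fst p) \<omega>) (X (snd p) \<omega>) e" for p \<omega> e
  define m where "m p e = C (fst p - snd p) e" for p e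
  have T: "integrable M (\<lambda>\<omega>. T p \<omega> e)" "(\<integral>\<omega>. T p \<omega> e \<partial>M) = m p e" for p e
    unfolding T_def m_def C_eq by (rule integrable_tensor refl)+
  have TT: "integrable M (\<lambda>\<omega>. cinner (T p \<omega> e) (T q \<omega> e))" for p q e
    unfolding T_def by (rule integrable_cinner_tensor)
  have exp: "cinner (T p \<omega> e - m p e) (T q \<omega> e - m q e)
      = cinner (T p \<omega> e) (T q \<omega> e) - cinner (T p \<omega> e) (m q e) - cinner (m p e) (T q \<omega> e) + cinner (m p e) (m q e)"
    for p q \<omega> e by (simp add: cinner_algebra)
  have i: "integrable M (\<lambda>\<omega>. cinner (T p \<omega> e - m p e) (T q \<omega> e - m q e))"
    and c: "(\<integral>\<omega>. cinner (T p \<omega> e - m p e) (T q \<omega> e - m q e) \<partial>M) = cov_at e p q" for p q e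
  proof -
    note int = TT[of p e q] integral_cinner_left[OF T(1), of p e "m q e"] integral_cinner_right[OF T(1), of "m p e" q e]
    show "integrable M (\<lambda>\<omega>. cinner (T p \<omega> e - m p e) (T q \<omega> e - m q e))"
      unfolding exp using int by (intro Bochner_Integration.integrable_add Bochner_Integration.integrable_diff) auto
    show "(\<integral>\<omega>. cinner (T p \<omega> e - m p e) (T q \<omega> e - m q e) \<partial>M) = cov_at e p q"
      unfolding exp using int
      by (simp add: T(2) cov_at_def T_def[symmetric] m_def[symmetric] prob_space)
  qed
  define h where "h e \<omega> = (\<Sum>p\<in>P. \<Sum>q\<in>P. a p * cnj (a q) * cinner (T p \<omega> e - m p e) (T q \<omega> e - m q e))" for e \<omega>
  have Z: "complex_of_real ((norm (Z \<omega> e))\<^sup>2) = h e \<omega>" for \<omega> e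
    unfolding cinner_self[symmetric] Z_def h_def T_def[symmetric] m_def[symmetric] cinner_sum_left unfolding cinner_sum_right
    by (intro sum.cong refl) (simp add: cinner_scaleC_left cinner_scaleC_right mult_ac)
  have hi: "integrable M (h e)" for e
    unfolding h_def by (intro Bochner_Integration.integrable_sum integrable_mult_right i)
  have hc: "(\<integral>\<omega>. h e \<omega> \<partial>M) = (\<Sum>p\<in>P. \<Sum>q\<in>P. a p * cnj (a q) * cov_at e p q)" for e
    unfolding h_def
    by (simp add: Bochner_Integration.integral_sum Bochner_Integration.integrable_sum i c)
  have hiR: "integrable M (\<lambda>\<omega>. complex_of_real ((norm (Z \<omega> e))\<^sup>2))" for e
    using hi[of e] by (simp only: Z)
  then show "integrable M (\<lambda>\<omega>. (norm (Z \<omega> e))\<^sup>2)"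
    using integrable_Re[of M "\<lambda>\<omega>. complex_of_real ((norm (Z \<omega> e))\<^sup>2)"] by simp
  define D where "D e = (\<integral>\<omega>. (norm (Z \<omega> e))\<^sup>2 \<partial>M)" for e
  have D: "complex_of_real (D e) = (\<Sum>p\<in>P. \<Sum>q\<in>P. a p * cnj (a q) * cov_at e p q)" for e
    unfolding hc[symmetric] D_def Z[symmetric] by (rule integral_complex_of_real[symmetric])
  define S where "S = (\<Sum>p\<in>P. \<Sum>q\<in>P. a p * cnj (a q) * quad_cov p q)"
  have "((\<lambda>e. complex_of_real (D e)) has_sum S) E"
    unfolding D S_def by (intro has_sum_sums has_sum_cmult_right has_sum_cov_at)
  from has_sum_Re[OF this] have "(D has_sum Re S) E" by simp
  then have "(\<Sum>e\<in>F. D e) \<le> Re S"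
    by (rule finite_sum_le_has_sum) (use F in \<open>auto simp: D_def\<close>)
  also have "\<dots> \<le> cmod S" by (rule complex_Re_le_cmod)
  also have "\<dots> \<le> (\<Sum>p\<in>P. \<Sum>q\<in>P. cmod (a p) * cmod (a q) * cmod (quad_cov p q))"
    unfolding S_def by (intro sum_norm_le) (simp add: norm_mult)
  finally show "(\<Sum>e\<in>F. \<integral>\<omega>. (norm (Z \<omega> e))\<^sup>2 \<partial>M) \<le> (\<Sum>p\<in>P. \<Sum>q\<in>P. cmod (a p) * cmod (a q) * cmod (quad_cov p q))"
    by (simp add: D_def)
qed

end

section \<open>The bias\<close>

text \<open>The chord has length 2 |sin((a - b)/2)|.\<close>

lemma norm_cis_diff_le: "cmod (cis a - cis b) \<le> \<bar>a - b\<bar>"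
proof -
  have "(cmod (cis a - cis b))\<^sup>2 = (cos a - cos b)\<^sup>2 + (sin a - sin b)\<^sup>2"
    by (simp add: cmod_power2)
  also have "\<dots> = 2 - 2 * cos (a - b)"
    using sin_cos_squared_add[of a] sin_cos_squared_add[of b]
    by (simp add: cos_diff power2_diff algebra_simps)
  also have "cos (a - b) = 1 - 2 * (sin ((a - b) / 2))\<^sup>2"
    by (metis cos_double_sin field_sum_of_halves mult_2)
  also have "2 - 2 * (1 - 2 * (sin ((a - b) / 2))\<^sup>2) = 4 * (sin ((a - b) / 2))\<^sup>2"
    by simp
  also have "\<dots> \<le> 4 * ((a - b) / 2)\<^sup>2"
    using abs_sin_x_le_abs_x[of "(a - b) / 2"] by (simp add: abs_le_square_iff[symmetric])
  finally have "(cmod (cis a - cis b))\<^sup>2 \<le> (a - b)\<^sup>2" by (simp add: power_divide)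
  then show ?thesis by (simp add: abs_le_square_iff[symmetric])
qed

lemma L2_set_measurable:
  fixes f :: "'e \<Rightarrow> 'a \<Rightarrow> 'b::{real_normed_vector,second_countable_topology}"
  assumes "\<And>e. e \<in> F \<Longrightarrow> f e \<in> borel_measurable M"
  shows "(\<lambda>x. L2_set (\<lambda>e. norm (f e x)) F) \<in> borel_measurable M"
proof -
  have "(\<lambda>x. norm (f e x)) \<in> borel_measurable M" if "e \<in> F" for e
    using assms[OF that] by measurable
  then show ?thesis
    unfolding L2_set_def
    by (intro borel_measurable_continuous_on[where f = sqrt] continuous_intros borel_measurable_sum
        borel_measurable_power)
qed

text \<open>Minkowski's integral inequality by duality: the vector a of integrated norms is paired
  with itself, Cauchy-Schwarz is applied under the integral, and one factor
  \<open>L2_set a F\<close> is cancelled.\<close>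

lemma L2_set_integral_le:
  fixes f :: "'e \<Rightarrow> 'a \<Rightarrow> 'b::{banach,second_countable_topology}"
  assumes F: "finite F" and f: "\<And>e. e \<in> F \<Longrightarrow> integrable M (f e)"
  shows "integrable M (\<lambda>x. L2_set (\<lambda>e. norm (f e x)) F)"
    and "L2_set (\<lambda>e. norm (\<integral>x. f e x \<partial>M)) F \<le> (\<integral>x. L2_set (\<lambda>e. norm (f e x)) F \<partial>M)"
proof -
  show i: "integrable M (\<lambda>x. L2_set (\<lambda>e. norm (f e x)) F)"
  proof (rule Bochner_Integration.integrable_bound)
    show "integrable M (\<lambda>x. \<Sum>e\<in>F. norm (f e x))"
      by (intro Bochner_Integration.integrable_sum integrable_norm f)
    show "(\<lambda>x. L2_set (\<lambda>e. norm (f e x)) F) \<in> borel_measurable M"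
      by (rule L2_set_measurable) (rule borel_measurable_integrable[OF f])
    show "AE x in M. norm (L2_set (\<lambda>e. norm (f e x)) F) \<le> norm (\<Sum>e\<in>F. norm (f e x))"
      by (intro AE_I2) (simp add: L2_set_le_sum sum_nonneg)
  qed
  define a where "a e = (\<integral>x. norm (f e x) \<partial>M)" for e
  let ?R = "\<integral>x. L2_set (\<lambda>e. norm (f e x)) F \<partial>M"
  have a0: "a e \<ge> 0" for e by (simp add: a_def)
  have "(L2_set a F)\<^sup>2 = (\<Sum>e\<in>F. a e * (\<integral>x. norm (f e x) \<partial>M))"
    unfolding a_def[symmetric] by (simp add: L2_set_def sum_nonneg power2_eq_square)
  also have "\<dots> = (\<integral>x. (\<Sum>e\<in>F. a e * norm (f e x)) \<partial>M)"
    using f by (subst Bochner_Integration.integral_sum) auto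
  also have "\<dots> \<le> (\<integral>x. L2_set a F * L2_set (\<lambda>e. norm (f e x)) F \<partial>M)"
  proof (rule integral_mono)
    show "integrable M (\<lambda>x. \<Sum>e\<in>F. a e * norm (f e x))"
      using f by (intro Bochner_Integration.integrable_sum integrable_mult_right integrable_norm)
    show "integrable M (\<lambda>x. L2_set a F * L2_set (\<lambda>e. norm (f e x)) F)"
      by (intro integrable_mult_right i)
    show "(\<Sum>e\<in>F. a e * norm (f e x)) \<le> L2_set a F * L2_set (\<lambda>e. norm (f e x)) F" for x
      using L2_set_mult_ineq[of a "\<lambda>e. norm (f e x)" F] a0 by simp
  qed
  also have "\<dots> = L2_set a F * ?R" by simp
  finally have "L2_set a F \<le> ?R"
    using L2_set_nonneg[of a F]
    by (cases "L2_set a F = 0") (auto simp: power2_eq_square intro!: integral_nonneg_AE)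
  moreover have "L2_set (\<lambda>e. norm (\<integral>x. f e x \<partial>M)) F \<le> L2_set a F"
    unfolding a_def by (rule L2_set_mono) auto
  ultimately show "L2_set (\<lambda>e. norm (\<integral>x. f e x \<partial>M)) F \<le> ?R" by simp
qed

lemma has_sum_measurable:
  fixes f :: "'i \<Rightarrow> 'a \<Rightarrow> 'b::{real_normed_vector,second_countable_topology}"
  assumes E: "countable E" and f: "\<And>e. e \<in> E \<Longrightarrow> f e \<in> borel_measurable M"
    and sum: "\<And>x. ((\<lambda>e. f e x) has_sum g x) E"
  shows "g \<in> borel_measurable M"
proof (cases "finite E")
  case True
  have "g = (\<lambda>x. \<Sum>e\<in>E. f e x)"
    using has_sum_unique[OF sum has_sum_finite[OF True]] by auto
  then show ?thesis using borel_measurable_sum[OF f] by simp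
next
  case False
  define b where "b = from_nat_into E"
  have bij: "bij_betw b UNIV E"
    unfolding b_def by (rule bij_betw_from_nat_into[OF E False])
  then have bE: "b i \<in> E" for i by (auto simp: bij_betw_def)
  have lim: "(\<lambda>n. \<Sum>i<n. f (b i) x) \<longlonglongrightarrow> g x" for x
    using has_sum_imp_sums[of "\<lambda>i. f (b i) x"] sum[of x]
    by (simp add: has_sum_reindex_bij_betw[OF bij, of "\<lambda>e. f e x"] sums_def)
  have "(\<lambda>x. \<Sum>i<n. f (b i) x) \<in> borel_measurable M" for n
    by (rule borel_measurable_sum) (rule f[OF bE])
  then show ?thesis
    using lim by (rule borel_measurable_LIMSEQ_metric)
qed

context stationary_process
begin

text \<open>No measurability of g is required, since only its values on a countable lattice
  matter.\<close>

lemma measurable_lattice_point [measurable (raw)]: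
  assumes "\<delta> > 0"
  shows "(\<lambda>x. g (lattice_point \<delta> x)) \<in> borel_measurable lebesgue"
proof -
  have "(\<lambda>k. g (latt \<delta> k)) \<in> borel_measurable (count_space UNIV)" by simp
  from measurable_compose[OF cell_measurable[OF assms] this] show ?thesis
    by (simp add: lattice_point_def)
qed

end

locale integrable_cov_process = stationary_process M E X C
  for M :: "'w measure" and E :: "'h::separable_chilbert set"
    and X :: "real^'d \<Rightarrow> 'w \<Rightarrow> 'h" and C :: "real^'d \<Rightarrow> 'h \<Rightarrow> 'h" +
  fixes \<gamma> :: real
  assumes cov: "covariance_cond E C \<gamma>"
begin

lemma C_measurable [measurable]: "(\<lambda>h. C h z) \<in> borel_measurable lebesgue"
  using cov by (simp add: covariance_cond_def trace_integrable_def)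

lemma trace_norm_C_integral: "(\<integral>\<^sup>+h. trace_norm E (C h) \<partial>lebesgue) < \<infinity>"
  using cov by (simp add: covariance_cond_def trace_integrable_def)

text \<open>The modulus condition at radius d \<delta>, with the dimensional factor moved into the
  constant. Monotonicity of \<open>nn_integral\<close> needs no measurability, so g may be any
  function below the increment.\<close>

lemma C_modulus:
  obtains \<kappa> where "\<kappa> \<ge> 0" "\<And>(\<delta>::real) g. 0 < \<delta> \<Longrightarrow> CARD('d) * \<delta> < 1 \<Longrightarrow>
      (\<And>x :: real^'d. g x \<le> trace_norm E (C (lattice_point \<delta> x) - C x)) \<Longrightarrow>
      (\<integral>\<^sup>+x. g x \<partial>lebesgue) \<le> ennreal (\<kappa> * \<delta> powr \<gamma>)"
proof -
  obtain \<kappa>0 where \<kappa>0: "\<And>r. 0 < r \<Longrightarrow> r < 1 \<Longrightarrow>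
      (\<integral>\<^sup>+x. (SUP y\<in>cball x r. trace_norm E (C y - C x)) \<partial>lebesgue) \<le> ennreal (\<kappa>0 * r powr \<gamma>)"
    using cov by (auto simp: covariance_cond_def)
  show ?thesis
  proof (rule that[of "max \<kappa>0 0 * real CARD('d) powr \<gamma>"])
    fix \<delta> :: real and g :: "real^'d \<Rightarrow> ennreal" assume \<delta>: "0 < \<delta>" "CARD('d) * \<delta> < 1"
      and g: "\<And>x. g x \<le> trace_norm E (C (lattice_point \<delta> x) - C x)"
    have "(\<integral>\<^sup>+x. g x \<partial>lebesgue) \<le> (\<integral>\<^sup>+x. (SUP y\<in>cball x (CARD('d) * \<delta>). trace_norm E (C y - C x)) \<partial>lebesgue)"
    proof (rule nn_integral_mono)
      fix x :: "real^'d"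
      have "lattice_point \<delta> x \<in> cball x (CARD('d) * \<delta>)"
        using lattice_point_close[OF \<delta>(1), of x] by (simp add: dist_norm norm_minus_commute)
      then show "g x \<le> (SUP y\<in>cball x (CARD('d) * \<delta>). trace_norm E (C y - C x))"
        by (rule SUP_upper2) (rule g)
    qed
    also have "\<dots> \<le> ennreal (\<kappa>0 * (CARD('d) * \<delta>) powr \<gamma>)"
      using \<delta> by (intro \<kappa>0) auto
    also have "\<dots> \<le> ennreal (max \<kappa>0 0 * (CARD('d) * \<delta>) powr \<gamma>)"
      by (intro ennreal_leI mult_right_mono) auto
    finally show "(\<integral>\<^sup>+x. g x \<partial>lebesgue) \<le> ennreal (max \<kappa>0 0 * real CARD('d) powr \<gamma> * \<delta> powr \<gamma>)"
      using \<delta> by (simp add: powr_mult mult_ac)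
  qed simp
qed

text \<open>The lattice sum is at most the integral of \<phi> plus that of the upward part of its
  increment to the lattice point. The first is bounded by the integral of the trace norm, the second
  by \<kappa> \<delta>^\<gamma> <= \<kappa>; the bound depends neither on \<delta> nor on S.\<close>

lemma lattice_sum_bounded:
  fixes \<phi> :: "real^'d \<Rightarrow> real"
  assumes m [measurable]: "\<phi> \<in> borel_measurable lebesgue"
    and \<phi>: "\<And>h. 0 \<le> \<phi> h" "\<And>h. ennreal (\<phi> h) \<le> trace_norm E (C h)"
    "\<And>y h. ennreal (\<phi> y - \<phi> h) \<le> trace_norm E (C y - C h)"
  obtains B where "B \<ge> 0" "\<And>(\<delta>::real) S. 0 < \<delta> \<Longrightarrow> CARD('d) * \<delta> < 1 \<Longrightarrow> finite S \<Longrightarrow>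
     (\<Sum>k\<in>S. \<delta> ^ CARD('d) * \<phi> (latt \<delta> k)) \<le> B"
proof -
  obtain \<kappa> where \<kappa>: "\<kappa> \<ge> 0" "\<And>(\<delta>::real) g. 0 < \<delta> \<Longrightarrow> CARD('d) * \<delta> < 1 \<Longrightarrow>
      (\<And>x :: real^'d. g x \<le> trace_norm E (C (lattice_point \<delta> x) - C x)) \<Longrightarrow>
      (\<integral>\<^sup>+x. g x \<partial>lebesgue) \<le> ennreal (\<kappa> * \<delta> powr \<gamma>)"
    using C_modulus by blast
  have \<gamma>: "\<gamma> > 0" using cov by (simp add: covariance_cond_def)
  define a where "a = enn2real (\<integral>\<^sup>+h. trace_norm E (C h) \<partial>lebesgue)"
  have a: "(\<integral>\<^sup>+h. trace_norm E (C h) \<partial>lebesgue) = ennreal a" "a \<ge> 0"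
    using trace_norm_C_integral by (auto simp: a_def less_top)
  show ?thesis
  proof (rule that[of "a + \<kappa>"])
    fix \<delta> :: real and S :: "('d \<Rightarrow> int) set"
    assume \<delta>: "0 < \<delta>" "CARD('d) * \<delta> < 1" and S: "finite S"
    have [measurable]: "(\<lambda>x. \<phi> (lattice_point \<delta> x)) \<in> borel_measurable lebesgue"
      by (rule measurable_lattice_point[OF \<delta>(1)])
    have "1 * \<delta> \<le> CARD('d) * \<delta>"
      using \<delta>(1) by (intro mult_right_mono) (simp_all add: Suc_leI)
    then have "\<delta> \<le> 1" using \<delta>(2) by linarith
    then have \<delta>1: "\<delta> powr \<gamma> \<le> 1" using \<delta>(1) \<gamma> by (intro powr_le1) auto
    have "ennreal (\<Sum>k\<in>S. \<delta> ^ CARD('d) * \<phi> (latt \<delta> k)) = (\<Sum>k\<in>S. ennreal (\<delta> ^ CARD('d)) * ennreal (\<phi> (latt \<delta> k)))"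
      using \<delta>(1) \<phi>(1) by (simp add: sum_ennreal[symmetric] ennreal_mult)
    also have "\<dots> \<le> (\<integral>\<^sup>+x. ennreal (\<phi> (latt \<delta> (cell \<delta> x))) \<partial>lebesgue)"
      by (rule lattice_sum_le_nn_integral[OF \<delta>(1) S])
    also have "\<dots> \<le> (\<integral>\<^sup>+x. ennreal (\<phi> x) + ennreal (\<phi> (lattice_point \<delta> x) - \<phi> x) \<partial>lebesgue)"
    proof (rule nn_integral_mono)
      fix x
      have "ennreal (\<phi> (latt \<delta> (cell \<delta> x))) \<le> ennreal (\<phi> x + max 0 (\<phi> (lattice_point \<delta> x) - \<phi> x))"
        by (intro ennreal_leI) (simp add: lattice_point_def)
      also have "\<dots> = ennreal (\<phi> x) + ennreal (\<phi> (lattice_point \<delta> x) - \<phi> x)"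
        using \<phi>(1) by (subst ennreal_plus) (auto simp: max_def ennreal_neg)
      finally show "ennreal (\<phi> (latt \<delta> (cell \<delta> x))) \<le> ennreal (\<phi> x) + ennreal (\<phi> (lattice_point \<delta> x) - \<phi> x)" .
    qed
    also have "\<dots> = (\<integral>\<^sup>+x. ennreal (\<phi> x) \<partial>lebesgue) + (\<integral>\<^sup>+x. ennreal (\<phi> (lattice_point \<delta> x) - \<phi> x) \<partial>lebesgue)"
      by (rule nn_integral_add) measurable
    also have "\<dots> \<le> ennreal a + ennreal (\<kappa> * \<delta> powr \<gamma>)"
    proof (rule add_mono)
      show "(\<integral>\<^sup>+x. ennreal (\<phi> x) \<partial>lebesgue) \<le> ennreal a"
        unfolding a(1)[symmetric] by (intro nn_integral_mono \<phi>(2))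
      show "(\<integral>\<^sup>+x. ennreal (\<phi> (lattice_point \<delta> x) - \<phi> x) \<partial>lebesgue) \<le> ennreal (\<kappa> * \<delta> powr \<gamma>)"
        by (rule \<kappa>(2)[OF \<delta> \<phi>(3)])
    qed
    also have "\<dots> \<le> ennreal a + ennreal \<kappa>"
      using \<delta>1 \<kappa>(1) by (intro add_left_mono ennreal_leI) (simp add: mult_left_le)
    finally show "(\<Sum>k\<in>S. \<delta> ^ CARD('d) * \<phi> (latt \<delta> k)) \<le> a + \<kappa>"
      using a(2) \<kappa>(1) by (simp add: ennreal_plus[symmetric] del: ennreal_plus)
  qed (use a(2) \<kappa>(1) in simp)
qed

lemma tr_cov_measurable [measurable]: "tr_cov \<in> borel_measurable lebesgue"
proof (rule has_sum_measurable[OF countable_cons[OF E]])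
  show "((\<lambda>e. cinner (C x e) e) has_sum tr_cov x) E" for x
    using has_sum_trace[of x 0] tr_cov_eq[of x 0] by simp
qed auto

lemma hs_cov_measurable [measurable]: "hs_cov \<in> borel_measurable lebesgue"
proof -
  have "(\<lambda>h. (hs_cov h)\<^sup>2) \<in> borel_measurable lebesgue"
    by (rule has_sum_measurable[OF countable_cons[OF E] _ has_sum_hs_cov]) auto
  then have "(\<lambda>h. sqrt ((hs_cov h)\<^sup>2)) \<in> borel_measurable lebesgue"
    by (intro borel_measurable_continuous_on[where f = sqrt] continuous_intros)
  then show ?thesis by (simp add: hs_cov_nonneg)
qed

lemma norm_C_apply_le: "norm (C h z) \<le> hs_cov h * norm z"
proof -
  have "((\<lambda>e. cinner z e *\<^sub>C C h e) has_sum C h z) E"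
    using has_sum_bounded_linear[OF bounded_clinearD(1)[OF bounded_clinear_C] cons_expansion[OF E, of z]]
    by (simp add: bounded_clinearD[OF bounded_clinear_C])
  then have lim: "((\<lambda>F. norm (\<Sum>e\<in>F. cinner z e *\<^sub>C C h e)) \<longlongrightarrow> norm (C h z)) (finite_subsets_at_top E)"
    unfolding has_sum_def by (rule tendsto_norm)
  show ?thesis
  proof (rule tendsto_upperbound[OF lim])
    have "norm (\<Sum>e\<in>F. cinner z e *\<^sub>C C h e) \<le> hs_cov h * norm z" if F: "finite F" "F \<subseteq> E" for F
    proof -
      have "norm (\<Sum>e\<in>F. cinner z e *\<^sub>C C h e) \<le> (\<Sum>e\<in>F. \<bar>cmod (cinner z e)\<bar> * \<bar>norm (C h e)\<bar>)"
        by (rule sum_norm_le) (simp add: norm_scaleC)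
      also have "\<dots> \<le> L2_set (\<lambda>e. cmod (cinner z e)) F * L2_set (\<lambda>e. norm (C h e)) F"
        by (rule L2_set_mult_ineq)
      also have "\<dots> \<le> norm z * hs_cov h"
      proof (intro mult_mono L2_set_C_le F)
        show "L2_set (\<lambda>e. cmod (cinner z e)) F \<le> norm z"
          unfolding L2_set_def by (rule real_le_lsqrt) (use Bessel[OF E F] in auto)
      qed auto
      finally show ?thesis by (simp add: mult.commute)
    qed
    then show "\<forall>\<^sub>F F in finite_subsets_at_top E. norm (\<Sum>e\<in>F. cinner z e *\<^sub>C C h e) \<le> hs_cov h * norm z"
      by (intro eventually_finite_subsets_at_top_weakI) auto
  qed simp
qed

lemma integrable_hs_cov: "integrable lebesgue hs_cov"
proof (rule integrableI_bounded)
  have "(\<integral>\<^sup>+x. ennreal (norm (hs_cov x)) \<partial>lebesgue) \<le> (\<integral>\<^sup>+h. trace_norm E (C h) \<partial>lebesgue)"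
    by (intro nn_integral_mono) (simp add: hs_cov_nonneg hs_cov_le_trace_norm)
  then show "(\<integral>\<^sup>+x. ennreal (norm (hs_cov x)) \<partial>lebesgue) < \<infinity>"
    using trace_norm_C_integral by (rule le_less_trans)
qed measurable

section \<open>The spectral density as a vector-valued integral\<close>

definition phase :: "real^'d \<Rightarrow> real^'d \<Rightarrow> complex" where
  "phase \<theta> h = cis (h \<bullet> \<theta>)"

lemma phase_measurable [measurable]: "phase \<theta> \<in> borel_measurable lebesgue"
proof -
  have "continuous_on UNIV (phase \<theta>)"
    unfolding phase_def cis_conv_exp by (intro continuous_intros)
  then have "phase \<theta> \<in> borel_measurable borel"
    by (rule borel_measurable_continuous_onI)
  then show ?thesis by (simp add: measurable_completion)
qed

lemma integrable_phase_C: "integrable lebesgue (\<lambda>h. phase \<theta> h *\<^sub>C C h z)"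
proof (rule Bochner_Integration.integrable_bound)
  show "integrable lebesgue (\<lambda>h. hs_cov h * norm z)"
    by (intro integrable_mult_left integrable_hs_cov)
  show "AE h in lebesgue. norm (phase \<theta> h *\<^sub>C C h z) \<le> norm (hs_cov h * norm z)"
    by (intro AE_I2) (simp add: norm_scaleC phase_def norm_C_apply_le hs_cov_nonneg abs_mult)
qed measurable

lemma spectral_density_eq:
  "spectral_density C \<theta> z = (1 / (2 * pi) ^ CARD('d)) *\<^sub>R (\<integral>h. phase \<theta> h *\<^sub>C C h z \<partial>lebesgue)"
proof -
  have "spectral_density C \<theta> z
      = (\<integral>h. complex_of_real (1 / (2 * pi) ^ CARD('d)) *\<^sub>C (phase \<theta> h *\<^sub>C C h z) \<partial>lebesgue)"
    unfolding spectral_density_def op_integral_def phase_def scaleC_scaleC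
    by (simp add: field_simps)
  also have "\<dots> = complex_of_real (1 / (2 * pi) ^ CARD('d)) *\<^sub>C (\<integral>h. phase \<theta> h *\<^sub>C C h z \<partial>lebesgue)"
    by (rule integral_scaleC_right(2)[OF integrable_phase_C])
  finally show ?thesis by (simp add: scaleR_scaleC)
qed

lemma bounded_clinear_spectral_density: "bounded_clinear (spectral_density C \<theta>)"
proof -
  let ?I = "\<lambda>z. \<integral>h. phase \<theta> h *\<^sub>C C h z \<partial>lebesgue"
  have "bounded_clinear ?I"
    unfolding bounded_clinear_def
  proof (intro conjI allI bounded_linear_intro[where K = "\<integral>h. hs_cov h \<partial>lebesgue"])
    show add: "?I (x + y) = ?I x + ?I y" for x y
      unfolding Bochner_Integration.integral_add[OF integrable_phase_C integrable_phase_C, symmetric]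
      by (simp add: bounded_clinearD[OF bounded_clinear_C] scaleC_add_right)
    show sc: "?I (c *\<^sub>C x) = c *\<^sub>C ?I x" for c x
      unfolding integral_scaleC_right(2)[OF integrable_phase_C, symmetric]
      by (simp add: bounded_clinearD[OF bounded_clinear_C] scaleC_scaleC mult.commute)
    show "?I (r *\<^sub>R x) = r *\<^sub>R ?I x" for r x
      using sc by (simp add: scaleR_scaleC)
    show "norm (?I x) \<le> norm x * (\<integral>h. hs_cov h \<partial>lebesgue)" for x
    proof -
      have "norm (?I x) \<le> (\<integral>h. norm (phase \<theta> h *\<^sub>C C h x) \<partial>lebesgue)"
        by (rule integral_norm_bound)
      also have "\<dots> \<le> (\<integral>h. hs_cov h * norm x \<partial>lebesgue)"
        by (intro integral_mono integrable_norm integrable_phase_C integrable_mult_left integrable_hs_cov)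
          (simp add: norm_scaleC phase_def norm_C_apply_le)
      finally show ?thesis by (simp add: mult.commute)
    qed
  qed
  then show ?thesis
    unfolding spectral_density_eq[abs_def] scaleR_scaleC
    by (rule bounded_clinear_compose[OF bounded_clinear_scaleC])
qed

end

text \<open>The weight of a pair of grid points depends on their lag only; with it the estimator is
  a linear combination of tensors, as \<open>variance_quadratic_form\<close> expects.\<close>

definition est_coef ::
  "(real^'d \<Rightarrow> real) \<Rightarrow> ('d::finite \<Rightarrow> nat) \<Rightarrow> real \<Rightarrow> real \<Rightarrow> real^'d \<Rightarrow> real^'d \<Rightarrow> complex" where
  "est_coef K N \<delta> \<Delta> \<theta> h = complex_of_real (\<delta> ^ (2 * CARD('d)) / (2 * pi) ^ CARD('d)) *
     (cis (h \<bullet> \<theta>) * complex_of_real (K (h /\<^sub>R \<Delta>) /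
        overlap N \<delta> h))"

text \<open>Bias and variance are restricted to a finite set \<open>F\<close> of basis vectors; the
  bounds below are uniform in \<open>F\<close> and are extended to \<open>E\<close> by
  \<open>hs_norm_le\<close> and \<open>nn_integral_infsum_le\<close>.\<close>

abbreviation est_bias where
  "est_bias M X C K N \<delta> \<Delta> \<theta> F \<equiv>
     L2_set (\<lambda>e. norm (op_integral M (spec_estimator X K N \<delta> \<Delta> \<theta>) e - spectral_density C \<theta> e)) F"

abbreviation est_variance where
  "est_variance M X K N \<delta> \<Delta> \<theta> F \<equiv>
     (\<Sum>e\<in>F. \<integral>\<omega>. (norm (spec_estimator X K N \<delta> \<Delta> \<theta> \<omega> e
        - op_integral M (spec_estimator X K N \<delta> \<Delta> \<theta>) e))\<^sup>2 \<partial>M)"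

lemma spec_estimator_eq:
  "spec_estimator X K N \<delta> \<Delta> \<theta> \<omega> z
    = (\<Sum>p\<in>grid N \<delta> \<times> grid N \<delta>. est_coef K N \<delta> \<Delta> \<theta> (fst p - snd p) *\<^sub>C tensor (X (fst p) \<omega>) (X (snd p) \<omega>) z)"
  unfolding spec_estimator_def est_coef_def scaleC_sum_right sum.cartesian_product
  by (simp only: case_prod_beta scaleC_scaleC)

context integrable_cov_process
begin

section \<open>The mean of the estimator and its distance to the spectral density\<close>

lemma bounded_clinear_tensor: "bounded_clinear (tensor x (y :: 'h))"
  unfolding bounded_clinear_def
proof (intro conjI allI bounded_linear_intro[where K = "norm x * norm y"])
  show "tensor x y (a + b) = tensor x y a + tensor x y b" for a b
    by (simp add: tensor_def cinner_algebra scaleC_add_left)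
  show "tensor x y (c *\<^sub>C a) = c *\<^sub>C tensor x y a" for c a
    by (simp add: tensor_def cinner_algebra scaleC_scaleC)
  then show "tensor x y (r *\<^sub>R a) = r *\<^sub>R tensor x y a" for r a
    by (simp add: scaleR_scaleC)
qed (rule norm_tensor_le)

lemma bounded_clinear_spec_estimator: "bounded_clinear (spec_estimator X K N \<delta> \<Delta> \<theta> \<omega>)"
  unfolding spec_estimator_eq[abs_def]
  by (intro bounded_clinear_sum bounded_clinear_compose[OF bounded_clinear_scaleC] bounded_clinear_tensor)

lemma mean_spec_estimator:
  "op_integral M (spec_estimator X K N \<delta> \<Delta> \<theta>) z
    = (\<Sum>p\<in>grid N \<delta> \<times> grid N \<delta>. est_coef K N \<delta> \<Delta> \<theta> (fst p - snd p) *\<^sub>C C (fst p - snd p) z)"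
  unfolding op_integral_def spec_estimator_eq C_eq
  by (subst Bochner_Integration.integral_sum)
    (simp_all add: integral_scaleC_right integrable_tensor)

lemma bounded_clinear_mean_spec_estimator:
  "bounded_clinear (op_integral M (spec_estimator X K N \<delta> \<Delta> \<theta>))"
  unfolding mean_spec_estimator[abs_def]
  by (intro bounded_clinear_sum bounded_clinear_compose[OF bounded_clinear_scaleC] bounded_clinear_C)

text \<open>The pair counts cancel the normalization. Since K vanishes at all lags outside
  \<open>lag_box N\<close>, the remaining sum runs over the whole lattice and is the integral of a
  step function.\<close>

lemma mean_spec_estimator_integral:
  fixes \<theta> :: "real^'d"
  assumes \<delta>: "\<delta> > 0" and K: "\<And>m. m \<notin> lag_box N \<Longrightarrow> K (latt \<delta> m /\<^sub>R \<Delta>) = 0"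
  defines "g \<equiv> \<lambda>x z. (phase \<theta> (lattice_point \<delta> x) * complex_of_real (K (lattice_point \<delta> x /\<^sub>R \<Delta>))) *\<^sub>C C (lattice_point \<delta> x) z"
  shows "integrable lebesgue (\<lambda>x. g x z)"
    and "op_integral M (spec_estimator X K N \<delta> \<Delta> \<theta>) z = (1 / (2 * pi) ^ CARD('d)) *\<^sub>R (\<integral>x. g x z \<partial>lebesgue)"
proof -
  define \<Phi> where "\<Phi> h = (phase \<theta> h * complex_of_real (K (h /\<^sub>R \<Delta>))) *\<^sub>C C h z" for h
  let ?m = "\<lambda>h. overlap N \<delta> h"
  have coef: "est_coef K N \<delta> \<Delta> \<theta> h *\<^sub>C C h z
      = (1 / (2 * pi) ^ CARD('d)) *\<^sub>R (\<delta> ^ (2 * CARD('d)) *\<^sub>R ((1 / ?m h) *\<^sub>R \<Phi> h))" for h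
    unfolding est_coef_def \<Phi>_def phase_def scaleR_scaleC scaleC_scaleC
    by (rule arg_cong[where f = "\<lambda>c. c *\<^sub>C C h z"]) (simp add: field_simps)
  have "op_integral M (spec_estimator X K N \<delta> \<Delta> \<theta>) z = (\<Sum>t\<in>grid N \<delta>. \<Sum>s\<in>grid N \<delta>. est_coef K N \<delta> \<Delta> \<theta> (t - s) *\<^sub>C C (t - s) z)"
    unfolding mean_spec_estimator by (simp add: sum.cartesian_product case_prod_beta)
  also have "\<dots> = (1 / (2 * pi) ^ CARD('d)) *\<^sub>R (\<delta> ^ (2 * CARD('d)) *\<^sub>R
      (\<Sum>t\<in>grid N \<delta>. \<Sum>s\<in>grid N \<delta>. (1 / ?m (t - s)) *\<^sub>R \<Phi> (t - s)))"
    unfolding coef scaleR_sum_right ..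
  also have "\<dots> = (1 / (2 * pi) ^ CARD('d)) *\<^sub>R (\<Sum>m\<in>lag_box N. \<delta> ^ CARD('d) *\<^sub>R \<Phi> (latt \<delta> m))"
    unfolding sum_grid_pairs_normalized[OF \<delta>] ..
  finally have mean: "op_integral M (spec_estimator X K N \<delta> \<Delta> \<theta>) z
      = (1 / (2 * pi) ^ CARD('d)) *\<^sub>R (\<Sum>m\<in>lag_box N. \<delta> ^ CARD('d) *\<^sub>R \<Phi> (latt \<delta> m))" .
  have "has_bochner_integral lebesgue (\<lambda>x. \<Phi> (latt \<delta> (cell \<delta> x))) (\<Sum>m\<in>lag_box N. \<delta> ^ CARD('d) *\<^sub>R \<Phi> (latt \<delta> m))"
    by (rule has_bochner_integral_lattice_sum[OF \<delta>]) (simp_all add: \<Phi>_def K)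
  then have "has_bochner_integral lebesgue (\<lambda>x. g x z) (\<Sum>m\<in>lag_box N. \<delta> ^ CARD('d) *\<^sub>R \<Phi> (latt \<delta> m))"
    by (simp add: g_def \<Phi>_def lattice_point_def)
  then show "integrable lebesgue (\<lambda>x. g x z)"
    "op_integral M (spec_estimator X K N \<delta> \<Delta> \<theta>) z = (1 / (2 * pi) ^ CARD('d)) *\<^sub>R (\<integral>x. g x z \<partial>lebesgue)"
    unfolding mean by (auto simp: has_bochner_integral_iff)
qed

text \<open>With y the lattice point of x, the integrand u C(y) - phase C(x) is split into u (C(y) -
  C(x)), controlled by the modulus since |u| <= 1, and (u - phase) C(x), controlled by the moment of
  order \<beta>.\<close>

lemma bias_bound:
  assumes K: "\<And>u. \<bar>K u\<bar> \<le> 1" "\<And>x y. \<bar>K x - K y\<bar> \<le> c * norm (x - y)" "\<And>u. \<bar>K u - 1\<bar> \<le> c * norm u powr \<beta>"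
    and pos: "c \<ge> 0" "b \<ge> 0" "L \<ge> 0" "\<beta> > 0"
    and L: "(\<integral>\<^sup>+x. ennreal (1 + norm x powr \<beta>) * trace_norm E (C x) \<partial>lebesgue) \<le> ennreal L"
  obtains c0 where "c0 \<ge> 0" "\<And>N (\<delta>::real) \<Delta> \<theta> F. 0 < \<delta> \<Longrightarrow> CARD('d) * \<delta> < 1 \<Longrightarrow> \<Delta> \<ge> 1 \<Longrightarrow>
     (\<And>m. m \<notin> lag_box N \<Longrightarrow> K (latt \<delta> m /\<^sub>R \<Delta>) = 0) \<Longrightarrow> norm \<theta> \<le> b \<Longrightarrow> finite F \<Longrightarrow> F \<subseteq> E \<Longrightarrow>
     est_bias M X C K N \<delta> \<Delta> \<theta> F
       \<le> c0 * (\<delta> powr \<gamma> + \<Delta> powr (- \<beta>))"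
proof -
  obtain \<kappa> where \<kappa>: "\<kappa> \<ge> 0" "\<And>(\<delta>::real) g. 0 < \<delta> \<Longrightarrow> CARD('d) * \<delta> < 1 \<Longrightarrow>
      (\<And>x :: real^'d. g x \<le> trace_norm E (C (lattice_point \<delta> x) - C x)) \<Longrightarrow>
      (\<integral>\<^sup>+x. g x \<partial>lebesgue) \<le> ennreal (\<kappa> * \<delta> powr \<gamma>)"
    using C_modulus by blast
  have \<gamma>: "0 < \<gamma>" "\<gamma> \<le> 1" using cov by (simp_all add: covariance_cond_def)
  define d where "d = real CARD('d)"
  have d: "d \<ge> 1" by (simp add: d_def Suc_leI)
  define c0 where "c0 = \<kappa> + (b * d + c * d + c) * L"
  show ?thesis
  proof (rule that[of c0])
    show "c0 \<ge> 0" using \<kappa>(1) pos d by (simp add: c0_def)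
    fix N :: "'d \<Rightarrow> nat" and \<delta> \<Delta> :: real and \<theta> :: "real^'d" and F :: "'h set"
    assume \<delta>: "0 < \<delta>" "CARD('d) * \<delta> < 1" and \<Delta>: "\<Delta> \<ge> 1"
      and lag: "\<And>m. m \<notin> lag_box N \<Longrightarrow> K (latt \<delta> m /\<^sub>R \<Delta>) = 0"
      and \<theta>: "norm \<theta> \<le> b" and F: "finite F" "F \<subseteq> E"
    define u where "u x = phase \<theta> (lattice_point \<delta> x) * complex_of_real (K (lattice_point \<delta> x /\<^sub>R \<Delta>))" for x
    define D where "D e x = u x *\<^sub>C C (lattice_point \<delta> x) e - phase \<theta> x *\<^sub>C C x e" for e x
    define s where "s x = L2_set (\<lambda>e. norm (C x e)) F" for x
    define q where "q x = L2_set (\<lambda>e. norm ((C (lattice_point \<delta> x) - C x) e)) F" for x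
    \<comment> \<open>The three terms come from moving the phase, from moving the kernel argument,
      and from replacing K by 1.\<close>
    define w where "w = b * d * \<delta> + c * d * \<delta> + c * \<Delta> powr (- \<beta>)"
    have w0: "w \<ge> 0" using pos d \<delta> by (simp add: w_def)
    have est: "integrable lebesgue (\<lambda>x. u x *\<^sub>C C (lattice_point \<delta> x) z)"
      "op_integral M (spec_estimator X K N \<delta> \<Delta> \<theta>) z
        = (1 / (2 * pi) ^ CARD('d)) *\<^sub>R (\<integral>x. u x *\<^sub>C C (lattice_point \<delta> x) z \<partial>lebesgue)" for z
      unfolding u_def by (rule mean_spec_estimator_integral[OF \<delta>(1)], erule lag)+
    have Di: "integrable lebesgue (D e)" for e
      unfolding D_def by (intro Bochner_Integration.integrable_diff est(1) integrable_phase_C)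
    have diff: "op_integral M (spec_estimator X K N \<delta> \<Delta> \<theta>) e - spectral_density C \<theta> e
        = (1 / (2 * pi) ^ CARD('d)) *\<^sub>R (\<integral>x. D e x \<partial>lebesgue)" for e
      unfolding est(2) spectral_density_eq D_def
      by (subst Bochner_Integration.integral_diff[OF est(1) integrable_phase_C]) (simp add: scaleR_diff_right)
    \<comment> \<open>The factor (2 pi)^(-d) shared by mean and density is bounded by 1.\<close>
    have "1 \<le> (2 * pi) ^ CARD('d)"
      using pi_gt3 by (intro one_le_power) simp
    then have le1: "1 / (2 * pi) ^ CARD('d) \<le> 1" by simp
    have uw: "cmod (u x - phase \<theta> x) \<le> w * (1 + norm x powr \<beta>)" for x
    proof -
      let ?y = "lattice_point \<delta> x"
      have close: "norm (?y - x) \<le> d * \<delta>"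
        using lattice_point_close[OF \<delta>(1), of x] by (simp add: d_def)
      have "cmod (u x - phase \<theta> x) = cmod (phase \<theta> ?y * complex_of_real (K (?y /\<^sub>R \<Delta>) - 1) + (phase \<theta> ?y - phase \<theta> x))"
        by (simp add: u_def algebra_simps)
      also have "\<dots> \<le> \<bar>K (?y /\<^sub>R \<Delta>) - 1\<bar> + cmod (phase \<theta> ?y - phase \<theta> x)"
      proof -
        have "cmod (phase \<theta> ?y * complex_of_real r) = \<bar>r\<bar>" for r
          by (simp add: norm_mult phase_def)
        then show ?thesis by (metis norm_triangle_ineq)
      qed
      also have "cmod (phase \<theta> ?y - phase \<theta> x) \<le> b * d * \<delta>"
      proof -
        have "cmod (phase \<theta> ?y - phase \<theta> x) \<le> \<bar>(?y - x) \<bullet> \<theta>\<bar>"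
          unfolding phase_def inner_diff_left by (rule norm_cis_diff_le)
        also have "\<dots> \<le> norm (?y - x) * norm \<theta>" by (rule Cauchy_Schwarz_ineq2)
        also have "\<dots> \<le> (d * \<delta>) * b" using close \<theta> d \<delta> by (intro mult_mono) auto
        finally show ?thesis by (simp add: mult_ac)
      qed
      also have "\<bar>K (?y /\<^sub>R \<Delta>) - 1\<bar> \<le> \<bar>K (?y /\<^sub>R \<Delta>) - K (x /\<^sub>R \<Delta>)\<bar> + \<bar>K (x /\<^sub>R \<Delta>) - 1\<bar>"
        by linarith
      also have "\<bar>K (?y /\<^sub>R \<Delta>) - K (x /\<^sub>R \<Delta>)\<bar> \<le> c * d * \<delta>"
      proof -
        have "\<bar>K (?y /\<^sub>R \<Delta>) - K (x /\<^sub>R \<Delta>)\<bar> \<le> c * norm (?y /\<^sub>R \<Delta> - x /\<^sub>R \<Delta>)" by (rule K(2))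
        also have "norm (?y /\<^sub>R \<Delta> - x /\<^sub>R \<Delta>) = norm (?y - x) / \<Delta>"
          using \<Delta> by (simp add: scaleR_diff_right[symmetric] divide_inverse mult.commute)
        also have "\<dots> \<le> norm (?y - x) / 1" using \<Delta> by (intro divide_left_mono) auto
        finally show ?thesis
          using close pos(1) by (smt (verit) div_by_1 mult.assoc mult_left_mono)
      qed
      \<comment> \<open>Flatness is used at x rather than at the lattice point, so that the weight
        |x|^\<beta> meets C(x) and the moment assumption applies directly.\<close>
      also have "\<bar>K (x /\<^sub>R \<Delta>) - 1\<bar> \<le> c * \<Delta> powr (- \<beta>) * norm x powr \<beta>"
      proof -
        have "norm (x /\<^sub>R \<Delta>) = norm x / \<Delta>" using \<Delta> by (simp add: divide_inverse mult.commute)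
        then show ?thesis
          using K(3)[of "x /\<^sub>R \<Delta>"] \<Delta> by (simp add: powr_divide powr_minus field_simps)
      qed
      finally have "cmod (u x - phase \<theta> x) \<le> c * d * \<delta> + c * \<Delta> powr (- \<beta>) * norm x powr \<beta> + b * d * \<delta>" by simp
      also have "\<dots> \<le> w * (1 + norm x powr \<beta>)"
        using pos d \<delta> by (simp add: w_def distrib_left distrib_right)
      finally show ?thesis .
    qed
    have u1: "cmod (u x) \<le> 1" for x
      using K(1) by (simp add: u_def norm_mult phase_def)
    have L2D: "L2_set (\<lambda>e. norm (D e x)) F \<le> q x + w * ((1 + norm x powr \<beta>) * s x)" for x
    proof -
      have "L2_set (\<lambda>e. norm (D e x)) F
          \<le> L2_set (\<lambda>e. norm ((C (lattice_point \<delta> x) - C x) e) + (w * (1 + norm x powr \<beta>)) * norm (C x e)) F"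
      proof (rule L2_set_mono)
        fix e
        have "D e x = u x *\<^sub>C ((C (lattice_point \<delta> x) - C x) e) + (u x - phase \<theta> x) *\<^sub>C C x e"
          by (simp add: D_def scaleC_diff_left scaleC_diff_right)
        then have "norm (D e x) \<le> cmod (u x) * norm ((C (lattice_point \<delta> x) - C x) e) + cmod (u x - phase \<theta> x) * norm (C x e)"
          by (metis norm_scaleC norm_triangle_ineq)
        also have "\<dots> \<le> 1 * norm ((C (lattice_point \<delta> x) - C x) e) + (w * (1 + norm x powr \<beta>)) * norm (C x e)"
          by (intro add_mono mult_right_mono u1 uw norm_ge_zero)
        finally show "norm (D e x) \<le> norm ((C (lattice_point \<delta> x) - C x) e) + (w * (1 + norm x powr \<beta>)) * norm (C x e)"
          by simp
      qed simp
      also have "\<dots> \<le> L2_set (\<lambda>e. norm ((C (lattice_point \<delta> x) - C x) e)) F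
          + L2_set (\<lambda>e. (w * (1 + norm x powr \<beta>)) * norm (C x e)) F"
        by (rule L2_set_triangle_ineq)
      also have "L2_set (\<lambda>e. (w * (1 + norm x powr \<beta>)) * norm (C x e)) F = w * ((1 + norm x powr \<beta>) * s x)"
        using w0 by (subst L2_set_right_distrib[symmetric]) (simp_all add: s_def mult.assoc)
      finally show ?thesis by (simp add: q_def)
    qed
    have [measurable]: "s \<in> borel_measurable lebesgue"
      unfolding s_def by (rule L2_set_measurable) (rule C_measurable)
    have [measurable]: "q \<in> borel_measurable lebesgue"
      unfolding q_def minus_apply
      by (intro L2_set_measurable borel_measurable_diff C_measurable
          measurable_lattice_point[OF \<delta>(1), of "\<lambda>y. C y _"])
    have [measurable]: "(\<lambda>x::real^'d. norm x powr \<beta>) \<in> borel_measurable lebesgue"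
      by (intro measurable_completion) measurable
    have s0: "s x \<ge> 0" for x by (simp add: s_def L2_set_nonneg)
    have q0: "q x \<ge> 0" for x by (simp add: q_def L2_set_nonneg)
    have "ennreal (\<integral>x. L2_set (\<lambda>e. norm (D e x)) F \<partial>lebesgue) = (\<integral>\<^sup>+x. ennreal (L2_set (\<lambda>e. norm (D e x)) F) \<partial>lebesgue)"
      by (rule nn_integral_eq_integral[symmetric]) (use L2_set_integral_le(1)[OF F(1) Di] in \<open>auto simp: L2_set_nonneg\<close>)
    also have "\<dots> \<le> (\<integral>\<^sup>+x. ennreal (q x) + ennreal w * (ennreal (1 + norm x powr \<beta>) * ennreal (s x)) \<partial>lebesgue)"
    proof (rule nn_integral_mono)
      fix x
      have "ennreal (L2_set (\<lambda>e. norm (D e x)) F) \<le> ennreal (q x + w * ((1 + norm x powr \<beta>) * s x))"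
        by (intro ennreal_leI L2D)
      also have "\<dots> = ennreal (q x) + ennreal w * (ennreal (1 + norm x powr \<beta>) * ennreal (s x))"
        using q0 w0 s0 by (subst ennreal_plus) (simp_all add: ennreal_mult)
      finally show "ennreal (L2_set (\<lambda>e. norm (D e x)) F)
          \<le> ennreal (q x) + ennreal w * (ennreal (1 + norm x powr \<beta>) * ennreal (s x))" .
    qed
    also have "\<dots> = (\<integral>\<^sup>+x. ennreal (q x) \<partial>lebesgue)
        + ennreal w * (\<integral>\<^sup>+x. ennreal (1 + norm x powr \<beta>) * ennreal (s x) \<partial>lebesgue)"
      by (subst nn_integral_add) (simp_all add: nn_integral_cmult)
    also have "\<dots> \<le> ennreal (\<kappa> * \<delta> powr \<gamma>) + ennreal w * ennreal L"
    proof (intro add_mono mult_left_mono)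
      show "(\<integral>\<^sup>+x. ennreal (q x) \<partial>lebesgue) \<le> ennreal (\<kappa> * \<delta> powr \<gamma>)"
        by (rule \<kappa>(2)[OF \<delta>]) (simp only: q_def sum_norm_sq_le_trace_norm[OF E F])
      have "(\<integral>\<^sup>+x. ennreal (1 + norm x powr \<beta>) * ennreal (s x) \<partial>lebesgue)
          \<le> (\<integral>\<^sup>+x. ennreal (1 + norm x powr \<beta>) * trace_norm E (C x) \<partial>lebesgue)"
        by (intro nn_integral_mono mult_left_mono) (simp_all only: s_def sum_norm_sq_le_trace_norm[OF E F] zero_le)
      then show "(\<integral>\<^sup>+x. ennreal (1 + norm x powr \<beta>) * ennreal (s x) \<partial>lebesgue) \<le> ennreal L"
        using L by (rule order_trans)
    qed auto
    also have "\<dots> = ennreal (\<kappa> * \<delta> powr \<gamma> + w * L)"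
      using \<kappa>(1) w0 pos(3) by (simp add: ennreal_mult)
    finally have "(\<integral>x. L2_set (\<lambda>e. norm (D e x)) F \<partial>lebesgue) \<le> \<kappa> * \<delta> powr \<gamma> + w * L"
      using \<kappa>(1) w0 pos(3) by (subst (asm) ennreal_le_iff) simp_all
    then have int: "L2_set (\<lambda>e. norm (\<integral>x. D e x \<partial>lebesgue)) F \<le> \<kappa> * \<delta> powr \<gamma> + w * L"
      using L2_set_integral_le(2)[OF F(1) Di] by (rule order_trans[rotated])
    have "est_bias M X C K N \<delta> \<Delta> \<theta> F
        \<le> L2_set (\<lambda>e. norm (\<integral>x. D e x \<partial>lebesgue)) F"
      unfolding diff norm_scaleR
    proof (rule L2_set_mono)
      show "\<bar>1 / (2 * pi) ^ CARD('d)\<bar> * norm (\<integral>x. D e x \<partial>lebesgue) \<le> norm (\<integral>x. D e x \<partial>lebesgue)" for e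
        using mult_right_mono[OF le1, of "norm (\<integral>x. D e x \<partial>lebesgue)"] by simp
    qed simp
    also note int
    also have "\<kappa> * \<delta> powr \<gamma> + w * L \<le> c0 * (\<delta> powr \<gamma> + \<Delta> powr (- \<beta>))"
    proof -
      have "1 * \<delta> \<le> CARD('d) * \<delta>"
        using \<delta>(1) by (intro mult_right_mono) (simp_all add: Suc_leI)
      then have "\<delta> \<le> 1" using \<delta>(2) by linarith
      \<comment> \<open>As \<gamma> <= 1 and \<delta> <= 1, the errors of order \<delta> are
        absorbed into \<delta>^\<gamma>.\<close>
      then have "\<delta> powr 1 \<le> \<delta> powr \<gamma>"
        using \<delta>(1) \<gamma> by (intro powr_mono') auto
      then have dg: "\<delta> \<le> \<delta> powr \<gamma>" using \<delta>(1) by simp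
      have w_le: "w \<le> (b * d + c * d + c) * (\<delta> powr \<gamma> + \<Delta> powr (- \<beta>))"
      proof -
        have "w = (b * d + c * d) * \<delta> + c * \<Delta> powr (- \<beta>)" by (simp add: w_def algebra_simps)
        also have "\<dots> \<le> (b * d + c * d) * (\<delta> powr \<gamma> + \<Delta> powr (- \<beta>)) + c * (\<delta> powr \<gamma> + \<Delta> powr (- \<beta>))"
          using dg pos d by (intro add_mono mult_left_mono) (auto intro: order_trans[OF dg])
        finally show ?thesis by (simp add: distrib_right)
      qed
      have "w * L \<le> ((b * d + c * d + c) * (\<delta> powr \<gamma> + \<Delta> powr (- \<beta>))) * L"
        by (rule mult_right_mono[OF w_le pos(3)])
      moreover have "\<kappa> * \<delta> powr \<gamma> \<le> \<kappa> * (\<delta> powr \<gamma> + \<Delta> powr (- \<beta>))"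
        using \<kappa>(1) by (intro mult_left_mono) auto
      ultimately show ?thesis by (simp add: c0_def algebra_simps)
    qed
    finally show "est_bias M X C K N \<delta> \<Delta> \<theta> F
       \<le> c0 * (\<delta> powr \<gamma> + \<Delta> powr (- \<beta>))" .
  qed
qed

end

section \<open>The variance\<close>

text \<open>Differences with a fixed grid point are distinct lattice points, and the index sets
  serve all \<phi> at once. Bounds over arbitrary finite lattice sets then apply without regard to
  the base point.\<close>

lemma grid_shift_sum:
  fixes s0 :: "real^'d::finite"
  assumes \<delta>: "\<delta> > 0" and s0: "s0 \<in> grid N \<delta>"
  obtains A B where "finite A" "finite B"
    "\<And>\<phi> :: real^'d \<Rightarrow> real. (\<Sum>t\<in>grid N \<delta>. \<phi> (t - s0)) = (\<Sum>k\<in>A. \<phi> (latt \<delta> k))"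
    "\<And>\<phi> :: real^'d \<Rightarrow> real. (\<Sum>t\<in>grid N \<delta>. \<phi> (s0 - t)) = (\<Sum>k\<in>B. \<phi> (latt \<delta> k))"
proof -
  obtain i where i: "s0 = latt \<delta> i" using s0 by (auto simp: grid_eq)
  have inj: "inj_on (latt \<delta>) (index_box N)" using inj_latt[OF \<delta>] inj_on_subset by blast
  have injA: "inj_on (\<lambda>j l. j l - i l) (index_box N)" and injB: "inj_on (\<lambda>j l. i l - j l) (index_box N)"
    by (auto simp: inj_on_def fun_eq_iff)
  show ?thesis
  proof (rule that[of "(\<lambda>j l. j l - i l) ` index_box N" "(\<lambda>j l. i l - j l) ` index_box N"])
    show "(\<Sum>t\<in>grid N \<delta>. \<phi> (t - s0)) = (\<Sum>k\<in>(\<lambda>j l. j l - i l) ` index_box N. \<phi> (latt \<delta> k))"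
      for \<phi> :: "real^'d \<Rightarrow> real"
      unfolding grid_eq i sum.reindex[OF inj] sum.reindex[OF injA] by (simp add: latt_diff)
    show "(\<Sum>t\<in>grid N \<delta>. \<phi> (s0 - t)) = (\<Sum>k\<in>(\<lambda>j l. i l - j l) ` index_box N. \<phi> (latt \<delta> k))"
      for \<phi> :: "real^'d \<Rightarrow> real"
      unfolding grid_eq i sum.reindex[OF inj] sum.reindex[OF injB] by (simp add: latt_diff)
  qed simp_all
qed

lemma card_close_pairs_le:
  fixes N :: "'d::finite \<Rightarrow> nat"
  assumes \<delta>: "\<delta> > 0" and \<rho>: "\<rho> \<ge> 0"
  shows "\<delta> ^ (2 * CARD('d)) * real (card {p \<in> grid N \<delta> \<times> grid N \<delta>. norm (fst p - snd p) \<le> \<rho>})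
    \<le> volume N \<delta> * (2 * \<rho> + \<delta>) ^ CARD('d)"
proof -
  have "{p \<in> grid N \<delta> \<times> grid N \<delta>. norm (fst p - snd p) \<le> \<rho>}
      = (SIGMA t:grid N \<delta>. {s \<in> grid N \<delta>. norm (t - s) \<le> \<rho>})" by auto
  then have "\<delta> ^ (2 * CARD('d)) * real (card {p \<in> grid N \<delta> \<times> grid N \<delta>. norm (fst p - snd p) \<le> \<rho>})
      = \<delta> ^ CARD('d) * (\<Sum>t\<in>grid N \<delta>. \<delta> ^ CARD('d) * real (card {s \<in> grid N \<delta>. norm (t - s) \<le> \<rho>}))"
    by (simp add: power_mult power2_eq_square mult_2 power_add sum_distrib_left mult_ac)
  also have "\<dots> \<le> \<delta> ^ CARD('d) * (\<Sum>t\<in>grid N \<delta>. (2 * \<rho> + \<delta>) ^ CARD('d))"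
    using \<delta> by (intro mult_left_mono sum_mono card_grid_ball_le \<delta> \<rho>) auto
  also have "\<dots> = volume N \<delta> * (2 * \<rho> + \<delta>) ^ CARD('d)"
    by (simp add: card_grid_measure[OF \<delta>, symmetric])
  finally show ?thesis .
qed

context integrable_cov_process
begin

text \<open>Stationarity moves s' to the origin, which puts t and s on the lattice. The supremum
  over small balls absorbs the rounding of u and v to lattice points, and the supremum over w makes
  the bound independent of t'.\<close>

lemma cum_sum_bounded:
  assumes fo: "fourth_order_cond E M X"
  obtains S4 \<delta>1 where "S4 \<ge> 0" "\<delta>1 > 0" "\<And>\<delta> N t' s'. 0 < \<delta> \<Longrightarrow> \<delta> < \<delta>1 \<Longrightarrow> s' \<in> grid N \<delta> \<Longrightarrow>
    \<delta> ^ (2 * CARD('d)) * (\<Sum>t\<in>grid N \<delta>. \<Sum>s\<in>grid N \<delta>. cmod (cum t s t' s')) \<le> S4"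
proof -
  have stat: "cum (t + \<tau>) (s + \<tau>) (w + \<tau>) (v + \<tau>) = cum t s w v" for t s w v \<tau>
    using fo by (simp add: fourth_order_cond_def)
  define sup where "sup r u v w = (SUP (l1, l2, l3) \<in> ball 0 r \<times> ball 0 r \<times> ball 0 r.
      ennreal (cmod (cum (l1 + u) (l2 + v) (l3 + w) 0)))" for r u v w
  obtain r where r: "r > 0" "(SUP w. \<integral>\<^sup>+u. \<integral>\<^sup>+v. sup r u v w \<partial>lebesgue \<partial>lebesgue) < \<infinity>"
    using fo unfolding fourth_order_cond_def sup_def by blast
  define S4 where "S4 = enn2real (SUP w. \<integral>\<^sup>+u. \<integral>\<^sup>+v. sup r u v w \<partial>lebesgue \<partial>lebesgue)"
  have S4: "(\<integral>\<^sup>+u. \<integral>\<^sup>+v. sup r u v w \<partial>lebesgue \<partial>lebesgue) \<le> ennreal S4" for w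
  proof -
    have "(\<integral>\<^sup>+u. \<integral>\<^sup>+v. sup r u v w \<partial>lebesgue \<partial>lebesgue) \<le> (SUP w. \<integral>\<^sup>+u. \<integral>\<^sup>+v. sup r u v w \<partial>lebesgue \<partial>lebesgue)"
      by (rule SUP_upper) simp
    also have "\<dots> = ennreal S4" using r(2) by (simp add: S4_def)
    finally show ?thesis .
  qed
  show ?thesis
  proof (rule that[of S4 "r / CARD('d)"])
    fix \<delta> :: real and N :: "'d \<Rightarrow> nat" and t' s' :: "real^'d"
    assume \<delta>: "0 < \<delta>" "\<delta> < r / CARD('d)" and s': "s' \<in> grid N \<delta>"
    define w where "w = t' - s'"
    have "CARD('d) * \<delta> < r" using \<delta>(2) by (simp add: pos_less_divide_eq mult.commute)
    then have close: "lattice_point \<delta> x - x \<in> ball 0 r" for x :: "real^'d"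
      using lattice_point_close[OF \<delta>(1), of x] by (simp add: dist_norm norm_minus_commute)
    obtain A where A: "finite A"
      "\<And>\<phi> :: real^'d \<Rightarrow> real. (\<Sum>t\<in>grid N \<delta>. \<phi> (t - s')) = (\<Sum>k\<in>A. \<phi> (latt \<delta> k))"
      using grid_shift_sum[OF \<delta>(1) s'] by metis
    have shift: "cum t s t' s' = cum (t - s') (s - s') w 0" for t s
      using stat[of "t - s'" s' "s - s'" w 0] by (simp add: w_def)
    have "(\<Sum>t\<in>grid N \<delta>. \<Sum>s\<in>grid N \<delta>. cmod (cum t s t' s'))
        = (\<Sum>k\<in>A. \<Sum>j\<in>A. cmod (cum (latt \<delta> k) (latt \<delta> j) w 0))"
      unfolding shift
      by (subst A(2)[of "\<lambda>h. \<Sum>s\<in>grid N \<delta>. cmod (cum h (s - s') w 0)"]) (simp add: A(2)[of "\<lambda>h. cmod (cum _ h w 0)"])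
    then have "ennreal (\<delta> ^ (2 * CARD('d)) * (\<Sum>t\<in>grid N \<delta>. \<Sum>s\<in>grid N \<delta>. cmod (cum t s t' s')))
        = ennreal (\<Sum>k\<in>A. \<delta> ^ CARD('d) * (\<Sum>j\<in>A. \<delta> ^ CARD('d) * cmod (cum (latt \<delta> k) (latt \<delta> j) w 0)))"
      by (simp add: power_mult power2_eq_square mult_2 power_add sum_distrib_left mult_ac)
    also have "\<dots> = (\<Sum>k\<in>A. ennreal (\<delta> ^ CARD('d)) * (\<Sum>j\<in>A. ennreal (\<delta> ^ CARD('d)) * ennreal (cmod (cum (latt \<delta> k) (latt \<delta> j) w 0))))"
      using \<delta>(1) by (simp add: sum_ennreal[symmetric] ennreal_mult sum_nonneg del: sum_ennreal)
    also have "\<dots> \<le> (\<integral>\<^sup>+u. (\<Sum>j\<in>A. ennreal (\<delta> ^ CARD('d)) * ennreal (cmod (cum (latt \<delta> (cell \<delta> u)) (latt \<delta> j) w 0))) \<partial>lebesgue)"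
      by (rule lattice_sum_le_nn_integral[OF \<delta>(1) A(1)])
    also have "\<dots> \<le> (\<integral>\<^sup>+u. \<integral>\<^sup>+v. sup r u v w \<partial>lebesgue \<partial>lebesgue)"
    proof (rule nn_integral_mono)
      fix u :: "real^'d"
      have "(\<Sum>j\<in>A. ennreal (\<delta> ^ CARD('d)) * ennreal (cmod (cum (latt \<delta> (cell \<delta> u)) (latt \<delta> j) w 0)))
          \<le> (\<integral>\<^sup>+v. ennreal (cmod (cum (latt \<delta> (cell \<delta> u)) (latt \<delta> (cell \<delta> v)) w 0)) \<partial>lebesgue)"
        by (rule lattice_sum_le_nn_integral[OF \<delta>(1) A(1)])
      also have "\<dots> \<le> (\<integral>\<^sup>+v. sup r u v w \<partial>lebesgue)"
      proof (rule nn_integral_mono)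
        fix v :: "real^'d"
        show "ennreal (cmod (cum (latt \<delta> (cell \<delta> u)) (latt \<delta> (cell \<delta> v)) w 0)) \<le> sup r u v w"
          unfolding sup_def
          \<comment> \<open>The first two shifts undo the rounding of u and v; w is kept exactly,
            hence the third shift 0.\<close>
          by (rule SUP_upper2[of "(lattice_point \<delta> u - u, lattice_point \<delta> v - v, 0)"])
            (use close r(1) in \<open>simp_all add: lattice_point_def\<close>)
      qed
      finally show "(\<Sum>j\<in>A. ennreal (\<delta> ^ CARD('d)) * ennreal (cmod (cum (latt \<delta> (cell \<delta> u)) (latt \<delta> j) w 0)))
          \<le> (\<integral>\<^sup>+v. sup r u v w \<partial>lebesgue)" .
    qed
    also have "\<dots> \<le> ennreal S4" by (rule S4)
    finally show "\<delta> ^ (2 * CARD('d)) * (\<Sum>t\<in>grid N \<delta>. \<Sum>s\<in>grid N \<delta>. cmod (cum t s t' s')) \<le> S4"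
      by (subst (asm) ennreal_le_iff) (simp_all add: S4_def)
  qed (use r(1) in \<open>simp_all add: S4_def\<close>)
qed

lemma cov_product_sum_le:
  fixes \<phi> :: "real^'d \<Rightarrow> real"
  assumes \<delta>: "\<delta> > 0" and G: "u \<in> grid N \<delta>" "v \<in> grid N \<delta>" and \<phi>: "\<And>h. \<phi> h \<ge> 0" "B \<ge> 0"
    and B: "\<And>S. finite S \<Longrightarrow> (\<Sum>k\<in>S. \<delta> ^ CARD('d) * \<phi> (latt \<delta> k)) \<le> B"
  shows "\<delta> ^ (2 * CARD('d)) * (\<Sum>x\<in>grid N \<delta>. \<Sum>y\<in>grid N \<delta>. \<phi> (u - x) * \<phi> (y - v)) \<le> B * B"
proof -
  have "\<delta> ^ CARD('d) * (\<Sum>x\<in>grid N \<delta>. \<phi> (u - x)) \<le> B"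
    using grid_shift_sum[OF \<delta> G(1)] B by (metis sum_distrib_left)
  moreover have "\<delta> ^ CARD('d) * (\<Sum>y\<in>grid N \<delta>. \<phi> (y - v)) \<le> B"
    using grid_shift_sum[OF \<delta> G(2)] B by (metis sum_distrib_left)
  ultimately have "(\<delta> ^ CARD('d) * (\<Sum>x\<in>grid N \<delta>. \<phi> (u - x))) * (\<delta> ^ CARD('d) * (\<Sum>y\<in>grid N \<delta>. \<phi> (y - v))) \<le> B * B"
    using \<delta> \<phi> by (intro mult_mono) (auto intro!: mult_nonneg_nonneg sum_nonneg)
  moreover have "(\<Sum>x\<in>grid N \<delta>. \<Sum>y\<in>grid N \<delta>. \<phi> (u - x) * \<phi> (y - v))
      = (\<Sum>x\<in>grid N \<delta>. \<phi> (u - x)) * (\<Sum>y\<in>grid N \<delta>. \<phi> (y - v))"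
    by (rule sum_product[symmetric])
  moreover have "\<delta> ^ (2 * CARD('d)) = \<delta> ^ CARD('d) * \<delta> ^ CARD('d)"
    by (simp add: mult_2 power_add)
  ultimately show ?thesis
    by (simp only: mult_ac)
qed

text \<open>For one pair held fixed, the sum over the other pair is enlarged to the full grid in
  both variables and stays of order \<delta>^(-2 d). Only the number of choices of the fixed pair
  survives.\<close>

lemma quad_cov_sum_bounded:
  assumes fo: "fourth_order_cond E M X"
  obtains B \<delta>1 where "B \<ge> 0" "\<delta>1 > 0" "\<And>\<delta> N P. 0 < \<delta> \<Longrightarrow> \<delta> < \<delta>1 \<Longrightarrow> P \<subseteq> grid N \<delta> \<times> grid N \<delta> \<Longrightarrow>
    \<delta> ^ (2 * CARD('d)) * (\<Sum>p\<in>P. \<Sum>q\<in>P. cmod (quad_cov p q)) \<le> B * real (card P)"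
proof -
  obtain S4 \<delta>0 where S4: "S4 \<ge> 0" "\<delta>0 > 0" "\<And>\<delta> N t' s'. 0 < \<delta> \<Longrightarrow> \<delta> < \<delta>0 \<Longrightarrow> s' \<in> grid N \<delta> \<Longrightarrow>
    \<delta> ^ (2 * CARD('d)) * (\<Sum>t\<in>grid N \<delta>. \<Sum>s\<in>grid N \<delta>. cmod (cum t s t' s')) \<le> S4"
    using cum_sum_bounded[OF fo] by blast
  have "ennreal (cmod (tr_cov y) - cmod (tr_cov h)) \<le> trace_norm E (C y - C h)" for y h
    using norm_tr_cov_diff_le[of y h] norm_triangle_ineq2[of "tr_cov y" "tr_cov h"]
    by (meson ennreal_leI order_trans)
  then obtain B1 where B1: "B1 \<ge> 0" "\<And>(\<delta>::real) S. 0 < \<delta> \<Longrightarrow> CARD('d) * \<delta> < 1 \<Longrightarrow> finite S \<Longrightarrow>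
     (\<Sum>k\<in>S. \<delta> ^ CARD('d) * cmod (tr_cov (latt \<delta> k))) \<le> B1"
    using lattice_sum_bounded[of "\<lambda>h. cmod (tr_cov h)"] norm_tr_cov_le by auto
  obtain B2 where B2: "B2 \<ge> 0" "\<And>(\<delta>::real) S. 0 < \<delta> \<Longrightarrow> CARD('d) * \<delta> < 1 \<Longrightarrow> finite S \<Longrightarrow>
     (\<Sum>k\<in>S. \<delta> ^ CARD('d) * hs_cov (latt \<delta> k)) \<le> B2"
    using lattice_sum_bounded[of hs_cov] hs_cov_nonneg hs_cov_le_trace_norm hs_cov_diff_le by auto
  show ?thesis
  proof (rule that[of "S4 + B1 * B1 + B2 * B2" "min \<delta>0 (1 / CARD('d))"])
    fix \<delta> :: real and N :: "'d \<Rightarrow> nat" and P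
    assume \<delta>: "0 < \<delta>" "\<delta> < min \<delta>0 (1 / CARD('d))" and P: "P \<subseteq> grid N \<delta> \<times> grid N \<delta>"
    have \<delta>1: "CARD('d) * \<delta> < 1" using \<delta>(2) by (simp add: pos_less_divide_eq mult.commute)
    let ?G = "grid N \<delta>" and ?v = "\<delta> ^ (2 * CARD('d))"
    have fin: "finite P" using P by (rule finite_subset) simp
    have v: "?v \<ge> 0" using \<delta>(1) by simp
    have sumP: "(\<Sum>p\<in>P. g p) \<le> (\<Sum>t\<in>?G. \<Sum>s\<in>?G. g (t, s))" if "\<And>p. g p \<ge> 0" for g :: "_ \<Rightarrow> real"
    proof -
      have "(\<Sum>t\<in>?G. \<Sum>s\<in>?G. g (t, s)) = sum g (?G \<times> ?G)"
        by (simp add: sum.cartesian_product split_def)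
      then show ?thesis using sum_mono2[OF _ P, of g] that by simp
    qed
    have "?v * (\<Sum>p\<in>P. \<Sum>q\<in>P. cmod (quad_cov p q))
        \<le> ?v * ((\<Sum>p\<in>P. \<Sum>q\<in>P. cmod (cum (fst p) (snd p) (fst q) (snd q)))
          + (\<Sum>p\<in>P. \<Sum>q\<in>P. cmod (tr_cov (fst p - fst q)) * cmod (tr_cov (snd q - snd p)))
          + (\<Sum>p\<in>P. \<Sum>q\<in>P. hs_cov (fst p - snd q) * hs_cov (fst q - snd p)))"
      unfolding sum.distrib[symmetric]
    proof (intro mult_left_mono[OF _ v] sum_mono)
      fix p q
      show "cmod (quad_cov p q) \<le> cmod (cum (fst p) (snd p) (fst q) (snd q))
          + cmod (tr_cov (fst p - fst q)) * cmod (tr_cov (snd q - snd p))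
          + hs_cov (fst p - snd q) * hs_cov (fst q - snd p)"
        unfolding quad_cov_def
        by (intro order_trans[OF norm_triangle_ineq] add_mono has_sum_hs_inner_C(2)) (simp_all add: norm_mult)
    qed
    also have "\<dots> = (\<Sum>q\<in>P. ?v * (\<Sum>p\<in>P. cmod (cum (fst p) (snd p) (fst q) (snd q))))
          + (\<Sum>p\<in>P. ?v * (\<Sum>q\<in>P. cmod (tr_cov (fst p - fst q)) * cmod (tr_cov (snd q - snd p))))
          + (\<Sum>p\<in>P. ?v * (\<Sum>q\<in>P. hs_cov (fst p - snd q) * hs_cov (fst q - snd p)))"
      \<comment> \<open>The cumulant sum is reordered because \<open>cum_sum_bounded\<close> fixes
        its last two arguments, that is, the pair q.\<close>
      by (subst (1) sum.swap) (simp only: distrib_left sum_distrib_left)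
    also have "\<dots> \<le> (\<Sum>q\<in>P. S4) + (\<Sum>p\<in>P. B1 * B1) + (\<Sum>p\<in>P. B2 * B2)"
    proof (intro add_mono sum_mono)
      fix p assume "p \<in> P"
      then have p: "fst p \<in> ?G" "snd p \<in> ?G" using P by auto
      have "?v * (\<Sum>q\<in>P. cmod (cum (fst q) (snd q) (fst p) (snd p)))
          \<le> ?v * (\<Sum>t\<in>?G. \<Sum>s\<in>?G. cmod (cum t s (fst p) (snd p)))"
        using sumP[of "\<lambda>q. cmod (cum (fst q) (snd q) (fst p) (snd p))"] v by (intro mult_left_mono) auto
      also have "\<dots> \<le> S4" by (rule S4(3)) (use \<delta> p in auto)
      finally show "?v * (\<Sum>q\<in>P. cmod (cum (fst q) (snd q) (fst p) (snd p))) \<le> S4" .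
      have "?v * (\<Sum>q\<in>P. cmod (tr_cov (fst p - fst q)) * cmod (tr_cov (snd q - snd p)))
          \<le> ?v * (\<Sum>x\<in>?G. \<Sum>y\<in>?G. cmod (tr_cov (fst p - x)) * cmod (tr_cov (y - snd p)))"
        using sumP[of "\<lambda>q. cmod (tr_cov (fst p - fst q)) * cmod (tr_cov (snd q - snd p))"] v
        by (intro mult_left_mono) auto
      also have "\<dots> \<le> B1 * B1"
        by (rule cov_product_sum_le[OF \<delta>(1) p]) (use B1 \<delta> \<delta>1 in auto)
      finally show "?v * (\<Sum>q\<in>P. cmod (tr_cov (fst p - fst q)) * cmod (tr_cov (snd q - snd p))) \<le> B1 * B1" .
      have "?v * (\<Sum>q\<in>P. hs_cov (fst p - snd q) * hs_cov (fst q - snd p))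
          \<le> ?v * (\<Sum>y\<in>?G. \<Sum>x\<in>?G. hs_cov (fst p - x) * hs_cov (y - snd p))"
        using sumP[of "\<lambda>q. hs_cov (fst p - snd q) * hs_cov (fst q - snd p)"] v
        by (intro mult_left_mono) (auto simp: hs_cov_nonneg)
      also have "\<dots> = ?v * (\<Sum>x\<in>?G. \<Sum>y\<in>?G. hs_cov (fst p - x) * hs_cov (y - snd p))"
        by (subst sum.swap) simp
      also have "\<dots> \<le> B2 * B2"
        by (rule cov_product_sum_le[OF \<delta>(1) p]) (use B2 \<delta> \<delta>1 hs_cov_nonneg in auto)
      finally show "?v * (\<Sum>q\<in>P. hs_cov (fst p - snd q) * hs_cov (fst q - snd p)) \<le> B2 * B2" .
    qed
    also have "\<dots> = (S4 + B1 * B1 + B2 * B2) * real (card P)"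
      by (simp add: algebra_simps)
    finally show "?v * (\<Sum>p\<in>P. \<Sum>q\<in>P. cmod (quad_cov p q)) \<le> (S4 + B1 * B1 + B2 * B2) * real (card P)" .
  qed (use S4(1,2) B1(1) B2(1) in auto)
qed

text \<open>Every weight is at most A = \<delta>^(2 d) / V, and only pairs within \<Delta> R carry
  weight. There are at most about \<delta>^(-2 d) V \<Delta>^d of them, so A^2 \<delta>^(-2 d) times
  their number is of order \<Delta>^d / V.\<close>

lemma variance_bound:
  assumes fo: "fourth_order_cond E M X"
    and K: "\<And>u. \<bar>K u\<bar> \<le> 1" "\<And>u. K u \<noteq> 0 \<Longrightarrow> norm u \<le> R" "R > 0"
  obtains c1 \<delta>1 where "c1 \<ge> 0" "\<delta>1 > 0" "\<And>\<delta> N \<Delta> \<theta> F. 0 < \<delta> \<Longrightarrow> \<delta> < \<delta>1 \<Longrightarrow> \<delta> \<le> \<Delta> \<Longrightarrow>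
     0 < volume N \<delta> \<Longrightarrow>
     (\<And>h. K (h /\<^sub>R \<Delta>) \<noteq> 0 \<Longrightarrow>
        volume N \<delta> \<le> 2 ^ CARD('d) * overlap N \<delta> h) \<Longrightarrow>
     finite F \<Longrightarrow> F \<subseteq> E \<Longrightarrow>
     est_variance M X K N \<delta> \<Delta> \<theta> F
       \<le> c1 * (\<Delta> ^ CARD('d) / volume N \<delta>)"
proof -
  obtain B \<delta>1 where B: "B \<ge> 0" "\<delta>1 > 0" "\<And>\<delta> N P. 0 < \<delta> \<Longrightarrow> \<delta> < \<delta>1 \<Longrightarrow> P \<subseteq> grid N \<delta> \<times> grid N \<delta> \<Longrightarrow>
    \<delta> ^ (2 * CARD('d)) * (\<Sum>p\<in>P. \<Sum>q\<in>P. cmod (quad_cov p q)) \<le> B * real (card P)"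
    using quad_cov_sum_bounded[OF fo] by blast
  show ?thesis
  proof (rule that[of "B * (2 * R + 1) ^ CARD('d)" \<delta>1])
    fix \<delta> :: real and N :: "'d \<Rightarrow> nat" and \<Delta> and \<theta> :: "real^'d" and F
    assume \<delta>: "0 < \<delta>" "\<delta> < \<delta>1" "\<delta> \<le> \<Delta>" and V0: "0 < volume N \<delta>"
      and shift: "\<And>h. K (h /\<^sub>R \<Delta>) \<noteq> 0 \<Longrightarrow>
        volume N \<delta> \<le> 2 ^ CARD('d) * overlap N \<delta> h"
      and F: "finite F" "F \<subseteq> E"
    define V where "V = volume N \<delta>"
    define G where "G = grid N \<delta> \<times> grid N \<delta>"
    define P where "P = {p \<in> G. norm (fst p - snd p) \<le> \<Delta> * R}"
    define a where "a p = est_coef K N \<delta> \<Delta> \<theta> (fst p - snd p)" for p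
    define A where "A = \<delta> ^ (2 * CARD('d)) / V"
    have V: "V > 0" using V0 by (simp add: V_def)
    have A0: "A \<ge> 0" using V \<delta> by (simp add: A_def)
    have \<Delta>: "\<Delta> > 0" using \<delta> by simp
    have PG: "P \<subseteq> G" "finite G" "finite P" by (auto simp: P_def G_def)
    have coef0: "a p = 0" if "p \<in> G - P" for p
    proof -
      have "norm ((fst p - snd p) /\<^sub>R \<Delta>) > R"
      proof -
        have "R < norm (fst p - snd p) / \<Delta>"
          using that \<Delta> by (simp add: P_def not_le pos_less_divide_eq mult.commute)
        also have "\<dots> = norm ((fst p - snd p) /\<^sub>R \<Delta>)"
          using \<Delta> by (simp only: norm_scaleR) (simp add: divide_inverse mult.commute)
        finally show ?thesis .
      qed
      then have "K ((fst p - snd p) /\<^sub>R \<Delta>) = 0" using K(2) by fastforce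
      then show ?thesis by (simp add: a_def est_coef_def)
    qed
    have coef: "cmod (a p) \<le> A" for p
    proof (cases "K ((fst p - snd p) /\<^sub>R \<Delta>) = 0")
      case True
      then show ?thesis using A0 by (simp add: a_def est_coef_def)
    next
      case False
      let ?h = "fst p - snd p"
      define m where "m = measure lebesgue (region N \<delta> \<inter> (\<lambda>x. x - ?h) ` region N \<delta>)"
      have Vm: "V \<le> 2 ^ CARD('d) * m" unfolding V_def m_def by (rule shift[OF False])
      then have m: "m > 0" using V by (smt (verit) mult_nonneg_nonpos zero_le_power)
      have "cmod (a p) = \<delta> ^ (2 * CARD('d)) / (2 * pi) ^ CARD('d) * (\<bar>K (?h /\<^sub>R \<Delta>)\<bar> / m)"
        using \<delta>(1) m by (simp add: a_def est_coef_def m_def[symmetric] norm_mult norm_divide norm_power del: of_real_power)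
      \<comment> \<open>From (2 pi)^d only 2^d is kept, exactly what compensates the loss in the
        overlap bound.\<close>
      also have "\<dots> \<le> \<delta> ^ (2 * CARD('d)) / 2 ^ CARD('d) * (1 / m)"
        using \<delta>(1) m K(1) pi_gt3
        by (intro mult_mono divide_left_mono divide_right_mono power_mono mult_pos_pos) auto
      also have "\<dots> = \<delta> ^ (2 * CARD('d)) / (2 ^ CARD('d) * m)" by simp
      also have "\<dots> \<le> A"
        unfolding A_def using \<delta>(1) V m Vm by (intro divide_left_mono mult_pos_pos) auto
      finally show ?thesis .
    qed
    have "est_variance M X K N \<delta> \<Delta> \<theta> F
        = (\<Sum>e\<in>F. \<integral>\<omega>. (norm (\<Sum>p\<in>G. a p *\<^sub>C (tensor (X (fst p) \<omega>) (X (snd p) \<omega>) e - C (fst p - snd p) e)))\<^sup>2 \<partial>M)"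
      by (simp add: spec_estimator_eq mean_spec_estimator G_def a_def scaleC_diff_right sum_subtractf)
    also have "\<dots> \<le> (\<Sum>p\<in>G. \<Sum>q\<in>G. cmod (a p) * cmod (a q) * cmod (quad_cov p q))"
      by (rule variance_quadratic_form(2)[OF PG(2) F])
    also have "\<dots> = (\<Sum>p\<in>P. \<Sum>q\<in>P. cmod (a p) * cmod (a q) * cmod (quad_cov p q))"
    proof -
      have "(\<Sum>q\<in>G. cmod (a p) * cmod (a q) * cmod (quad_cov p q)) = (\<Sum>q\<in>P. cmod (a p) * cmod (a q) * cmod (quad_cov p q))" for p
        by (rule sum.mono_neutral_right) (use PG coef0 in auto)
      moreover have "(\<Sum>p\<in>G. \<Sum>q\<in>P. cmod (a p) * cmod (a q) * cmod (quad_cov p q)) = (\<Sum>p\<in>P. \<Sum>q\<in>P. cmod (a p) * cmod (a q) * cmod (quad_cov p q))"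
        by (rule sum.mono_neutral_right) (use PG coef0 in auto)
      ultimately show ?thesis by simp
    qed
    also have "\<dots> \<le> (\<Sum>p\<in>P. \<Sum>q\<in>P. A * A * cmod (quad_cov p q))"
      by (intro sum_mono mult_right_mono mult_mono coef A0) auto
    also have "\<dots> = (A / V) * (\<delta> ^ (2 * CARD('d)) * (\<Sum>p\<in>P. \<Sum>q\<in>P. cmod (quad_cov p q)))"
      by (simp add: sum_distrib_left A_def mult.assoc)
    also have "\<dots> \<le> (A / V) * (B * real (card P))"
      using A0 V PG(1) by (intro mult_left_mono B(3) \<delta>) (auto simp: G_def)
    also have "\<dots> = B / (V * V) * (\<delta> ^ (2 * CARD('d)) * real (card P))"
      by (simp add: A_def)
    also have "\<dots> \<le> B / (V * V) * (V * (2 * (\<Delta> * R) + \<delta>) ^ CARD('d))"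
      using B(1) V card_close_pairs_le[OF \<delta>(1), of "\<Delta> * R" N] \<Delta> K(3)
      by (intro mult_left_mono) (auto simp: P_def G_def V_def)
    also have "\<dots> \<le> B / (V * V) * (V * ((2 * R + 1) * \<Delta>) ^ CARD('d))"
      using B(1) V \<delta> \<Delta> K(3) by (intro mult_left_mono power_mono) (auto simp: algebra_simps)
    also have "\<dots> = B * (2 * R + 1) ^ CARD('d) * (\<Delta> ^ CARD('d) / V)"
      using V by (simp add: power_mult_distrib)
    finally show "est_variance M X K N \<delta> \<Delta> \<theta> F
        \<le> B * (2 * R + 1) ^ CARD('d) * (\<Delta> ^ CARD('d) / volume N \<delta>)"
      by (simp add: V_def)
  qed (use B K(3) in auto)
qed

end

section \<open>Geometry of the sampling region\<close>

text \<open>T - T is closed, so it contains lags with some |m l| equal to \<open>N l\<close>, where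
  the overlap is zero. They are excluded because {K > 0} is open: a slight dilation of such a lag
  would still have to lie in T - T.\<close>

lemma kernel_lag_support:
  fixes K :: "real^'d \<Rightarrow> real"
  assumes K: "continuous_on UNIV K" "\<And>u. 0 \<le> K u" and \<delta>: "\<delta> > 0" and \<Delta>: "\<Delta> > 0" and N: "\<And>l. N l \<ge> 1"
    and sub: "(\<lambda>t. \<Delta> *\<^sub>R t) ` {t. K t > 0} \<subseteq> set_diff (region N \<delta>) (region N \<delta>)"
    and m: "m \<notin> lag_box N"
  shows "K (latt \<delta> m /\<^sub>R \<Delta>) = 0"
proof (rule ccontr)
  define v where "v = latt \<delta> m /\<^sub>R \<Delta>"
  assume "K (latt \<delta> m /\<^sub>R \<Delta>) \<noteq> 0"
  then have "v \<in> {u. 0 < K u}" using K(2)[of v] by (simp add: v_def order_less_le)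
  moreover have "open {u. 0 < K u}"
    using K(1) by (intro open_Collect_less) auto
  ultimately obtain r where r: "r > 0" "ball v r \<subseteq> {u. 0 < K u}"
    unfolding open_contains_ball by blast
  \<comment> \<open>Small enough that (1 + \<eta>) v stays in the ball around v; adding 1 covers v =
    0.\<close>
  define \<eta> where "\<eta> = r / (2 * (norm v + 1))"
  have \<eta>: "\<eta> > 0" using r(1) by (simp add: \<eta>_def add_nonneg_pos)
  have "\<eta> * norm v \<le> r / 2"
    using r(1) by (simp add: \<eta>_def divide_simps add_nonneg_pos)
  then have "(1 + \<eta>) *\<^sub>R v \<in> ball v r"
    using r(1) \<eta> by (simp add: dist_norm scaleR_add_left)
  then have "\<Delta> *\<^sub>R ((1 + \<eta>) *\<^sub>R v) \<in> set_diff (region N \<delta>) (region N \<delta>)"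
    using r(2) sub by blast
  moreover have "\<Delta> *\<^sub>R ((1 + \<eta>) *\<^sub>R v) = (1 + \<eta>) *\<^sub>R latt \<delta> m"
    using \<Delta> by (simp add: v_def)
  ultimately obtain a b where ab: "a \<in> region N \<delta>" "b \<in> region N \<delta>" "(1 + \<eta>) *\<^sub>R latt \<delta> m = a - b"
    by (auto simp: set_diff_def)
  obtain l where l: "\<bar>m l\<bar> \<ge> int (N l)" using m by (auto simp: lag_box_def not_less)
  have "(1 + \<eta>) * (\<delta> * real_of_int (m l)) = a $ l - b $ l"
    using arg_cong[OF ab(3), of "\<lambda>x. x $ l"] by (simp add: latt_def)
  moreover have "\<bar>a $ l - b $ l\<bar> \<le> real (N l) * \<delta>"
    using ab(1,2) by (auto simp: region_def abs_le_iff dest!: spec[of _ l])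
  ultimately have "\<bar>(1 + \<eta>) * (\<delta> * real_of_int (m l))\<bar> \<le> real (N l) * \<delta>" by simp
  then have "((1 + \<eta>) * \<bar>real_of_int (m l)\<bar>) * \<delta> \<le> real (N l) * \<delta>"
    using \<eta> \<delta> by (simp add: abs_mult mult_ac)
  then have "(1 + \<eta>) * \<bar>real_of_int (m l)\<bar> \<le> real (N l)" using \<delta> by simp
  moreover have "real (N l) \<le> \<bar>real_of_int (m l)\<bar>"
    using l by (metis of_int_abs of_int_le_iff of_int_of_nat_eq)
  \<comment> \<open>This makes m l nonzero, so that the dilation strictly exceeds the side
    length.\<close>
  moreover have "real (N l) \<ge> 1" using N[of l] by simp
  ultimately have "\<eta> * \<bar>real_of_int (m l)\<bar> \<le> 0" "\<bar>real_of_int (m l)\<bar> > 0"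
    by (auto simp: distrib_right)
  then show False using \<eta> by (simp add: mult_le_0_iff)
qed

text \<open>Boundedness of S makes the real supremum in the distance a true upper bound of
  \<open>infdist\<close>.\<close>

lemma norm_le_of_hausdorff:
  fixes S T :: "'a::real_normed_vector set"
  assumes S: "bounded S" "x \<in> S" and T: "T \<noteq> {}" "\<And>y. y \<in> T \<Longrightarrow> norm y \<le> R"
  shows "norm x \<le> hausdorff_dist S T + R"
proof -
  obtain y0 where y0: "y0 \<in> T" using T(1) by auto
  obtain b where b: "\<And>z. z \<in> S \<Longrightarrow> norm z \<le> b" using S(1) by (auto simp: bounded_iff)
  have "bdd_above ((\<lambda>x. infdist x T) ` S)"
  proof (rule bdd_aboveI2)
    fix z assume "z \<in> S"
    have "infdist z T \<le> dist z y0" by (rule infdist_le[OF y0])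
    also have "\<dots> \<le> norm z + norm y0" by (simp add: dist_norm norm_triangle_ineq4)
    finally show "infdist z T \<le> b + norm y0" using b[OF \<open>z \<in> S\<close>] by simp
  qed
  then have "infdist x T \<le> (SUP x\<in>S. infdist x T)" using S(2) by (rule cSUP_upper[rotated])
  then have "infdist x T \<le> hausdorff_dist S T" by (simp add: hausdorff_dist_def)
  moreover have "norm x - R \<le> infdist x T"
    unfolding infdist_def using T
    by (auto intro!: cINF_greatest simp: dist_norm) (smt (verit) norm_triangle_ineq2)
  ultimately show ?thesis by simp
qed

text \<open>The limit set is bounded, so the far corner of the rescaled box eventually lies in a
  fixed ball; its coordinates are the rescaled side lengths.\<close>

lemma region_sides_bounded:
  fixes N :: "nat \<Rightarrow> 'd::finite \<Rightarrow> nat"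
  assumes "sampling_cond N \<delta>"
  obtains B where "B \<ge> 1" "\<forall>\<^sub>F n in sequentially. \<forall>l.
    real (N n l) * \<delta> n \<le> B * volume (N n) (\<delta> n) powr (1 / CARD('d))"
proof -
  define V where "V n = volume (N n) (\<delta> n)" for n
  have \<delta>: "\<delta> n > 0" for n using assms by (simp add: sampling_cond_def)
  have "filterlim V at_top sequentially"
    using assms by (simp add: sampling_cond_def V_def[abs_def])
  then have V: "\<forall>\<^sub>F n in sequentially. V n > 0" by (simp add: filterlim_at_top_dense)
  obtain T :: "(real^'d) set" where T: "bounded T" "interior T \<noteq> {}"
    "(\<lambda>n. hausdorff_dist ((\<lambda>x. x /\<^sub>R (V n powr (1 / CARD('d)))) ` region (N n) (\<delta> n)) T) \<longlonglongrightarrow> 0"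
    using assms unfolding sampling_cond_def V_def by blast
  then have "T \<noteq> {}" by auto
  obtain R where R: "\<And>y. y \<in> T \<Longrightarrow> norm y \<le> R" using T(1) by (auto simp: bounded_iff)
  have "\<forall>\<^sub>F n in sequentially. hausdorff_dist ((\<lambda>x. x /\<^sub>R (V n powr (1 / CARD('d)))) ` region (N n) (\<delta> n)) T < 1"
    using T(3) by (rule order_tendstoD) simp
  then have "\<forall>\<^sub>F n in sequentially. \<forall>l. real (N n l) * \<delta> n \<le> max 1 (1 + R) * V n powr (1 / CARD('d))"
    using V
  proof eventually_elim
    case (elim n)
    define s where "s = V n powr (1 / CARD('d))"
    have s: "s > 0" using elim by (simp add: s_def)
    let ?S = "(\<lambda>x. x /\<^sub>R s) ` region (N n) (\<delta> n)"
    define x :: "real^'d" where "x = (\<chi> l. real (N n l) * \<delta> n)"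
    have "x \<in> region (N n) (\<delta> n)" using \<delta>[of n] by (simp add: x_def region_def)
    have "region (N n) (\<delta> n) = cbox 0 x"
      by (auto simp: region_def mem_box_cart x_def)
    then have "bounded ?S"
      by (simp add: bounded_scaling)
    then have "norm (x /\<^sub>R s) \<le> hausdorff_dist ?S T + R"
      using \<open>x \<in> region (N n) (\<delta> n)\<close> by (intro norm_le_of_hausdorff \<open>T \<noteq> {}\<close> R) auto
    also have "\<dots> \<le> max 1 (1 + R)" using elim(1) by (simp add: s_def)
    also have "norm (x /\<^sub>R s) = norm x / s"
      using s by (simp add: divide_inverse mult.commute)
    finally have "norm x \<le> max 1 (1 + R) * s"
      using s by (simp add: pos_divide_le_eq)
    then show ?case
      using component_le_norm_cart[of x] \<delta>[of n] by (auto simp: x_def s_def intro: order_trans)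
  qed
  then show ?thesis using that[of "max 1 (1 + R)"] by (simp add: V_def)
qed

text \<open>The side lengths have product \<open>|T|\<close>, so an upper bound of the order \<open>|T|\<^sup>1\<^sup>/\<^sup>d\<close> on all of them
  forces a lower bound of the same order.\<close>

lemma region_overlap:
  fixes N :: "nat \<Rightarrow> 'd::finite \<Rightarrow> nat"
  assumes samp: "sampling_cond N \<delta>" and \<Delta>: "\<And>n. \<Delta> n > 0" and R: "R > 0"
    and lim: "(\<lambda>n. \<Delta> n ^ CARD('d) / volume (N n) (\<delta> n)) \<longlonglongrightarrow> 0"
  shows "\<forall>\<^sub>F n in sequentially. \<forall>h. norm h \<le> \<Delta> n * R \<longrightarrow>
    volume (N n) (\<delta> n)
      \<le> 2 ^ CARD('d) * overlap (N n) (\<delta> n) h"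
proof -
  define V where "V n = volume (N n) (\<delta> n)" for n
  define d where "d = CARD('d)"
  have d: "d \<ge> 1" by (simp add: d_def Suc_leI)
  have \<delta>: "\<delta> n > 0" for n using samp by (simp add: sampling_cond_def)
  have "filterlim V at_top sequentially"
    using samp by (simp add: sampling_cond_def V_def[abs_def])
  then have V: "\<forall>\<^sub>F n in sequentially. V n > 0" by (simp add: filterlim_at_top_dense)
  obtain B where B: "B \<ge> 1" "\<forall>\<^sub>F n in sequentially. \<forall>l. real (N n l) * \<delta> n \<le> B * V n powr (1 / d)"
    using region_sides_bounded[OF samp] unfolding V_def d_def by blast
  \<comment> \<open>Chosen so that \<Delta> < \<eta> s and s <= a l * B^(d - 1) give |h l| <=
    \<Delta> R <= a l / 2.\<close>
  define \<eta> where "\<eta> = 1 / (2 * R * B ^ (d - 1))"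
  have \<eta>: "\<eta> > 0" using R B(1) by (simp add: \<eta>_def)
  have "\<forall>\<^sub>F n in sequentially. \<Delta> n ^ d / V n < \<eta> ^ d"
    using lim unfolding V_def d_def by (rule order_tendstoD) (use \<eta> in simp)
  then show ?thesis using V B(2)
  proof eventually_elim
    case (elim n)
    define s where "s = V n powr (1 / d)"
    define a where "a l = real (N n l) * \<delta> n" for l
    have s: "s > 0" using elim by (simp add: s_def)
    have sd: "s ^ d = V n"
      using elim d s unfolding s_def by (subst powr_realpow[symmetric]) (auto simp: powr_powr)
    have a0: "a l \<ge> 0" "a l \<le> B * s" for l using \<delta>[of n] elim by (auto simp: a_def s_def)
    have Va: "V n = (\<Prod>l\<in>UNIV. a l)" by (simp add: V_def measure_region[OF \<delta>] a_def)
    have low: "s \<le> a l * B ^ (d - 1)" for l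
    proof -
      have "s * s ^ (d - 1) = V n" using sd d by (metis Suc_diff_1 Suc_le_lessD One_nat_def power_Suc)
      also have "\<dots> = a l * (\<Prod>j\<in>UNIV - {l}. a j)"
        unfolding Va by (rule prod.remove) auto
      also have "\<dots> \<le> a l * (\<Prod>j\<in>UNIV - {l}. B * s)"
        by (intro mult_left_mono prod_mono) (auto simp: a0)
      also have "\<dots> = (a l * B ^ (d - 1)) * s ^ (d - 1)"
        by (simp add: d_def power_mult_distrib)
      finally show ?thesis using s by simp
    qed
    \<comment> \<open>Since s^d is the volume, smallness of \<Delta>^d / |T| compares \<Delta> with
      the linear size s.\<close>
    have "(\<Delta> n) ^ d < (\<eta> * s) ^ d"
      using elim(1) elim(2) by (simp add: power_mult_distrib sd pos_divide_less_eq)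
    then have \<Delta>s: "\<Delta> n < \<eta> * s"
      by (rule power_less_imp_less_base) (use \<eta> s in simp)
    show ?case
    proof (intro allI impI)
      fix h :: "real^'d" assume h: "norm h \<le> \<Delta> n * R"
      have half: "a l / 2 \<le> a l - \<bar>h $ l\<bar>" for l
      proof -
        have "\<bar>h $ l\<bar> \<le> \<Delta> n * R" using h component_le_norm_cart[of h l] by simp
        also have "\<dots> \<le> (\<eta> * s) * R" using \<Delta>s R by (intro mult_right_mono) auto
        also have "\<dots> \<le> (\<eta> * (a l * B ^ (d - 1))) * R"
          using low[of l] \<eta> R by (intro mult_right_mono mult_left_mono) auto
        also have "\<dots> = a l / 2" using R B(1) by (simp add: \<eta>_def)
        finally show ?thesis by simp
      qed
      have "V n = 2 ^ d * (\<Prod>l\<in>UNIV. a l / 2)"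
        by (simp add: Va prod_dividef d_def)
      also have "\<dots> \<le> 2 ^ d * (\<Prod>l\<in>UNIV. max 0 (real (N n l) * \<delta> n - \<bar>h $ l\<bar>))"
        using half a0(1) by (intro mult_left_mono prod_mono) (auto simp: a_def le_max_iff_disj)
      finally show "volume (N n) (\<delta> n)
          \<le> 2 ^ CARD('d) * overlap (N n) (\<delta> n) h"
        by (simp add: measure_region_shift[OF \<delta>] V_def d_def)
    qed
  qed
qed

section \<open>Convergence rates\<close>

text \<open>Monotone convergence along initial segments of an enumeration. Taking images of initial
  segments treats finite and infinite index sets alike.\<close>

lemma nn_integral_infsum_le:
  fixes f :: "'e \<Rightarrow> 'a \<Rightarrow> ennreal"
  assumes E: "countable E" and f: "\<And>e. e \<in> E \<Longrightarrow> f e \<in> borel_measurable M"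
    and B: "\<And>F. finite F \<Longrightarrow> F \<subseteq> E \<Longrightarrow> (\<Sum>e\<in>F. \<integral>\<^sup>+x. f e x \<partial>M) \<le> B"
  shows "(\<integral>\<^sup>+x. (\<Sum>\<^sub>\<infinity>e\<in>E. f e x) \<partial>M) \<le> B"
proof (cases "E = {}")
  case False
  define I where "I n = from_nat_into E ` {..<n}" for n :: nat
  have I: "finite (I n)" "I n \<subseteq> E" for n
    using from_nat_into[OF False] by (auto simp: I_def)
  have mono: "I m \<subseteq> I n" if "m \<le> n" for m n using that by (auto simp: I_def)
  have SUP: "(\<Sum>\<^sub>\<infinity>e\<in>E. f e x) = (SUP n. \<Sum>e\<in>I n. f e x)" for x
  proof (rule antisym)
    show "(\<Sum>\<^sub>\<infinity>e\<in>E. f e x) \<le> (SUP n. \<Sum>e\<in>I n. f e x)"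
      unfolding nonneg_infsum_complete[OF zero_le]
    proof (rule SUP_least)
      fix F assume F: "F \<in> {F. finite F \<and> F \<subseteq> E}"
      have "\<exists>n. F \<subseteq> I n"
      proof -
        define n where "n = Suc (Max (insert 0 (to_nat_on E ` F)))"
        have "e \<in> I n" if "e \<in> F" for e
        proof -
          have "to_nat_on E e < n" using F that by (auto simp: n_def less_Suc_eq_le)
          moreover have "from_nat_into E (to_nat_on E e) = e" using F that E by auto
          ultimately show ?thesis unfolding I_def by (metis imageI lessThan_iff)
        qed
        then show ?thesis by blast
      qed
      then obtain n where "F \<subseteq> I n" by blast
      then have "(\<Sum>e\<in>F. f e x) \<le> (\<Sum>e\<in>I n. f e x)" using I(1) by (intro sum_mono2) auto
      then show "(\<Sum>e\<in>F. f e x) \<le> (SUP n. \<Sum>e\<in>I n. f e x)" by (rule SUP_upper2[rotated]) simp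
    qed
    show "(SUP n. \<Sum>e\<in>I n. f e x) \<le> (\<Sum>\<^sub>\<infinity>e\<in>E. f e x)"
      unfolding nonneg_infsum_complete[OF zero_le]
      using I by (intro SUP_least SUP_upper) auto
  qed
  have "(\<integral>\<^sup>+x. (SUP n. \<Sum>e\<in>I n. f e x) \<partial>M) = (SUP n. \<integral>\<^sup>+x. (\<Sum>e\<in>I n. f e x) \<partial>M)"
  proof (rule nn_integral_monotone_convergence_SUP)
    show "incseq (\<lambda>n x. \<Sum>e\<in>I n. f e x)"
      using mono I(1) by (auto simp: incseq_def le_fun_def intro!: sum_mono2)
    show "(\<lambda>x. \<Sum>e\<in>I n. f e x) \<in> borel_measurable M" for n
      by (rule borel_measurable_sum) (use f I in auto)
  qed
  also have "\<dots> \<le> B"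
  proof (rule SUP_least)
    fix n
    have "(\<integral>\<^sup>+x. (\<Sum>e\<in>I n. f e x) \<partial>M) = (\<Sum>e\<in>I n. \<integral>\<^sup>+x. f e x \<partial>M)"
      by (rule nn_integral_sum) (use f I in auto)
    then show "(\<integral>\<^sup>+x. (\<Sum>e\<in>I n. f e x) \<partial>M) \<le> B" using B[OF I] by simp
  qed
  finally show ?thesis unfolding SUP .
qed simp

lemma esqrt_le:
  assumes "x \<le> ennreal (r\<^sup>2)" "0 \<le> r"
  shows "esqrt x \<le> ennreal r"
  using assms by (auto simp: esqrt_def top_unique intro!: ennreal_leI real_le_lsqrt enn2real_leI)

context integrable_cov_process
begin

text \<open>The elementary |x + y|^2 <= 2 |x|^2 + 2 |y|^2 is applied at each basis vector; the sum
  over \<open>E\<close> is taken under the expectation through finite sections.\<close>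

lemma mean_square_error_le:
  assumes v: "\<And>F. finite F \<Longrightarrow> F \<subseteq> E \<Longrightarrow>
      est_variance M X K N \<delta> \<Delta> \<theta> F \<le> v"
    and b: "\<And>F. finite F \<Longrightarrow> F \<subseteq> E \<Longrightarrow>
      est_bias M X C K N \<delta> \<Delta> \<theta> F \<le> b"
    and pos: "0 \<le> v" "0 \<le> b"
  shows "(\<integral>\<^sup>+\<omega>. (hs_norm E (spec_estimator X K N \<delta> \<Delta> \<theta> \<omega> - spectral_density C \<theta>))\<^sup>2 \<partial>M) \<le> ennreal (2 * v + 2 * b\<^sup>2)"
proof -
  define Y where "Y \<omega> e = spec_estimator X K N \<delta> \<Delta> \<theta> \<omega> e" for \<omega> e
  define m where "m e = op_integral M (spec_estimator X K N \<delta> \<Delta> \<theta>) e" for e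
  define g where "g e = spectral_density C \<theta> e" for e
  have [measurable]: "(\<lambda>\<omega>. Y \<omega> e) \<in> borel_measurable M" for e
    unfolding Y_def spec_estimator_eq by measurable
  \<comment> \<open>Only the integrability claim is taken, so the empty section serves.\<close>
  have int: "integrable M (\<lambda>\<omega>. (norm (Y \<omega> e - m e))\<^sup>2)" for e
    using variance_quadratic_form(1)[of "grid N \<delta> \<times> grid N \<delta>" "{}" "\<lambda>p. est_coef K N \<delta> \<Delta> \<theta> (fst p - snd p)" e]
    by (simp add: Y_def m_def spec_estimator_eq mean_spec_estimator scaleC_diff_right sum_subtractf)
  have "(hs_norm E (spec_estimator X K N \<delta> \<Delta> \<theta> \<omega> - spectral_density C \<theta>))\<^sup>2 = (\<Sum>\<^sub>\<infinity>e\<in>E. ennreal ((norm (Y \<omega> e - g e))\<^sup>2))" for \<omega>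
    using bounded_clinear_diff[OF bounded_clinear_spec_estimator bounded_clinear_spectral_density]
    by (subst hs_norm_power2) (simp_all add: fun_diff_def Y_def g_def)
  then have "(\<integral>\<^sup>+\<omega>. (hs_norm E (spec_estimator X K N \<delta> \<Delta> \<theta> \<omega> - spectral_density C \<theta>))\<^sup>2 \<partial>M)
      = (\<integral>\<^sup>+\<omega>. (\<Sum>\<^sub>\<infinity>e\<in>E. ennreal ((norm (Y \<omega> e - g e))\<^sup>2)) \<partial>M)" by simp
  also have "\<dots> \<le> ennreal (2 * v + 2 * b\<^sup>2)"
  proof (rule nn_integral_infsum_le[OF countable_cons[OF E]])
    fix F assume F: "finite F" "F \<subseteq> E"
    have "(\<integral>\<^sup>+\<omega>. ennreal ((norm (Y \<omega> e - g e))\<^sup>2) \<partial>M)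
        \<le> ennreal (2 * (\<integral>\<omega>. (norm (Y \<omega> e - m e))\<^sup>2 \<partial>M) + 2 * (norm (m e - g e))\<^sup>2)" for e
    proof -
      have "(\<integral>\<^sup>+\<omega>. ennreal ((norm (Y \<omega> e - g e))\<^sup>2) \<partial>M)
          \<le> (\<integral>\<^sup>+\<omega>. ennreal (2 * (norm (Y \<omega> e - m e))\<^sup>2 + 2 * (norm (m e - g e))\<^sup>2) \<partial>M)"
      proof (intro nn_integral_mono ennreal_leI)
        fix \<omega>
        have "norm (Y \<omega> e - g e) \<le> norm (Y \<omega> e - m e) + norm (m e - g e)"
          using norm_triangle_ineq[of "Y \<omega> e - m e" "m e - g e"] by simp
        then have "(norm (Y \<omega> e - g e))\<^sup>2 \<le> (norm (Y \<omega> e - m e) + norm (m e - g e))\<^sup>2"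
          by (intro power_mono) auto
        also have "\<dots> \<le> 2 * (norm (Y \<omega> e - m e))\<^sup>2 + 2 * (norm (m e - g e))\<^sup>2"
          using zero_le_power2[of "norm (Y \<omega> e - m e) - norm (m e - g e)"]
          by (simp add: power2_sum power2_diff)
        finally show "(norm (Y \<omega> e - g e))\<^sup>2 \<le> 2 * (norm (Y \<omega> e - m e))\<^sup>2 + 2 * (norm (m e - g e))\<^sup>2" .
      qed
      also have "\<dots> = ennreal (\<integral>\<omega>. 2 * (norm (Y \<omega> e - m e))\<^sup>2 + 2 * (norm (m e - g e))\<^sup>2 \<partial>M)"
        using int by (intro nn_integral_eq_integral) auto
      also have "(\<integral>\<omega>. 2 * (norm (Y \<omega> e - m e))\<^sup>2 + 2 * (norm (m e - g e))\<^sup>2 \<partial>M)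
          = 2 * (\<integral>\<omega>. (norm (Y \<omega> e - m e))\<^sup>2 \<partial>M) + 2 * (norm (m e - g e))\<^sup>2"
        using int by (simp add: prob_space)
      finally show ?thesis .
    qed
    then have "(\<Sum>e\<in>F. \<integral>\<^sup>+\<omega>. ennreal ((norm (Y \<omega> e - g e))\<^sup>2) \<partial>M)
        \<le> (\<Sum>e\<in>F. ennreal (2 * (\<integral>\<omega>. (norm (Y \<omega> e - m e))\<^sup>2 \<partial>M) + 2 * (norm (m e - g e))\<^sup>2))"
      by (intro sum_mono)
    also have "\<dots> = ennreal (\<Sum>e\<in>F. 2 * (\<integral>\<omega>. (norm (Y \<omega> e - m e))\<^sup>2 \<partial>M) + 2 * (norm (m e - g e))\<^sup>2)"
      by (rule sum_ennreal) (auto intro!: add_nonneg_nonneg)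
    also have "(\<Sum>e\<in>F. 2 * (\<integral>\<omega>. (norm (Y \<omega> e - m e))\<^sup>2 \<partial>M) + 2 * (norm (m e - g e))\<^sup>2)
        = 2 * (\<Sum>e\<in>F. \<integral>\<omega>. (norm (Y \<omega> e - m e))\<^sup>2 \<partial>M) + 2 * (L2_set (\<lambda>e. norm (m e - g e)) F)\<^sup>2"
      by (simp add: sum.distrib sum_distrib_left L2_set_def sum_nonneg)
    also have "ennreal \<dots> \<le> ennreal (2 * v + 2 * b\<^sup>2)"
      using v[OF F] b[OF F] by (intro ennreal_leI add_mono mult_left_mono power_mono) (auto simp: Y_def m_def g_def)
    finally show "(\<Sum>e\<in>F. \<integral>\<^sup>+\<omega>. ennreal ((norm (Y \<omega> e - g e))\<^sup>2) \<partial>M) \<le> ennreal (2 * v + 2 * b\<^sup>2)" .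
  qed measurable
  finally show ?thesis .
qed

end

theorem theorem5p3:
  fixes E :: "'h::separable_chilbert set"
    and M :: "'w measure"
    and X :: "real^'d \<Rightarrow> 'w \<Rightarrow> 'h"
    and C f :: "real^'d \<Rightarrow> 'h \<Rightarrow> 'h"
    and K :: "real^'d \<Rightarrow> real"
    and N :: "nat \<Rightarrow> 'd \<Rightarrow> nat"
    and \<delta> \<Delta> :: "nat \<Rightarrow> real"
    and \<beta> L \<gamma> :: real
  assumes E: "is_cons E"
    and \<beta>: "\<beta> > 0" and L: "L > 0"
    and M: "prob_space M"
    and X_meas: "\<And>t. X t \<in> borel_measurable M"
    and X_real: "\<And>t \<omega>. \<omega> \<in> space M \<Longrightarrow> is_real E (X t \<omega>)"
    and X_second: "\<And>t. integrable M (\<lambda>\<omega>. (norm (X t \<omega>))\<^sup>2)"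
    and X_mean: "\<And>t. (\<integral>\<omega>. X t \<omega> \<partial>M) = 0"
    and X_stat: "so_stationary M X C"
    and f: "in_power_law_class E \<beta> L C f"
    and covariance: "covariance_cond E C \<gamma>"
    and kernel: "kernel_cond \<beta> K"
    and sampling: "sampling_cond N \<delta>"
    and fourth_order: "fourth_order_cond E M X"
    and bandwidth: "bandwidth_cond K N \<delta> \<Delta>"
  shows "(\<forall>\<Theta>. bounded \<Theta> \<longrightarrow>
           (\<exists>c::real. \<forall>\<^sub>F n in sequentially.
              (SUP \<theta>\<in>\<Theta>. hs_norm E
                 (op_integral M (spec_estimator X K (N n) (\<delta> n) (\<Delta> n) \<theta>) - f \<theta>))
              \<le> ennreal (c * (\<delta> n powr \<gamma> + \<Delta> n powr (- \<beta>)))))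
       \<and> ((\<forall>n. \<Delta> n = measure lebesgue (region (N n) (\<delta> n)) powr (1 / (2 * \<beta> + CARD('d)))) \<longrightarrow>
          (\<forall>\<Theta>. bounded \<Theta> \<longrightarrow>
            (\<exists>c::real. \<forall>\<^sub>F n in sequentially.
               (SUP \<theta>\<in>\<Theta>. esqrt (\<integral>\<^sup>+\<omega>. (hs_norm E
                  (spec_estimator X K (N n) (\<delta> n) (\<Delta> n) \<theta> \<omega> - f \<theta>))\<^sup>2 \<partial>M))
               \<le> ennreal (c * max (\<delta> n powr \<gamma>)
                    (measure lebesgue (region (N n) (\<delta> n)) powr (- \<beta> / (2 * \<beta> + CARD('d))))))))"
proof -
  interpret prob_space M by (rule M)
  interpret integrable_cov_process M E X C \<gamma>
    by unfold_locales (use E X_meas X_real X_stat covariance fourth_order in \<open>auto simp: fourth_order_cond_def\<close>)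
  define d where "d = real CARD('d)"
  have d: "d \<ge> 1" by (simp add: d_def Suc_leI)
  define V where "V n = volume (N n) (\<delta> n)" for n
  obtain R c where R: "R > 0" and c: "c \<ge> 0" and supp: "\<And>u. K u \<noteq> 0 \<Longrightarrow> norm u \<le> R"
    and K_Lipschitz: "\<And>x y. \<bar>K x - K y\<bar> \<le> c * norm (x - y)" and K_flat: "\<And>u. \<bar>K u - 1\<bar> \<le> c * norm u powr \<beta>"
    using kernel_estimates[OF \<beta> kernel] by metis
  have K: "continuous_on UNIV K" "\<And>u. 0 \<le> K u" "\<And>u. \<bar>K u\<bar> \<le> 1"
    using kernel by (auto simp: kernel_cond_def)
  have f_eq: "f = spectral_density C"
    and L_bound: "(\<integral>\<^sup>+x. ennreal (1 + norm x powr \<beta>) * trace_norm E (C x) \<partial>lebesgue) \<le> ennreal L"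
    using f by (simp_all add: in_power_law_class_def)
  have \<delta>: "\<And>n. \<delta> n > 0" "\<delta> \<longlonglongrightarrow> 0" and V_top: "filterlim V at_top sequentially"
    and N: "\<And>l. filterlim (\<lambda>n. N n l) at_top sequentially"
    using sampling by (simp_all add: sampling_cond_def V_def[abs_def])
  have \<Delta>: "\<And>n. \<Delta> n > 0" "filterlim \<Delta> at_top sequentially"
    and \<Delta>_sub: "\<And>n. (\<lambda>t. \<Delta> n *\<^sub>R t) ` {t. K t > 0} \<subseteq> set_diff (region (N n) (\<delta> n)) (region (N n) (\<delta> n))"
    and \<Delta>_lim: "(\<lambda>n. \<Delta> n ^ CARD('d) / volume (N n) (\<delta> n)) \<longlonglongrightarrow> 0"
    using bandwidth by (simp_all add: bandwidth_cond_def)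
  have ev_\<delta>: "\<forall>\<^sub>F n in sequentially. \<delta> n < r" if "r > 0" for r
    using \<delta>(2) that by (rule order_tendstoD)
  have ev_\<Delta>: "\<forall>\<^sub>F n in sequentially. \<Delta> n \<ge> 1"
    using \<Delta>(2) by (simp add: filterlim_at_top)
  have "\<forall>\<^sub>F n in sequentially. N n l \<ge> 1" for l
    using N[of l] by (simp add: filterlim_at_top)
  then have "\<forall>\<^sub>F n in sequentially. \<forall>l. N n l \<ge> 1"
    by (rule eventually_all_finite)
  then have ev_lag: "\<forall>\<^sub>F n in sequentially. \<forall>m. m \<notin> lag_box (N n) \<longrightarrow> K (latt (\<delta> n) m /\<^sub>R \<Delta> n) = 0"
  proof eventually_elim
    case (elim n)
    then show ?case
      using kernel_lag_support[OF K(1,2) \<delta>(1) \<Delta>(1) _ \<Delta>_sub, of n] by blast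
  qed
  \<comment> \<open>Shared by both claims. The constant depends on \<Theta> through a radius b, but
    not on n, \<theta> or \<open>F\<close>.\<close>
  have bias: "\<exists>c0\<ge>0. \<forall>\<^sub>F n in sequentially. \<forall>\<theta>\<in>\<Theta>. \<forall>F. finite F \<longrightarrow> F \<subseteq> E \<longrightarrow>
      est_bias M X C K (N n) (\<delta> n) (\<Delta> n) \<theta> F
        \<le> c0 * (\<delta> n powr \<gamma> + \<Delta> n powr (- \<beta>))" if \<Theta>: "bounded \<Theta>" for \<Theta>
  proof -
    obtain b where b: "b > 0" "\<And>\<theta>. \<theta> \<in> \<Theta> \<Longrightarrow> norm \<theta> \<le> b"
      using \<Theta> by (auto simp: bounded_pos)
    obtain c0 where c0: "c0 \<ge> 0" "\<And>N (\<delta>::real) \<Delta> \<theta> F. 0 < \<delta> \<Longrightarrow> CARD('d) * \<delta> < 1 \<Longrightarrow> \<Delta> \<ge> 1 \<Longrightarrow>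
       (\<And>m. m \<notin> lag_box N \<Longrightarrow> K (latt \<delta> m /\<^sub>R \<Delta>) = 0) \<Longrightarrow> norm \<theta> \<le> b \<Longrightarrow> finite F \<Longrightarrow> F \<subseteq> E \<Longrightarrow>
       est_bias M X C K N \<delta> \<Delta> \<theta> F
         \<le> c0 * (\<delta> powr \<gamma> + \<Delta> powr (- \<beta>))"
      using bias_bound[OF K(3) K_Lipschitz K_flat c less_imp_le[OF b(1)] less_imp_le[OF L] \<beta> L_bound] by blast
    have "\<forall>\<^sub>F n in sequentially. \<delta> n < 1 / CARD('d)" by (rule ev_\<delta>) simp
    then have "\<forall>\<^sub>F n in sequentially. \<forall>\<theta>\<in>\<Theta>. \<forall>F. finite F \<longrightarrow> F \<subseteq> E \<longrightarrow>
      est_bias M X C K (N n) (\<delta> n) (\<Delta> n) \<theta> F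
        \<le> c0 * (\<delta> n powr \<gamma> + \<Delta> n powr (- \<beta>))"
      using ev_\<Delta> ev_lag
    proof eventually_elim
      case (elim n)
      have "CARD('d) * \<delta> n < 1" using elim(1) by (simp add: pos_less_divide_eq mult.commute)
      then show ?case
        using elim(2,3) b(2) by (intro ballI allI impI c0(2) \<delta>(1)) auto
    qed
    then show ?thesis using c0(1) by blast
  qed
  show ?thesis
  proof (intro conjI impI allI)
    fix \<Theta> :: "(real^'d) set" assume \<Theta>: "bounded \<Theta>"
    obtain c0 where c0: "c0 \<ge> 0" "\<forall>\<^sub>F n in sequentially. \<forall>\<theta>\<in>\<Theta>. \<forall>F. finite F \<longrightarrow> F \<subseteq> E \<longrightarrow>
      est_bias M X C K (N n) (\<delta> n) (\<Delta> n) \<theta> F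
        \<le> c0 * (\<delta> n powr \<gamma> + \<Delta> n powr (- \<beta>))"
      using bias[OF \<Theta>] by blast
    from c0(2) have "\<forall>\<^sub>F n in sequentially.
        (SUP \<theta>\<in>\<Theta>. hs_norm E (op_integral M (spec_estimator X K (N n) (\<delta> n) (\<Delta> n) \<theta>) - f \<theta>))
          \<le> ennreal (c0 * (\<delta> n powr \<gamma> + \<Delta> n powr (- \<beta>)))"
    proof eventually_elim
      case (elim n)
      show ?case
      proof (rule SUP_least, rule hs_norm_le)
        fix \<theta> assume "\<theta> \<in> \<Theta>"
        show "bounded_clinear (op_integral M (spec_estimator X K (N n) (\<delta> n) (\<Delta> n) \<theta>) - f \<theta>)"
          using bounded_clinear_diff[OF bounded_clinear_mean_spec_estimator bounded_clinear_spectral_density]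
          by (simp add: fun_diff_def f_eq)
        show "L2_set (\<lambda>e. norm ((op_integral M (spec_estimator X K (N n) (\<delta> n) (\<Delta> n) \<theta>) - f \<theta>) e)) F
            \<le> c0 * (\<delta> n powr \<gamma> + \<Delta> n powr (- \<beta>))" if "finite F" "F \<subseteq> E" for F
          using elim \<open>\<theta> \<in> \<Theta>\<close> that by (simp add: f_eq)
      qed (use c0(1) in simp)
    qed
    then show "\<exists>c::real. \<forall>\<^sub>F n in sequentially.
        (SUP \<theta>\<in>\<Theta>. hs_norm E (op_integral M (spec_estimator X K (N n) (\<delta> n) (\<Delta> n) \<theta>) - f \<theta>))
          \<le> ennreal (c * (\<delta> n powr \<gamma> + \<Delta> n powr (- \<beta>)))" ..
  next
    fix \<Theta> :: "(real^'d) set"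
    assume \<Delta>_eq: "\<forall>n. \<Delta> n = volume (N n) (\<delta> n) powr (1 / (2 * \<beta> + real CARD('d)))"
      and \<Theta>: "bounded \<Theta>"
    obtain c0 where c0: "c0 \<ge> 0" "\<forall>\<^sub>F n in sequentially. \<forall>\<theta>\<in>\<Theta>. \<forall>F. finite F \<longrightarrow> F \<subseteq> E \<longrightarrow>
      est_bias M X C K (N n) (\<delta> n) (\<Delta> n) \<theta> F
        \<le> c0 * (\<delta> n powr \<gamma> + \<Delta> n powr (- \<beta>))"
      using bias[OF \<Theta>] by blast
    obtain c1 \<delta>1 where c1: "c1 \<ge> 0" "\<delta>1 > 0" "\<And>\<delta> N \<Delta> \<theta> F. 0 < \<delta> \<Longrightarrow> \<delta> < \<delta>1 \<Longrightarrow> \<delta> \<le> \<Delta> \<Longrightarrow>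
       0 < volume N \<delta> \<Longrightarrow>
       (\<And>h. K (h /\<^sub>R \<Delta>) \<noteq> 0 \<Longrightarrow>
          volume N \<delta> \<le> 2 ^ CARD('d) * overlap N \<delta> h) \<Longrightarrow>
       finite F \<Longrightarrow> F \<subseteq> E \<Longrightarrow>
       est_variance M X K N \<delta> \<Delta> \<theta> F
         \<le> c1 * (\<Delta> ^ CARD('d) / volume N \<delta>)"
      using variance_bound[where K = K and R = R, OF fourth_order K(3)] supp R by blast
    have "\<forall>\<^sub>F n in sequentially. V n > 0" using V_top by (simp add: filterlim_at_top_dense)
    \<comment> \<open>The constant arises from r = 2 sqrt c1 \<rho> + 2 c0 (\<delta>^\<gamma> +
      \<rho>), each term being estimated by the maximum.\<close>
    then have "\<forall>\<^sub>F n in sequentially.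
        (SUP \<theta>\<in>\<Theta>. esqrt (\<integral>\<^sup>+\<omega>. (hs_norm E (spec_estimator X K (N n) (\<delta> n) (\<Delta> n) \<theta> \<omega> - f \<theta>))\<^sup>2 \<partial>M))
          \<le> ennreal ((2 * sqrt c1 + 4 * c0) * max (\<delta> n powr \<gamma>)
              (volume (N n) (\<delta> n) powr (- \<beta> / (2 * \<beta> + real CARD('d)))))"
      using c0(2) ev_\<delta>[OF c1(2)] ev_\<delta>[OF zero_less_one] ev_\<Delta>
        region_overlap[OF sampling \<Delta>(1) R \<Delta>_lim]
    proof eventually_elim
      case (elim n)
      define \<rho> where "\<rho> = V n powr (- \<beta> / (2 * \<beta> + d))"
      define v where "v = c1 * (\<Delta> n ^ CARD('d) / V n)"
      define b where "b = c0 * (\<delta> n powr \<gamma> + \<Delta> n powr (- \<beta>))"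
      have den: "2 * \<beta> + d > 0" using \<beta> d by simp
      have \<Delta>n: "\<Delta> n = V n powr (1 / (2 * \<beta> + d))" using \<Delta>_eq by (simp add: V_def d_def)
      have \<Delta>\<beta>: "\<Delta> n powr (- \<beta>) = \<rho>"
        unfolding \<Delta>n \<rho>_def by (simp add: powr_powr)
      \<comment> \<open>For this bandwidth the exponent d / (2 \<beta> + d) - 1 equals -2 \<beta> /
        (2 \<beta> + d), so the variance rate is the square of the bias rate \<rho> =
        \<Delta>^(-\<beta>).\<close>
      have "\<Delta> n ^ CARD('d) / V n = \<Delta> n powr d / V n powr 1"
        using \<Delta>(1)[of n] elim(1) by (simp add: d_def powr_realpow)
      also have "\<dots> = V n powr (d / (2 * \<beta> + d) - 1)"
        unfolding \<Delta>n by (simp add: powr_powr powr_diff)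
      also have "d / (2 * \<beta> + d) - 1 = - \<beta> / (2 * \<beta> + d) + - \<beta> / (2 * \<beta> + d)"
        unfolding add_divide_distrib[symmetric] using den by (simp add: field_simps)
      also have "V n powr \<dots> = \<rho>\<^sup>2"
        unfolding \<rho>_def power2_eq_square by (rule powr_add)
      finally have v_eq: "v = c1 * \<rho>\<^sup>2" by (simp add: v_def)
      have \<rho>0: "\<rho> \<ge> 0" by (simp add: \<rho>_def)
      have v0: "v \<ge> 0" and b0: "b \<ge> 0" using c1(1) c0(1) by (simp_all add: v_eq b_def)
      \<comment> \<open>Its square is 4 v + 4 b^2 plus a nonnegative cross term, which dominates the
        mean square bound and makes the root explicit.\<close>
      define r where "r = 2 * (sqrt c1 * \<rho>) + 2 * b"
      have r0: "r \<ge> 0" using c1(1) \<rho>0 b0 by (simp add: r_def)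
      have "2 * v + 2 * b\<^sup>2 \<le> r\<^sup>2"
      proof -
        have "r\<^sup>2 = 4 * v + 8 * (sqrt c1 * \<rho> * b) + 4 * b\<^sup>2"
          using c1(1) by (simp add: r_def v_eq power2_sum power_mult_distrib)
        moreover have "0 \<le> sqrt c1 * \<rho> * b" using c1(1) \<rho>0 b0 by simp
        ultimately show ?thesis using v0 by (smt (verit) zero_le_power2)
      qed
      have "(SUP \<theta>\<in>\<Theta>. esqrt (\<integral>\<^sup>+\<omega>. (hs_norm E (spec_estimator X K (N n) (\<delta> n) (\<Delta> n) \<theta> \<omega> - f \<theta>))\<^sup>2 \<partial>M)) \<le> ennreal r"
      proof (rule SUP_least, rule esqrt_le[OF _ r0])
        fix \<theta> assume \<theta>: "\<theta> \<in> \<Theta>"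
        have "(\<integral>\<^sup>+\<omega>. (hs_norm E (spec_estimator X K (N n) (\<delta> n) (\<Delta> n) \<theta> \<omega> - f \<theta>))\<^sup>2 \<partial>M) \<le> ennreal (2 * v + 2 * b\<^sup>2)"
          unfolding f_eq
        proof (rule mean_square_error_le[OF _ _ v0 b0])
          fix F assume F: "finite F" "F \<subseteq> E"
          show "est_variance M X K (N n) (\<delta> n) (\<Delta> n) \<theta> F \<le> v"
            unfolding v_def V_def
          proof (rule c1(3)[OF \<delta>(1) _ _ _ _ F])
            show "\<delta> n < \<delta>1" "\<delta> n \<le> \<Delta> n" "0 < volume (N n) (\<delta> n)"
              using elim by (auto simp: V_def)
            fix h assume "K (h /\<^sub>R \<Delta> n) \<noteq> 0"
            then have "norm (h /\<^sub>R \<Delta> n) \<le> R" by (rule supp)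
            then have "norm h \<le> \<Delta> n * R"
            proof -
              have "norm (h /\<^sub>R \<Delta> n) = norm h / \<Delta> n"
                using \<Delta>(1)[of n] by (simp add: divide_inverse mult.commute)
              then show ?thesis
                using \<open>norm (h /\<^sub>R \<Delta> n) \<le> R\<close> \<Delta>(1)[of n] by (simp add: pos_divide_le_eq mult.commute)
            qed
            then show "volume (N n) (\<delta> n)
                \<le> 2 ^ CARD('d) * overlap (N n) (\<delta> n) h"
              using elim(6) by blast
          qed
          show "est_bias M X C K (N n) (\<delta> n) (\<Delta> n) \<theta> F \<le> b"
            unfolding b_def using elim(2) \<theta> F by blast
        qed
        also have "\<dots> \<le> ennreal (r\<^sup>2)" by (rule ennreal_leI) fact
        finally show "(\<integral>\<^sup>+\<omega>. (hs_norm E (spec_estimator X K (N n) (\<delta> n) (\<Delta> n) \<theta> \<omega> - f \<theta>))\<^sup>2 \<partial>M) \<le> ennreal (r\<^sup>2)" .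
      qed
      also have "r \<le> (2 * sqrt c1 + 4 * c0) * max (\<delta> n powr \<gamma>) \<rho>"
      proof -
        have "r = 2 * sqrt c1 * \<rho> + 2 * c0 * (\<delta> n powr \<gamma>) + 2 * c0 * \<rho>"
          by (simp add: r_def b_def \<Delta>\<beta> algebra_simps)
        also have "\<dots> \<le> 2 * sqrt c1 * max (\<delta> n powr \<gamma>) \<rho> + 2 * c0 * max (\<delta> n powr \<gamma>) \<rho> + 2 * c0 * max (\<delta> n powr \<gamma>) \<rho>"
          using c0(1) c1(1) by (intro add_mono mult_left_mono) auto
        finally show ?thesis by (simp add: algebra_simps)
      qed
      then have "ennreal r \<le> ennreal ((2 * sqrt c1 + 4 * c0) * max (\<delta> n powr \<gamma>) \<rho>)" by (rule ennreal_leI)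
      finally show ?case by (simp add: \<rho>_def V_def d_def)
    qed
    then show "\<exists>c::real. \<forall>\<^sub>F n in sequentially.
        (SUP \<theta>\<in>\<Theta>. esqrt (\<integral>\<^sup>+\<omega>. (hs_norm E (spec_estimator X K (N n) (\<delta> n) (\<Delta> n) \<theta> \<omega> - f \<theta>))\<^sup>2 \<partial>M))
          \<le> ennreal (c * max (\<delta> n powr \<gamma>)
              (volume (N n) (\<delta> n) powr (- \<beta> / (2 * \<beta> + real CARD('d)))))" ..
  qed
qed

end
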